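(* Let $\Pi$ be a non-recursive stratified datalog program and $Q\in\mathrm{Int}(\Pi)$. Then $\mathrm{fotw}(\varphi_{\Pi_Q})\le\mathrm{tw}(G_{\varphi_{\Pi_Q}},\mathrm{ad}'_{\varphi_{\Pi_Q}})\le\mathrm{stw}(\Pi)$.
   Context: A datalog rule with negation $\rho$ is $Qx_1\dots x_l\leftarrow\bigwedge_{i=1}^n\lambda_i$ with $Q$ a relation symbol, $\lambda_i$ literals, and $x_1,\dots,x_l$ pairwise distinct variables occurring in the body; with $\bar y$ the remaining body variables, $\varphi_\rho(x_1,\dots,x_l):=\exists\bar y\bigwedge_i\lambda_i$. A non-recursive stratified datalog program is a sequence $\Pi=(\Pi^1,\dots,\Pi^n)$ of non-recursive datalog programs (strata, finite sets of such rules) in the sense of Flum–Frick–Grohe; $\mathrm{Int}(\Pi)$ is its set of intensional (head) relation symbols and $\mathrm{ext}(\Pi)$ its extensional vocabulary. For $Q\in\mathrm{Int}(\Pi^i)$, $\bar\varphi_{\Pi_Q}:=\bigvee\{\varphi_\rho:\rho\in\Pi^i,\ Q \text{ in the head of } \rho\}$ and $\varphi_{\Pi_Q}:=\bigvee\{\varphi^*_\rho:\rho\in\Pi^i,\ Q\text{ in the head of }\rho\}$, where $\varphi^*_\rho$ is obtained from $\varphi_\rho$ by recursively replacing each intensional symbol $Q'$ by the corresponding formula $\bar\varphi_{\Pi_{Q'}}$, so $\varphi_{\Pi_Q}$ is an $\mathrm{ext}(\Pi)$-formula (taken straight, i.e. bound variables renamed apart, and in negation normal form). The strict tree-width is $\mathrm{stw}(\rho):=\mathrm{tw}(G_{\varphi_\rho})$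 and $\mathrm{stw}(\Pi):=\max\{\mathrm{stw}(\rho):\rho\in\bigcup_i\Pi^i\}$. For a formula $\varphi$: $G_\varphi$ has vertex set $\mathrm{var}(\varphi)$ and an edge $\{x,y\}$ ($x\neq y$) whenever $x,y$ are both free or occur together in some atom. For bound $x$, $Q_x$ is its quantifier, its scope the $\psi$ with $Q_xx\psi$ a subformula; $x\le_\varphi y$ means $x=y$ or $y$ is quantified in the scope of $x$. $\mathrm{ad}'_\varphi(x)=0$ for free $x$; for bound $x$ it is $1$ plus the maximum over sequences $v_1,\dots,v_m=x$ with $v_i\le_\varphi v_{i+1}$, $v_i\ne v_{i+1}$, of the number of $i$ with $Q_{v_i}\ne Q_{v_{i+1}}$. $\varphi_{[X]}$ is the minimal subformula containing all atoms using variables from $X$; $x,y$ are entangled w.r.t. a relation $\trianglelefteq$ if $x$ occurs in $\varphi_{[\{z:y\trianglelefteq z\}]}$ and $y$ occurs in $\varphi_{[\{z:x\trianglelefteq z\}]}$. $\preceq_\varphi$ is the smallest reflexive, transitive relation on $\mathrm{var}(\varphi)$ such that: if $x\le_\varphi y$, $Q_x\ne Q_y$, and there is a sequence $x=z_0,\dots,z_n=y$ of bound variables with $z_i,z_{i+1}$ entangled w.r.t. $\preceq_\varphi$ and ($x\preceq_\varphi z_i$ or $y\preceq_\varphi z_i$) for all $0\le i<n$, then $x\preceq_\varphi y$. $\mathrm{ead}_\varphi(x)=0$ for free $x$; for bound $x$ it is the maximum over sequences $v_1,\dots,v_m=x$ with $v_i\preceq_\varphi v_{i+1}$, $v_i\neq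 v_{i+1}$ of the number of $i$ with $Q_{v_i}\ne Q_{v_{i+1}}$, plus 1 if $Q_{v_1}=\exists$, plus 2 if $Q_{v_1}=\forall$. A tree decomposition $(T,B)$ of $G$ (rooted tree, pieces covering vertices and edges, connected occurrence sets, width $\max|B_t|-1$) is $d$-stratified if $t_u<_Tt_v$ implies $d(u)\le d(v)$, $t_v$ being the node nearest the root whose piece contains $v$; $\mathrm{tw}(G,d)$ is the minimum such width, $\mathrm{tw}(G)$ the ordinary tree-width, and $\mathrm{fotw}(\varphi):=\mathrm{tw}(G_\varphi,\mathrm{ead}_\varphi)$. *)

theory Defs
  imports Complex_Main "HOL-Library.Sublist"
begin

section \<open>First-order formulas\<close>

datatype quantifier = Exists | Forall

datatype (syms: 'r, vars: 'v) fm =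
    Rel 'r "'v list"
  | Eq 'v 'v
  | Neg "('r, 'v) fm"
  | Conj "('r, 'v) fm list"
  | Disj "('r, 'v) fm list"
  | Quant quantifier 'v "('r, 'v) fm"

text \<open>The set function \<^const>\<open>vars\<close> generated by the datatype also collects the variables next to
  quantifiers, so it is the set of all free and bound variables.\<close>

type_synonym 'r formula = "('r, nat) fm"

fun is_atom :: "'r formula \<Rightarrow> bool" where
  "is_atom (Rel R xs) = True"
| "is_atom (Eq x y) = True"
| "is_atom _ = False"

fun is_literal :: "'r formula \<Rightarrow> bool" where
  "is_literal (Neg \<phi>) = is_atom \<phi>"
| "is_literal \<phi> = is_atom \<phi>"

fun free_vars :: "'r formula \<Rightarrow> nat set" where
  "free_vars (Rel R xs) = set xs"
| "free_vars (Eq x y) = {x, y}"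
| "free_vars (Neg \<phi>) = free_vars \<phi>"
| "free_vars (Conj \<phi>s) = (\<Union>\<phi> \<in> set \<phi>s. free_vars \<phi>)"
| "free_vars (Disj \<phi>s) = (\<Union>\<phi> \<in> set \<phi>s. free_vars \<phi>)"
| "free_vars (Quant q x \<phi>) = free_vars \<phi> - {x}"

fun quantified :: "'r formula \<Rightarrow> nat list" where
  "quantified (Rel R xs) = []"
| "quantified (Eq x y) = []"
| "quantified (Neg \<phi>) = quantified \<phi>"
| "quantified (Conj \<phi>s) = concat (map quantified \<phi>s)"
| "quantified (Disj \<phi>s) = concat (map quantified \<phi>s)"
| "quantified (Quant q x \<phi>) = x # quantified \<phi>"

abbreviation bound_vars :: "'r formula \<Rightarrow> nat set" where
  "bound_vars \<phi> \<equiv> set (quantified \<phi>)"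

definition straight :: "'r formula \<Rightarrow> bool" where
  "straight \<phi> \<longleftrightarrow> distinct (quantified \<phi>) \<and> free_vars \<phi> \<inter> bound_vars \<phi> = {}"

fun dual :: "quantifier \<Rightarrow> quantifier" where
  "dual Exists = Forall"
| "dual Forall = Exists"

text \<open>\<open>nnf True \<phi>\<close> and \<open>nnf False \<phi>\<close> are the negation normal forms of \<open>\<phi>\<close> and of its negation.\<close>

fun nnf :: "bool \<Rightarrow> 'r formula \<Rightarrow> 'r formula" where
  "nnf b (Rel R xs) = (if b then Rel R xs else Neg (Rel R xs))"
| "nnf b (Eq x y) = (if b then Eq x y else Neg (Eq x y))"
| "nnf b (Neg \<phi>) = nnf (\<not> b) \<phi>"
| "nnf b (Conj \<phi>s) = (if b then Conj else Disj) (map (nnf b) \<phi>s)"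
| "nnf b (Disj \<phi>s) = (if b then Disj else Conj) (map (nnf b) \<phi>s)"
| "nnf b (Quant q x \<phi>) = Quant (if b then q else dual q) x (nnf b \<phi>)"

fun subfms :: "'r formula \<Rightarrow> 'r formula set" where
  "subfms (Rel R xs) = {Rel R xs}"
| "subfms (Eq x y) = {Eq x y}"
| "subfms (Neg \<phi>) = insert (Neg \<phi>) (subfms \<phi>)"
| "subfms (Conj \<phi>s) = insert (Conj \<phi>s) (\<Union>\<phi> \<in> set \<phi>s. subfms \<phi>)"
| "subfms (Disj \<phi>s) = insert (Disj \<phi>s) (\<Union>\<phi> \<in> set \<phi>s. subfms \<phi>)"
| "subfms (Quant q x \<phi>) = insert (Quant q x \<phi>) (subfms \<phi>)"


section \<open>Stratified tree-width\<close>

type_synonym graph = "nat set \<times> nat set set"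

text \<open>A rooted tree with node set \<open>N\<close> and root \<open>r\<close> is given by its parent function, which fixes the
  root. Every finite rooted tree has a copy with nodes of type \<^typ>\<open>nat\<close>.\<close>

definition rooted_tree :: "nat set \<Rightarrow> nat \<Rightarrow> (nat \<Rightarrow> nat) \<Rightarrow> bool" where
  "rooted_tree N r par \<longleftrightarrow>
     finite N \<and> r \<in> N \<and> par r = r \<and> (\<forall>t\<in>N. par t \<in> N \<and> (\<exists>k. (par ^^ k) t = r))"

definition tree_le :: "(nat \<Rightarrow> nat) \<Rightarrow> nat \<Rightarrow> nat \<Rightarrow> bool" where
  "tree_le par s t \<longleftrightarrow> (\<exists>k. s = (par ^^ k) t)"

definition tree_connected :: "(nat \<Rightarrow> nat) \<Rightarrow> nat set \<Rightarrow> bool" where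
  "tree_connected par S \<longleftrightarrow>
     (\<forall>s\<in>S. \<forall>t\<in>S. (s, t) \<in> {(u, v). u \<in> S \<and> v \<in> S \<and> (v = par u \<or> u = par v)}\<^sup>*)"

definition tree_decomposition ::
  "graph \<Rightarrow> nat set \<Rightarrow> nat \<Rightarrow> (nat \<Rightarrow> nat) \<Rightarrow> (nat \<Rightarrow> nat set) \<Rightarrow> bool" where
  "tree_decomposition G N r par B \<longleftrightarrow>
     rooted_tree N r par \<and>
     (\<Union>t\<in>N. B t) = fst G \<and>
     (\<forall>e\<in>snd G. \<exists>t\<in>N. e \<subseteq> B t) \<and>
     (\<forall>v\<in>fst G. tree_connected par {t \<in> N. v \<in> B t})"

definition width :: "nat set \<Rightarrow> (nat \<Rightarrow> nat set) \<Rightarrow> int" where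
  "width N B = int (Max ((\<lambda>t. card (B t)) ` N)) - 1"

definition top_node :: "nat set \<Rightarrow> (nat \<Rightarrow> nat) \<Rightarrow> (nat \<Rightarrow> nat set) \<Rightarrow> nat \<Rightarrow> nat" where
  "top_node N par B v =
     (THE t. t \<in> N \<and> v \<in> B t \<and> (\<forall>s\<in>N. v \<in> B s \<longrightarrow> tree_le par t s))"

definition stratified ::
  "graph \<Rightarrow> (nat \<Rightarrow> nat) \<Rightarrow> nat set \<Rightarrow> (nat \<Rightarrow> nat) \<Rightarrow> (nat \<Rightarrow> nat set) \<Rightarrow> bool" where
  "stratified G d N par B \<longleftrightarrow>
     (\<forall>u\<in>fst G. \<forall>v\<in>fst G.
        tree_le par (top_node N par B u) (top_node N par B v) \<and>
        top_node N par B u \<noteq> top_node N par B v \<longrightarrow> d u \<le> d v)"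

text \<open>Widths are integers: the empty graph has tree-width \<open>-1\<close>. For finite graphs the sets below are
  nonempty, because of the one-node decomposition, so the infima are minima.\<close>

definition tw :: "graph \<Rightarrow> int" where
  "tw G = Inf {width N B | N r par B. tree_decomposition G N r par B}"

definition stratified_tw :: "graph \<Rightarrow> (nat \<Rightarrow> nat) \<Rightarrow> int" where
  "stratified_tw G d =
     Inf {width N B | N r par B. tree_decomposition G N r par B \<and> stratified G d N par B}"


section \<open>Alternation depth and first-order tree-width\<close>

definition fm_graph :: "'r formula \<Rightarrow> graph" where
  "fm_graph \<phi> =
     (vars \<phi>,
      {{x, y} | x y. x \<noteq> y \<and>
         (x \<in> free_vars \<phi> \<and> y \<in> free_vars \<phi> \<or>
          (\<exists>\<alpha> \<in> subfms \<phi>. is_atom \<alpha> \<and> x \<in> vars \<alpha> \<and> y \<in> vars \<alpha>))})"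

text \<open>The quantifier of a bound variable; well-defined in straight formulas.\<close>

definition quant_of :: "'r formula \<Rightarrow> nat \<Rightarrow> quantifier" where
  "quant_of \<phi> x = (THE q. \<exists>\<psi>. Quant q x \<psi> \<in> subfms \<phi>)"

definition scope_le :: "'r formula \<Rightarrow> nat \<Rightarrow> nat \<Rightarrow> bool" where
  "scope_le \<phi> x y \<longleftrightarrow>
     x = y \<or> (\<exists>q \<psi>. Quant q x \<psi> \<in> subfms \<phi> \<and> (\<exists>q' \<chi>. Quant q' y \<chi> \<in> subfms \<psi>))"

definition chains_to :: "(nat \<Rightarrow> nat \<Rightarrow> bool) \<Rightarrow> nat \<Rightarrow> nat list set" where
  "chains_to le x =
     {vs. vs \<noteq> [] \<and> last vs = x \<and> successively (\<lambda>u v. le u v \<and> u \<noteq> v) vs}"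

definition alternations :: "'r formula \<Rightarrow> nat list \<Rightarrow> nat" where
  "alternations \<phi> vs =
     card {i. Suc i < length vs \<and> quant_of \<phi> (vs ! i) \<noteq> quant_of \<phi> (vs ! Suc i)}"

definition ad' :: "'r formula \<Rightarrow> nat \<Rightarrow> nat" where
  "ad' \<phi> x =
     (if x \<in> free_vars \<phi> then 0
      else 1 + Max (alternations \<phi> ` chains_to (scope_le \<phi>) x))"

text \<open>Subformulas have to be taken as occurrences here, since a straight formula may still contain
  several copies of the same atom. Occurrences are addressed by positions, and the smallest
  subformula containing a nonempty set of occurrences is the one at their longest common prefix.\<close>

fun subfm_at :: "'r formula \<Rightarrow> nat list \<Rightarrow> 'r formula option" where
  "subfm_at \<phi> [] = Some \<phi>"
| "subfm_at (Neg \<phi>) (i # p) = (if i = 0 then subfm_at \<phi> p else None)"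
| "subfm_at (Conj \<phi>s) (i # p) = (if i < length \<phi>s then subfm_at (\<phi>s ! i) p else None)"
| "subfm_at (Disj \<phi>s) (i # p) = (if i < length \<phi>s then subfm_at (\<phi>s ! i) p else None)"
| "subfm_at (Quant q x \<phi>) (i # p) = (if i = 0 then subfm_at \<phi> p else None)"
| "subfm_at _ (i # p) = None"

definition atom_positions :: "'r formula \<Rightarrow> nat set \<Rightarrow> nat list set" where
  "atom_positions \<phi> X =
     {p. \<exists>\<alpha>. subfm_at \<phi> p = Some \<alpha> \<and> is_atom \<alpha> \<and> vars \<alpha> \<inter> X \<noteq> {}}"

definition min_subfm :: "'r formula \<Rightarrow> nat set \<Rightarrow> 'r formula" where
  "min_subfm \<phi> X = the (subfm_at \<phi> (Longest_common_prefix (atom_positions \<phi> X)))"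

definition entangled :: "'r formula \<Rightarrow> (nat \<times> nat) set \<Rightarrow> nat \<Rightarrow> nat \<Rightarrow> bool" where
  "entangled \<phi> R x y \<longleftrightarrow>
     x \<in> vars (min_subfm \<phi> {z. (y, z) \<in> R}) \<and> y \<in> vars (min_subfm \<phi> {z. (x, z) \<in> R})"

definition entanglement_closed :: "'r formula \<Rightarrow> (nat \<times> nat) set \<Rightarrow> bool" where
  "entanglement_closed \<phi> R \<longleftrightarrow>
     R \<subseteq> vars \<phi> \<times> vars \<phi> \<and> refl_on (vars \<phi>) R \<and> trans R \<and>
     (\<forall>x y zs.
        scope_le \<phi> x y \<and> quant_of \<phi> x \<noteq> quant_of \<phi> y \<and>
        zs \<noteq> [] \<and> hd zs = x \<and> last zs = y \<and> set zs \<subseteq> bound_vars \<phi> \<and>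
        (\<forall>i. Suc i < length zs \<longrightarrow>
           entangled \<phi> R (zs ! i) (zs ! Suc i) \<and> ((x, zs ! i) \<in> R \<or> (y, zs ! i) \<in> R))
        \<longrightarrow> (x, y) \<in> R)"

text \<open>The smallest relation satisfying \<^const>\<open>entanglement_closed\<close>. If every variable of \<open>\<phi>\<close> occurs in
  an atom, then \<^const>\<open>entangled\<close> is monotone in the relation, and the intersection is itself closed.\<close>

definition ess_le :: "'r formula \<Rightarrow> nat \<Rightarrow> nat \<Rightarrow> bool" where
  "ess_le \<phi> x y \<longleftrightarrow> (x, y) \<in> \<Inter> {R. entanglement_closed \<phi> R}"

definition ead :: "'r formula \<Rightarrow> nat \<Rightarrow> nat" where
  "ead \<phi> x =
     (if x \<in> free_vars \<phi> then 0
      else Max ((\<lambda>vs. alternations \<phi> vs + (case quant_of \<phi> (hd vs) of Exists \<Rightarrow> 1 | Forall \<Rightarrow> 2))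
                ` chains_to (ess_le \<phi>) x))"

definition fotw :: "'r formula \<Rightarrow> int" where
  "fotw \<phi> = stratified_tw (fm_graph \<phi>) (ead \<phi>)"


section \<open>Non-recursive stratified datalog\<close>

datatype 'r rule = Rule (head_sym: 'r) (head_vars: "nat list") (body: "'r formula list")

definition body_vars :: "'r rule \<Rightarrow> nat set" where
  "body_vars \<rho> = (\<Union>l \<in> set (body \<rho>). vars l)"

definition wf_rule :: "('r \<Rightarrow> nat) \<Rightarrow> 'r rule \<Rightarrow> bool" where
  "wf_rule ar \<rho> \<longleftrightarrow>
     distinct (head_vars \<rho>) \<and> length (head_vars \<rho>) = ar (head_sym \<rho>) \<and>
     set (head_vars \<rho>) \<subseteq> body_vars \<rho> \<and>
     (\<forall>l \<in> set (body \<rho>). is_literal l \<and> (\<forall>R xs. Rel R xs \<in> subfms l \<longrightarrow> length xs = ar R))"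

text \<open>The remaining body variables, listed in increasing order.\<close>

definition ex_vars :: "'r rule \<Rightarrow> nat list" where
  "ex_vars \<rho> = sorted_list_of_set (body_vars \<rho> - set (head_vars \<rho>))"

definition rule_fm :: "'r rule \<Rightarrow> 'r formula" where
  "rule_fm \<rho> = foldr (Quant Exists) (ex_vars \<rho>) (Conj (body \<rho>))"

type_synonym 'r program = "'r rule set list"

definition heads :: "'r rule set \<Rightarrow> 'r set" where
  "heads P = head_sym ` P"

definition int_syms :: "'r program \<Rightarrow> 'r set" where
  "int_syms \<Pi> = (\<Union>P \<in> set \<Pi>. heads P)"

definition depends :: "'r rule set \<Rightarrow> ('r \<times> 'r) set" where
  "depends P =
     {(R, head_sym \<rho>) | R \<rho>. \<rho> \<in> P \<and> R \<in> heads P \<and> (\<exists>l \<in> set (body \<rho>). R \<in> syms l)}"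

text \<open>Symbols defined in a stratum may be used positively in this stratum and in all later ones, and
  negatively in later ones only. Non-recursiveness means that no symbol depends on itself. This includes
  the programs in which the bodies of a stratum contain no symbol defined in that stratum.\<close>

definition nrsd_program :: "('r \<Rightarrow> nat) \<Rightarrow> 'r program \<Rightarrow> bool" where
  "nrsd_program ar \<Pi> \<longleftrightarrow>
     (\<forall>P \<in> set \<Pi>. finite P \<and> (\<forall>\<rho>\<in>P. wf_rule ar \<rho>) \<and> acyclic (depends P)) \<and>
     (\<forall>i j. i < j \<and> j < length \<Pi> \<longrightarrow> heads (\<Pi> ! i) \<inter> heads (\<Pi> ! j) = {}) \<and>
     (\<forall>i j \<rho> R xs. i < length \<Pi> \<and> j < length \<Pi> \<and> \<rho> \<in> \<Pi> ! i \<and> R \<in> heads (\<Pi> ! j) \<longrightarrow>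
        (Rel R xs \<in> set (body \<rho>) \<longrightarrow> j \<le> i) \<and> (Neg (Rel R xs) \<in> set (body \<rho>) \<longrightarrow> j < i))"

text \<open>\<open>rule_instance \<rho> xs \<psi>\<close>: \<open>\<psi>\<close> arises from \<^term>\<open>rule_fm \<rho>\<close> by substituting \<open>xs\<close> for the head
  variables and renaming the bound variables without capture. The list \<open>xs\<close> may have repetitions.\<close>

definition rule_instance :: "'r rule \<Rightarrow> nat list \<Rightarrow> 'r formula \<Rightarrow> bool" where
  "rule_instance \<rho> xs \<psi> \<longleftrightarrow>
     (\<exists>\<sigma>. map \<sigma> (head_vars \<rho>) = xs \<and>
          inj_on \<sigma> (set (ex_vars \<rho>)) \<and> \<sigma> ` set (ex_vars \<rho>) \<inter> set xs = {} \<and>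
          \<psi> = map_fm id \<sigma> (rule_fm \<rho>))"

text \<open>\<open>def_instance \<Pi> Q xs \<psi>\<close>: \<open>\<psi>\<close> is, up to renaming of bound variables, the disjunction of the
  formulas of all rules for \<open>Q\<close>, in any order and with argument variables \<open>xs\<close>.\<close>

definition def_instance :: "'r program \<Rightarrow> 'r \<Rightarrow> nat list \<Rightarrow> 'r formula \<Rightarrow> bool" where
  "def_instance \<Pi> Q xs \<psi> \<longleftrightarrow>
     (\<exists>P \<in> set \<Pi>. Q \<in> heads P \<and>
        (\<exists>\<rho>s \<psi>s. distinct \<rho>s \<and> set \<rho>s = {\<rho> \<in> P. head_sym \<rho> = Q} \<and>
                 list_all2 (\<lambda>\<rho>. rule_instance \<rho> xs) \<rho>s \<psi>s \<and> \<psi> = Disj \<psi>s))"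

inductive expands :: "'r program \<Rightarrow> 'r formula \<Rightarrow> 'r formula \<Rightarrow> bool" for \<Pi> where
  Rel_ext: "R \<notin> int_syms \<Pi> \<Longrightarrow> expands \<Pi> (Rel R xs) (Rel R xs)"
| Rel_int: "R \<in> int_syms \<Pi> \<Longrightarrow> def_instance \<Pi> R xs \<psi> \<Longrightarrow> expands \<Pi> \<psi> \<chi> \<Longrightarrow> expands \<Pi> (Rel R xs) \<chi>"
| Eq: "expands \<Pi> (Eq x y) (Eq x y)"
| Neg: "expands \<Pi> \<psi> \<chi> \<Longrightarrow> expands \<Pi> (Neg \<psi>) (Neg \<chi>)"
| Conj: "list_all2 (expands \<Pi>) \<psi>s \<chi>s \<Longrightarrow> expands \<Pi> (Conj \<psi>s) (Conj \<chi>s)"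
| Disj: "list_all2 (expands \<Pi>) \<psi>s \<chi>s \<Longrightarrow> expands \<Pi> (Disj \<psi>s) (Disj \<chi>s)"
| Quant: "expands \<Pi> \<psi> \<chi> \<Longrightarrow> expands \<Pi> (Quant q x \<psi>) (Quant q x \<chi>)"

text \<open>\<open>program_fm \<Pi> Q \<phi>\<close>: \<open>\<phi>\<close> is one of the straight formulas in negation normal form that define \<open>Q\<close>
  over the extensional vocabulary; they differ only in the names of variables and in the order of
  disjuncts. Straightness makes the choices of bound variables in different places compatible.\<close>

definition program_fm :: "'r program \<Rightarrow> 'r \<Rightarrow> 'r formula \<Rightarrow> bool" where
  "program_fm \<Pi> Q \<phi> \<longleftrightarrow>
     (\<exists>xs \<psi> \<chi>. distinct xs \<and> def_instance \<Pi> Q xs \<psi> \<and> expands \<Pi> \<psi> \<chi> \<and> straight \<chi> \<and> \<phi> = nnf True \<chi>)"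

definition stw_rule :: "'r rule \<Rightarrow> int" where
  "stw_rule \<rho> = tw (fm_graph (rule_fm \<rho>))"

definition stw :: "'r program \<Rightarrow> int" where
  "stw \<Pi> = Max (stw_rule ` \<Union> (set \<Pi>))"


section \<open>Every intensional symbol has a defining formula\<close>

lemma fresh_substitution:
  assumes "distinct hs" "length xs = length hs" "finite A" "set hs \<inter> Y = {}"
  shows "\<exists>\<sigma>::nat \<Rightarrow> nat. map \<sigma> hs = xs \<and> inj_on \<sigma> Y \<and> \<sigma> ` Y \<inter> A = {}"
proof -
  define \<sigma> where "\<sigma> v = (case map_of (zip hs xs) v of Some x \<Rightarrow> x | None \<Rightarrow> Suc (Max (insert 0 A)) + v)" for v
  have "\<sigma> (hs ! i) = xs ! i" if "i < length hs" for i
    using assms that by (simp add: \<sigma>_def map_of_zip_nth)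
  then have 1: "map \<sigma> hs = xs"
    using assms by (intro nth_equalityI) auto
  have 2: "\<sigma> y = Suc (Max (insert 0 A)) + y" if "y \<in> Y" for y
  proof -
    have "y \<notin> set hs" using that assms by auto
    then have "map_of (zip hs xs) y = None" using assms by (simp add: map_of_zip_is_None)
    then show ?thesis by (simp add: \<sigma>_def)
  qed
  have "\<sigma> y \<notin> A" if "y \<in> Y" for y
  proof
    assume "\<sigma> y \<in> A"
    then have "\<sigma> y \<le> Max (insert 0 A)" using assms by (intro Max_ge) auto
    then show False using 2[OF that] by simp
  qed
  then show ?thesis using 1 2 by (intro exI[of _ \<sigma>]) (auto simp: inj_on_def)
qed

lemma map_fm_foldr_Quant:
  "map_fm id \<sigma> (foldr (Quant q) ys \<phi>) = foldr (Quant q) (map \<sigma> ys) (map_fm id \<sigma> \<phi>)"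
  by (induction ys) auto

lemma expands_foldr_Quant:
  "expands \<Pi> \<psi> \<chi> \<Longrightarrow> expands \<Pi> (foldr (Quant q) ys \<psi>) (foldr (Quant q) ys \<chi>)"
  by (induction ys) (auto intro: expands.Quant)

lemma quantified_foldr_Quant: "quantified (foldr (Quant q) ys \<phi>) = ys @ quantified \<phi>"
  by (induction ys) auto

lemma free_vars_foldr_Quant: "free_vars (foldr (Quant q) ys \<phi>) = free_vars \<phi> - set ys"
  by (induction ys) auto

definition fresh_expansion :: "'r program \<Rightarrow> nat set \<Rightarrow> 'r formula \<Rightarrow> 'r formula \<Rightarrow> bool" where
  "fresh_expansion \<Pi> A \<psi> \<chi> \<longleftrightarrow>
     expands \<Pi> \<psi> \<chi> \<and> distinct (quantified \<chi>) \<and> bound_vars \<chi> \<inter> A = {} \<and> free_vars \<chi> \<subseteq> vars \<psi>"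

lemma fresh_expansions_list:
  assumes "\<And>\<psi> A. \<psi> \<in> set \<psi>s \<Longrightarrow> finite A \<Longrightarrow> \<exists>\<chi>. fresh_expansion \<Pi> A \<psi> \<chi>" "finite A"
  shows "\<exists>\<chi>s. list_all2 (expands \<Pi>) \<psi>s \<chi>s \<and> distinct (concat (map quantified \<chi>s)) \<and>
              (\<Union>\<chi>\<in>set \<chi>s. bound_vars \<chi>) \<inter> A = {} \<and> (\<Union>\<chi>\<in>set \<chi>s. free_vars \<chi>) \<subseteq> (\<Union>\<psi>\<in>set \<psi>s. vars \<psi>)"
  using assms
proof (induction \<psi>s arbitrary: A)
  case Nil
  then show ?case by (intro exI[of _ "[]"]) auto
next
  case (Cons \<psi> \<psi>s)
  obtain \<chi> where \<chi>: "fresh_expansion \<Pi> A \<psi> \<chi>" using Cons.prems by force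
  have "finite (A \<union> bound_vars \<chi>)" using Cons.prems by simp
  from Cons.IH[OF _ this] Cons.prems obtain \<chi>s where
    "list_all2 (expands \<Pi>) \<psi>s \<chi>s" "distinct (concat (map quantified \<chi>s))"
    "(\<Union>\<chi>\<in>set \<chi>s. bound_vars \<chi>) \<inter> (A \<union> bound_vars \<chi>) = {}"
    "(\<Union>\<chi>\<in>set \<chi>s. free_vars \<chi>) \<subseteq> (\<Union>\<psi>\<in>set \<psi>s. vars \<psi>)" by fastforce
  then show ?case using \<chi> unfolding fresh_expansion_def
    by (intro exI[of _ "\<chi> # \<chi>s"]) (simp, blast)
qed

definition definable :: "('r \<Rightarrow> nat) \<Rightarrow> 'r program \<Rightarrow> 'r \<Rightarrow> bool" where
  "definable ar \<Pi> Q \<longleftrightarrow>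
     (\<forall>A xs. finite A \<longrightarrow> length xs = ar Q \<longrightarrow>
        (\<exists>\<psi> \<chi>. def_instance \<Pi> Q xs \<psi> \<and> expands \<Pi> \<psi> \<chi> \<and> distinct (quantified \<chi>) \<and>
               bound_vars \<chi> \<inter> A = {} \<and> free_vars \<chi> \<subseteq> set xs))"

lemma atom_expansion:
  assumes "is_atom \<alpha>" "syms \<alpha> \<inter> int_syms \<Pi> \<subseteq> {R. definable ar \<Pi> R}"
    "\<forall>R xs. \<alpha> = Rel R xs \<longrightarrow> length xs = ar R" "finite A"
  shows "\<exists>\<chi>. fresh_expansion \<Pi> A \<alpha> \<chi>"
proof (cases \<alpha>)
  case (Rel R xs)
  show ?thesis
  proof (cases "R \<in> int_syms \<Pi>")
    case True
    then have "definable ar \<Pi> R" using assms Rel by auto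
    moreover have "length xs = ar R" using assms Rel by simp
    ultimately obtain \<psi> \<chi> where "def_instance \<Pi> R xs \<psi>" "expands \<Pi> \<psi> \<chi>" "distinct (quantified \<chi>)"
        "bound_vars \<chi> \<inter> A = {}" "free_vars \<chi> \<subseteq> set xs"
      using \<open>finite A\<close> unfolding definable_def by blast
    then show ?thesis using Rel expands.Rel_int[OF True]
      by (intro exI[of _ \<chi>]) (simp add: fresh_expansion_def)
  next
    case False
    then show ?thesis using Rel by (auto simp: fresh_expansion_def intro: expands.Rel_ext)
  qed
next
  case (Eq x y)
  then show ?thesis by (auto simp: fresh_expansion_def intro: expands.Eq)
qed (use assms in auto)

lemma literal_expansion:
  assumes "is_literal l" "syms l \<inter> int_syms \<Pi> \<subseteq> {R. definable ar \<Pi> R}"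
    "\<forall>R xs. Rel R xs \<in> subfms l \<longrightarrow> length xs = ar R" "finite A"
  shows "\<exists>\<chi>. fresh_expansion \<Pi> A l \<chi>"
proof (cases "is_atom l")
  case True
  have "length xs = ar R" if "l = Rel R xs" for R xs using that assms by auto
  then show ?thesis using atom_expansion[OF True assms(2) _ assms(4)] by auto
next
  case False
  then obtain \<alpha> where l: "l = Neg \<alpha>" and \<alpha>: "is_atom \<alpha>" using assms(1) by (cases l) auto
  have "length xs = ar R" if "\<alpha> = Rel R xs" for R xs using that assms l by auto
  then obtain \<chi> where "fresh_expansion \<Pi> A \<alpha> \<chi>"
    using atom_expansion[OF \<alpha> _ _ assms(4), of \<Pi> ar] assms(2) l by auto
  then show ?thesis using l
    by (intro exI[of _ "Neg \<chi>"]) (auto simp: fresh_expansion_def intro: expands.Neg)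
qed


lemma is_literal_map: "is_literal (map_fm id \<sigma> l) = is_literal l"
  by (cases l rule: is_literal.cases; (rename_tac \<alpha>, case_tac \<alpha>)?) auto

lemma literal_Rel_map:
  assumes "is_literal l" "Rel R xs \<in> subfms (map_fm id \<sigma> l)"
  shows "\<exists>ys. xs = map \<sigma> ys \<and> Rel R ys \<in> subfms l"
  using assms by (cases l rule: is_literal.cases; (rename_tac \<alpha>, case_tac \<alpha>)?) auto

lemma rule_expansion:
  assumes wf: "wf_rule ar \<rho>" and len: "length xs = ar (head_sym \<rho>)" and A: "finite A"
    and def: "\<And>l R. l \<in> set (body \<rho>) \<Longrightarrow> R \<in> syms l \<Longrightarrow> R \<in> int_syms \<Pi> \<Longrightarrow> definable ar \<Pi> R"
  shows "\<exists>\<psi> \<chi>. rule_instance \<rho> xs \<psi> \<and> expands \<Pi> \<psi> \<chi> \<and> distinct (quantified \<chi>) \<and>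
               bound_vars \<chi> \<inter> A = {} \<and> free_vars \<chi> \<subseteq> set xs"
proof -
  have fin: "finite (body_vars \<rho>)" unfolding body_vars_def by (auto simp: fm.set_finite)
  then have ex: "set (ex_vars \<rho>) = body_vars \<rho> - set (head_vars \<rho>)" by (simp add: ex_vars_def)
  obtain \<sigma> where \<sigma>: "map \<sigma> (head_vars \<rho>) = xs" "inj_on \<sigma> (set (ex_vars \<rho>))"
      "\<sigma> ` set (ex_vars \<rho>) \<inter> (A \<union> set xs) = {}"
    using fresh_substitution[of "head_vars \<rho>" xs "A \<union> set xs" "set (ex_vars \<rho>)"] wf len A ex
    by (auto simp: wf_rule_def)
  let ?ys = "map \<sigma> (ex_vars \<rho>)" and ?b = "map (map_fm id \<sigma>) (body \<rho>)"
  have "\<exists>\<chi>. fresh_expansion \<Pi> A' l' \<chi>" if "l' \<in> set ?b" "finite A'" for l' A'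
  proof -
    obtain l where l: "l \<in> set (body \<rho>)" "l' = map_fm id \<sigma> l" using \<open>l' \<in> set ?b\<close> by auto
    have lit: "is_literal l" and ar: "\<forall>R xs. Rel R xs \<in> subfms l \<longrightarrow> length xs = ar R"
      using wf l unfolding wf_rule_def by auto
    have "\<forall>R xs. Rel R xs \<in> subfms l' \<longrightarrow> length xs = ar R"
      using literal_Rel_map[OF lit] ar l by fastforce
    moreover have "syms l' \<inter> int_syms \<Pi> \<subseteq> {R. definable ar \<Pi> R}"
      using def l by (auto simp: fm.set_map)
    ultimately show ?thesis
      using literal_expansion[of l' \<Pi> ar A'] lit l that by (simp add: is_literal_map)
  qed
  moreover have "finite (A \<union> set ?ys)" using A by simp
  ultimately have "\<exists>\<chi>s. list_all2 (expands \<Pi>) ?b \<chi>s \<and> distinct (concat (map quantified \<chi>s)) \<and>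
      (\<Union>\<chi>\<in>set \<chi>s. bound_vars \<chi>) \<inter> (A \<union> set ?ys) = {} \<and>
      (\<Union>\<chi>\<in>set \<chi>s. free_vars \<chi>) \<subseteq> (\<Union>l\<in>set ?b. vars l)"
    by (rule fresh_expansions_list)
  then
  obtain \<chi>s where \<chi>s: "list_all2 (expands \<Pi>) ?b \<chi>s" "distinct (concat (map quantified \<chi>s))"
      "(\<Union>\<chi>\<in>set \<chi>s. bound_vars \<chi>) \<inter> (A \<union> set ?ys) = {}"
      "(\<Union>\<chi>\<in>set \<chi>s. free_vars \<chi>) \<subseteq> (\<Union>l\<in>set ?b. vars l)"
    by blast
  have "(\<Union>l\<in>set ?b. vars l) = \<sigma> ` body_vars \<rho>"
    by (auto simp: body_vars_def fm.set_map)
  also have "\<dots> \<subseteq> set xs \<union> set ?ys" using \<sigma>(1) ex by (auto simp flip: \<sigma>(1))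
  finally have free: "(\<Union>\<chi>\<in>set \<chi>s. free_vars \<chi>) - set ?ys \<subseteq> set xs" using \<chi>s(4) by blast
  let ?\<psi> = "foldr (Quant Exists) ?ys (Conj ?b)" and ?\<chi> = "foldr (Quant Exists) ?ys (Conj \<chi>s)"
  have "rule_instance \<rho> xs ?\<psi>"
    unfolding rule_instance_def rule_fm_def using \<sigma>
    by (intro exI[of _ \<sigma>]) (auto simp: map_fm_foldr_Quant)
  moreover have "expands \<Pi> ?\<psi> ?\<chi>" using \<chi>s by (intro expands_foldr_Quant expands.Conj)
  moreover have "distinct (quantified ?\<chi>)"
    using \<chi>s \<sigma> by (auto simp: quantified_foldr_Quant distinct_map ex_vars_def)
  moreover have "bound_vars ?\<chi> \<inter> A = {}"
    using \<chi>s \<sigma> by (auto simp: quantified_foldr_Quant)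
  moreover have "free_vars ?\<chi> \<subseteq> set xs" using free by (simp add: free_vars_foldr_Quant)
  ultimately show ?thesis by blast
qed

lemma rules_expansion:
  assumes "\<And>\<rho> A. \<rho> \<in> set \<rho>s \<Longrightarrow> finite A \<Longrightarrow> \<exists>\<psi> \<chi>. rule_instance \<rho> xs \<psi> \<and> expands \<Pi> \<psi> \<chi> \<and>
             distinct (quantified \<chi>) \<and> bound_vars \<chi> \<inter> A = {} \<and> free_vars \<chi> \<subseteq> set xs" "finite A"
  shows "\<exists>\<psi>s \<chi>s. list_all2 (\<lambda>\<rho>. rule_instance \<rho> xs) \<rho>s \<psi>s \<and> list_all2 (expands \<Pi>) \<psi>s \<chi>s \<and>
     distinct (concat (map quantified \<chi>s)) \<and> (\<Union>\<chi>\<in>set \<chi>s. bound_vars \<chi>) \<inter> A = {} \<and>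
     (\<Union>\<chi>\<in>set \<chi>s. free_vars \<chi>) \<subseteq> set xs"
  using assms
proof (induction \<rho>s arbitrary: A)
  case Nil
  show ?case by (intro exI[of _ "[]"]) auto
next
  case (Cons \<rho> \<rho>s)
  from Cons.prems(1)[of \<rho> A] Cons.prems(2) obtain \<psi> \<chi> where 1: "rule_instance \<rho> xs \<psi>" "expands \<Pi> \<psi> \<chi>"
    "distinct (quantified \<chi>)" "bound_vars \<chi> \<inter> A = {}" "free_vars \<chi> \<subseteq> set xs"
    by auto
  have "finite (A \<union> bound_vars \<chi>)" using Cons.prems by simp
  from Cons.IH[OF Cons.prems(1)[OF list.set_intros(2)] this] obtain \<psi>s \<chi>s where
    "list_all2 (\<lambda>\<rho>. rule_instance \<rho> xs) \<rho>s \<psi>s" "list_all2 (expands \<Pi>) \<psi>s \<chi>s"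
    "distinct (concat (map quantified \<chi>s))"
    "(\<Union>\<chi>\<in>set \<chi>s. bound_vars \<chi>) \<inter> (A \<union> bound_vars \<chi>) = {}"
    "(\<Union>\<chi>\<in>set \<chi>s. free_vars \<chi>) \<subseteq> set xs" by blast
  with 1 show ?case
    by - (rule exI[of _ "\<psi> # \<psi>s"], rule exI[of _ "\<chi> # \<chi>s"], simp, blast)
qed

lemma stratum_definable:
  assumes \<Pi>: "nrsd_program ar \<Pi>" and i: "i < length \<Pi>"
    and lower: "\<And>j R. j < i \<Longrightarrow> R \<in> heads (\<Pi> ! j) \<Longrightarrow> definable ar \<Pi> R"
    and Q: "Q \<in> heads (\<Pi> ! i)"
  shows "definable ar \<Pi> Q"
proof -
  let ?P = "\<Pi> ! i"
  have P: "finite ?P" "\<And>\<rho>. \<rho> \<in> ?P \<Longrightarrow> wf_rule ar \<rho>" "acyclic (depends ?P)"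
    using \<Pi> i unfolding nrsd_program_def by auto
  have "depends ?P \<subseteq> heads ?P \<times> heads ?P" by (auto simp: depends_def heads_def)
  then have "finite (depends ?P)" by (rule finite_subset) (simp add: heads_def P(1))
  then have "wf (depends ?P)" using P(3) by (rule finite_acyclic_wf)
  then show ?thesis using Q
  proof (induction Q rule: wf_induct_rule)
    case (less Q)
    have *: "definable ar \<Pi> R"
      if \<rho>: "\<rho> \<in> ?P" "head_sym \<rho> = Q" "l \<in> set (body \<rho>)" "R \<in> syms l" "R \<in> int_syms \<Pi>" for \<rho> l R
    proof -
      obtain j where j: "j < length \<Pi>" "R \<in> heads (\<Pi> ! j)"
        using \<rho>(5) by (auto simp: int_syms_def in_set_conv_nth)
      have "is_literal l" using P(2) \<rho> by (auto simp: wf_rule_def)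
      then have "\<exists>xs. l = Rel R xs \<or> l = Neg (Rel R xs)" using \<rho>(4)
        by (cases l rule: is_literal.cases; (rename_tac \<alpha>, case_tac \<alpha>)?) auto
      moreover have "(Rel R xs \<in> set (body \<rho>) \<longrightarrow> j \<le> i) \<and> (Neg (Rel R xs) \<in> set (body \<rho>) \<longrightarrow> j < i)" for xs
        using \<Pi> i j \<rho>(1) unfolding nrsd_program_def by blast
      ultimately have "j \<le> i" using \<rho>(3) by (metis less_imp_le)
      show ?thesis
      proof (cases "j = i")
        case True
        then have "(R, Q) \<in> depends ?P" using j \<rho> by (auto simp: depends_def)
        then show ?thesis using less.IH j True by blast
      next
        case False
        then show ?thesis using lower[of j R] j \<open>j \<le> i\<close> by simp
      qed
    qed
    show ?case unfolding definable_def
    proof (intro allI impI)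
      fix A :: "nat set" and xs :: "nat list" assume A: "finite A" "length xs = ar Q"
      obtain \<rho>s where \<rho>s: "distinct \<rho>s" "set \<rho>s = {\<rho> \<in> ?P. head_sym \<rho> = Q}"
        using finite_distinct_list[of "{\<rho> \<in> ?P. head_sym \<rho> = Q}"] P(1) by auto
      have "\<exists>\<psi> \<chi>. rule_instance \<rho> xs \<psi> \<and> expands \<Pi> \<psi> \<chi> \<and>
             distinct (quantified \<chi>) \<and> bound_vars \<chi> \<inter> A = {} \<and> free_vars \<chi> \<subseteq> set xs"
        if "\<rho> \<in> set \<rho>s" "finite A" for \<rho> A
        using that \<rho>s A P(2) * by (intro rule_expansion) auto
      from rules_expansion[OF this A(1)] obtain \<psi>s \<chi>s where
        "list_all2 (\<lambda>\<rho>. rule_instance \<rho> xs) \<rho>s \<psi>s" "list_all2 (expands \<Pi>) \<psi>s \<chi>s"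
        "distinct (concat (map quantified \<chi>s))" "(\<Union>\<chi>\<in>set \<chi>s. bound_vars \<chi>) \<inter> A = {}"
        "(\<Union>\<chi>\<in>set \<chi>s. free_vars \<chi>) \<subseteq> set xs" by blast
      then show "\<exists>\<psi> \<chi>. def_instance \<Pi> Q xs \<psi> \<and> expands \<Pi> \<psi> \<chi> \<and> distinct (quantified \<chi>) \<and>
               bound_vars \<chi> \<inter> A = {} \<and> free_vars \<chi> \<subseteq> set xs"
        using \<rho>s i less.prems unfolding def_instance_def
        by - (rule exI[of _ "Disj \<psi>s"], rule exI[of _ "Disj \<chi>s"], intro conjI bexI[of _ ?P],
              auto intro: expands.Disj)
    qed
  qed
qed

lemma program_fm_exists:
  assumes "nrsd_program ar \<Pi>" "Q \<in> int_syms \<Pi>"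
  shows "\<exists>\<phi>. program_fm \<Pi> Q \<phi>"
proof -
  have "i < length \<Pi> \<Longrightarrow> R \<in> heads (\<Pi> ! i) \<Longrightarrow> definable ar \<Pi> R" for i R
  proof (induction i arbitrary: R rule: less_induct)
    case (less i)
    then show ?case using stratum_definable[OF assms(1)] by (meson less_trans)
  qed
  then have "definable ar \<Pi> Q" using assms(2) by (auto simp: int_syms_def in_set_conv_nth)
  then obtain \<psi> \<chi> where "def_instance \<Pi> Q [0..<ar Q] \<psi>" "expands \<Pi> \<psi> \<chi>" "distinct (quantified \<chi>)"
      "bound_vars \<chi> \<inter> {0..<ar Q} = {}" "free_vars \<chi> \<subseteq> set [0..<ar Q]"
    unfolding definable_def by (metis finite_atLeastLessThan length_upt minus_nat.diff_0)
  then show ?thesis unfolding program_fm_def straight_def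
    by - (rule exI[of _ "nnf True \<chi>"], rule exI[of _ "[0..<ar Q]"], rule exI[of _ \<psi>],
          rule exI[of _ \<chi>], auto)
qed

end

theory Submission
  imports Defs
begin

text \<open>
  A stratified decomposition of width at most \<open>k\<close> is the same as an order of the vertices, compatible
  with the stratification, in which every vertex has at most \<open>k\<close> lower neighbours when the vertices
  are eliminated from the top.

  For the first inequality, an order compatible with \<^const>\<open>ad'\<close> is sorted anew by \<^const>\<open>ead\<close>, keeping the old
  order among variables of equal \<^const>\<open>ead\<close>. If a bound variable \<open>u\<close> is connected to \<open>w\<close> through bound
  variables of larger \<^const>\<open>ead\<close>, then \<open>u\<close> is essentially above \<open>w\<close> and \<open>ad' u < ad' w\<close>. Hence the
  component of a vertex among the higher ones can only shrink, and no new lower neighbours arise.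

  For the second inequality, the head variables of a rule form a clique, so the rule has an
  elimination order of width at most \<open>stw \<Pi>\<close> that starts with them. When an atom is replaced by a
  rule instance, the arguments of the atom are a clique in the outer rule, and the order of the inner
  rule can be put on top of the outer one. The variables quantified in one rule instance
  have the same alternation depth, and those of inner instances have no smaller one.
\<close>

section \<open>Rooted trees\<close>

text \<open>The two inequalities use different forms of an elimination order. In the first, both
  sides concern the same graph, so two linear orders are compared: lower neighbours are described by
  paths, and paths make sense for either order. In the second, the order glued together from rules
  need not be sorted by \<open>ad'\<close>, since variables of different rule instances may have
  incomparable scopes. The depth only has to grow along neighbours, so the decomposition is built
  from a chordal relation \<open>E\<close> along which the depth does not decrease.

  Two obstacles shape the rest. The essential order refers to itself through entanglement, so its
  description as a closure of single steps rests on entanglement being monotone. This needs every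
  bound variable to occur in an atom, which comes from all variables of a rule occurring in its
  body. And the arguments of an atom may repeat, so the instance of a rule has a quotient of the
  graph of the rule; only head variables are merged, and they form a clique, hence the bound
  survives.\<close>

definition depth :: "(nat \<Rightarrow> nat) \<Rightarrow> nat \<Rightarrow> nat \<Rightarrow> nat" where
  "depth par r t = (LEAST k. (par ^^ k) t = r)"

lemma tree_le_refl: "tree_le par t t"
  unfolding tree_le_def by (rule exI[of _ 0]) simp

lemma tree_le_trans: "tree_le par s t \<Longrightarrow> tree_le par t u \<Longrightarrow> tree_le par s u"
  unfolding tree_le_def by (metis comp_apply funpow_add)

lemma tree_le_par: "tree_le par (par t) t"
  unfolding tree_le_def by (rule exI[of _ 1]) simp

lemma tree_le_parD: "tree_le par s t \<Longrightarrow> s \<noteq> t \<Longrightarrow> tree_le par s (par t)"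
  unfolding tree_le_def
proof (elim exE)
  fix k assume "s \<noteq> t" "s = (par ^^ k) t"
  then show "\<exists>k. s = (par ^^ k) (par t)"
    by (cases k) (auto simp: funpow_swap1)
qed

lemma tree_le_linear:
  assumes "tree_le par s u" "tree_le par t u"
  shows "tree_le par s t \<or> tree_le par t s"
proof -
  obtain k l where kl: "s = (par ^^ k) u" "t = (par ^^ l) u" using assms by (auto simp: tree_le_def)
  have *: "(par ^^ (m + n)) u = (par ^^ m) ((par ^^ n) u)" for m n by (simp add: funpow_add)
  show ?thesis
  proof (cases "k \<le> l")
    case True
    then show ?thesis using kl *[of "l - k" k] by (auto simp: tree_le_def)
  next
    case False
    then show ?thesis using kl *[of "k - l" l] by (auto simp: tree_le_def)
  qed
qed

lemma tree_le_in_nodes: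
  assumes "rooted_tree N r par" "t \<in> N" "tree_le par s t"
  shows "s \<in> N"
proof -
  have "(par ^^ k) t \<in> N" for k
    using assms(1,2) by (induction k) (auto simp: rooted_tree_def)
  then show ?thesis using assms(3) by (auto simp: tree_le_def)
qed

lemma depth_par:
  assumes "rooted_tree N r par" "t \<in> N" "t \<noteq> r"
  shows "depth par r t = Suc (depth par r (par t))"
proof -
  obtain k where "(par ^^ k) t = r" using assms by (auto simp: rooted_tree_def)
  then have "(LEAST k. (par ^^ k) t = r) = Suc (LEAST m. (par ^^ Suc m) t = r)"
    using assms(3) by (intro Least_Suc) auto
  then show ?thesis by (simp add: depth_def funpow_swap1)
qed

lemma depth_less:
  assumes "rooted_tree N r par" "t \<in> N" "tree_le par s t" "s \<noteq> t"
  shows "depth par r s < depth par r t"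
  using assms(2-)
proof (induction "depth par r t" arbitrary: t rule: less_induct)
  case less
  have "t \<noteq> r"
  proof
    assume "t = r"
    moreover have "par r = r" using assms(1) by (simp add: rooted_tree_def)
    then have "(par ^^ k) r = r" for k by (induction k) auto
    ultimately show False using less.prems by (auto simp: tree_le_def)
  qed
  then have d: "depth par r t = Suc (depth par r (par t))" using depth_par assms(1) less.prems by auto
  have "par t \<in> N" using assms(1) less.prems by (simp add: rooted_tree_def)
  moreover have "tree_le par s (par t)" using less.prems tree_le_parD by blast
  ultimately show ?case using less.hyps[of "par t"] d by (cases "s = par t") auto
qed

lemma tree_le_antisym:
  assumes "rooted_tree N r par" "t \<in> N" "tree_le par s t" "tree_le par t s"
  shows "s = t"
  using depth_less[OF assms(1,2,3)] depth_less[OF assms(1) _ assms(4)]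
    tree_le_in_nodes[OF assms(1-3)] by (cases "s = t") simp_all

text \<open>A node \<open>t\<close> of least depth works. A walk through \<open>S\<close> can leave
  the subtree below \<open>t\<close> only from \<open>t\<close> to \<open>par t\<close>, and
  \<open>par t \<in> S\<close> forces \<open>par t = t\<close> by minimality.\<close>

lemma connected_least:
  assumes tree: "rooted_tree N r par" and S: "S \<subseteq> N" "S \<noteq> {}" "tree_connected par S"
  shows "\<exists>t\<in>S. \<forall>s\<in>S. tree_le par t s"
proof -
  define t where "t = arg_min_on (depth par r) S"
  have fin: "finite S" using tree S finite_subset by (auto simp: rooted_tree_def)
  have t: "t \<in> S" "\<And>s. s \<in> S \<Longrightarrow> depth par r t \<le> depth par r s"
    using arg_min_if_finite[OF fin S(2), of "depth par r"] unfolding t_def by (auto simp: not_less)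
  have "tree_le par t s" if "s \<in> S" for s
  proof -
    have "(t, s) \<in> {(u, v). u \<in> S \<and> v \<in> S \<and> (v = par u \<or> u = par v)}\<^sup>*"
      using S(3) t(1) that by (auto simp: tree_connected_def)
    then show ?thesis
    proof (induction rule: rtrancl_induct)
      case (step u v)
      have "tree_le par t v" if "v = par u"
      proof (cases "t = u")
        case True
        then have "tree_le par v t" using that tree_le_par by blast
        moreover have "v \<in> S" "t \<in> N" using step t(1) S(1) by auto
        ultimately have "v = t" using depth_less[OF tree, of t v] t(2)[of v] by fastforce
        then show ?thesis using tree_le_refl by simp
      next
        case False
        then show ?thesis using that tree_le_parD step.IH by blast
      qed
      moreover have "tree_le par t v" if "u = par v"
        using step.IH that tree_le_par tree_le_trans by blast
      ultimately show ?case using step(2) by blast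
    qed (rule tree_le_refl)
  qed
  then show ?thesis using t by blast
qed

text \<open>A walk in \<open>S\<close> that starts below \<open>m\<close> can leave the subtree of
  \<open>m\<close> only through \<open>m\<close>. If it avoids \<open>m\<close>, then
  \<open>t\<close> lies below \<open>m\<close> as well as above it.\<close>

lemma connected_convex:
  assumes tree: "rooted_tree N r par" and S: "S \<subseteq> N" "tree_connected par S"
    and st: "s \<in> S" "t \<in> S" "tree_le par t m" "tree_le par m s"
  shows "m \<in> S"
proof (rule ccontr)
  assume m: "m \<notin> S"
  have "(s, t) \<in> {(u, v). u \<in> S \<and> v \<in> S \<and> (v = par u \<or> u = par v)}\<^sup>*"
    using S(2) st by (auto simp: tree_connected_def)
  then have "tree_le par m t"
  proof (induction rule: rtrancl_induct)
    case (step u v)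
    have uv: "u \<noteq> m" "v = par u \<or> u = par v" using step(2) m by auto
    from uv(2) show ?case
    proof
      assume "v = par u"
      then show ?thesis using step.IH uv(1) tree_le_parD by blast
    next
      assume "u = par v"
      then show ?thesis using step.IH tree_le_par tree_le_trans by blast
    qed
  qed (rule st)
  then have "m = t" using tree_le_antisym[OF tree] st S by blast
  then show False using m st by simp
qed

section \<open>Top nodes and change of the root\<close>

lemma top_node_eqI:
  assumes "rooted_tree N r par" "t \<in> N" "v \<in> B t" "\<And>s. s \<in> N \<Longrightarrow> v \<in> B s \<Longrightarrow> tree_le par t s"
  shows "top_node N par B v = t"
  unfolding top_node_def
proof (rule the_equality)
  fix s assume "s \<in> N \<and> v \<in> B s \<and> (\<forall>t\<in>N. v \<in> B t \<longrightarrow> tree_le par s t)"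
  then show "s = t" using tree_le_antisym[OF assms(1,2), of s] assms by blast
qed (use assms in blast)

lemma top_node:
  assumes dec: "tree_decomposition G N r par B" and v: "v \<in> fst G"
  shows "top_node N par B v \<in> N" "v \<in> B (top_node N par B v)"
    "s \<in> N \<Longrightarrow> v \<in> B s \<Longrightarrow> tree_le par (top_node N par B v) s"
proof -
  let ?S = "{t \<in> N. v \<in> B t}"
  have tree: "rooted_tree N r par" using dec by (simp add: tree_decomposition_def)
  have "?S \<noteq> {}" "tree_connected par ?S" using dec v by (auto simp: tree_decomposition_def)
  then obtain t where t: "t \<in> ?S" "\<forall>s\<in>?S. tree_le par t s"
    using connected_least[OF tree, of ?S] by auto
  then have "top_node N par B v = t" using top_node_eqI[OF tree] by auto
  then show "top_node N par B v \<in> N" "v \<in> B (top_node N par B v)"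
    "s \<in> N \<Longrightarrow> v \<in> B s \<Longrightarrow> tree_le par (top_node N par B v) s" using t by auto
qed

lemma in_bag_between:
  assumes dec: "tree_decomposition G N r par B" and "v \<in> fst G" "s \<in> N" "v \<in> B s"
    "tree_le par (top_node N par B v) m" "tree_le par m s"
  shows "v \<in> B m"
proof -
  have "m \<in> {t \<in> N. v \<in> B t}"
    using connected_convex[of N r par "{t \<in> N. v \<in> B t}" s "top_node N par B v" m] assms top_node[OF dec]
    by (auto simp: tree_decomposition_def)
  then show ?thesis by simp
qed

text \<open>Only the edge between the old root and its child \<open>c\<close> changes direction, so
  two values of the parent function are updated. Occurrence sets stay connected because
  connectedness ignores the direction of edges.\<close>

lemma reroot_step:
  assumes dec: "tree_decomposition G N r par B" and c: "c \<in> N" "par c = r"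
  shows "tree_decomposition G N c (par(r := c, c := c)) B"
proof -
  let ?p = "par(r := c, c := c)"
  have tree: "rooted_tree N r par" using dec by (simp add: tree_decomposition_def)
  then have r: "par r = r" "r \<in> N" by (auto simp: rooted_tree_def)
  have "\<exists>k. (?p ^^ k) t = c" if "t \<in> N" for t
    using that
  proof (induction "depth par r t" arbitrary: t rule: less_induct)
    case less
    consider "t = c" | "t = r" "t \<noteq> c" | "t \<noteq> r" "t \<noteq> c" by blast
    then show ?case
    proof cases
      case 1
      then show ?thesis by (intro exI[of _ 0]) simp
    next
      case 2
      then show ?thesis by (intro exI[of _ 1]) simp
    next
      case 3
      then have "depth par r (par t) < depth par r t" using depth_par[OF tree less.prems] by simp
      moreover have "par t \<in> N" using tree less.prems by (simp add: rooted_tree_def)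
      ultimately obtain k where "(?p ^^ k) (par t) = c" using less.hyps by blast
      then have "(?p ^^ Suc k) t = c" using 3 by (simp add: funpow_swap1)
      then show ?thesis by blast
    qed
  qed
  then have "rooted_tree N c ?p" using tree c by (auto simp: rooted_tree_def)
  moreover have "tree_connected ?p S" if "tree_connected par S" for S
    unfolding tree_connected_def
  proof (intro ballI)
    fix s t assume "s \<in> S" "t \<in> S"
    then have "(s, t) \<in> {(u, v). u \<in> S \<and> v \<in> S \<and> (v = par u \<or> u = par v)}\<^sup>*"
      using that by (auto simp: tree_connected_def)
    then show "(s, t) \<in> {(u, v). u \<in> S \<and> v \<in> S \<and> (v = ?p u \<or> u = ?p v)}\<^sup>*"
    proof (induction rule: rtrancl_induct)
      case (step u v)
      \<comment> \<open>The case \<open>u = v\<close> accounts for the loop \<open>par r = r\<close>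
        at the old root, which is lost when \<open>c\<close> differs from \<open>r\<close>.\<close>
      have "u = v \<or> v = ?p u \<or> u = ?p v" using step(2) c r by auto
      then have "u = v \<or> (u, v) \<in> {(u, v). u \<in> S \<and> v \<in> S \<and> (v = ?p u \<or> u = ?p v)}"
        using step(2) by (auto simp del: fun_upd_apply)
      then show ?case
      proof
        assume "u = v"
        then show ?thesis using step.IH by (simp only:)
      next
        assume "(u, v) \<in> {(u, v). u \<in> S \<and> v \<in> S \<and> (v = ?p u \<or> u = ?p v)}"
        with step.IH show ?thesis by (rule rtrancl_into_rtrancl)
      qed
    qed simp
  qed
  ultimately show ?thesis using dec by (simp add: tree_decomposition_def)
qed

lemma reroot:
  assumes "tree_decomposition G N r par B" "t \<in> N"
  shows "\<exists>par'. tree_decomposition G N t par' B"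
proof -
  \<comment> \<open>The root travels along the path towards \<open>t\<close>, one edge at a time.
    Minimality of \<open>k\<close> keeps the nodes between \<open>t\<close> and \<open>c\<close>
    distinct from \<open>r\<close> and \<open>c\<close>, so the updates leave the rest of the path
    intact.\<close>
  have *: "\<exists>par'. tree_decomposition G N t par' B"
    if "tree_decomposition G N r par B" "(par ^^ k) t = r" "\<forall>j<k. (par ^^ j) t \<noteq> r" for k r par
    using that
  proof (induction k arbitrary: r par)
    case 0
    then show ?case by (intro exI[of _ par]) simp
  next
    case (Suc k)
    define c where "c = (par ^^ k) t"
    let ?p = "par(r := c, c := c)"
    have tree: "rooted_tree N r par" using Suc.prems by (simp add: tree_decomposition_def)
    have "c \<in> N" using tree_le_in_nodes[OF tree assms(2)] by (auto simp: c_def tree_le_def)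
    moreover have "par c = r" using Suc.prems by (simp add: c_def)
    ultimately have "tree_decomposition G N c ?p B" using reroot_step Suc.prems(1) by blast
    moreover have nc: "(par ^^ j) t \<noteq> c" if "j < k" for j
    proof
      assume "(par ^^ j) t = c"
      then have "(par ^^ Suc j) t = r" using \<open>par c = r\<close> by simp
      then show False using Suc.prems(3) that by blast
    qed
    moreover have p: "(?p ^^ j) t = (par ^^ j) t" if "j \<le> k" for j
      using that
    proof (induction j)
      case (Suc j)
      then show ?case using nc[of j] \<open>\<forall>j<Suc k. (par ^^ j) t \<noteq> r\<close> by simp
    qed simp
    moreover have "(?p ^^ k) t = c" "\<forall>j<k. (?p ^^ j) t \<noteq> c" using p nc
      by (auto simp only: c_def less_imp_le)
    ultimately show ?case by (intro Suc.IH[of c ?p])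
  qed
  have "\<exists>k. (par ^^ k) t = r" using assms by (auto simp: tree_decomposition_def rooted_tree_def)
  then obtain k where k: "(par ^^ k) t = r" "\<forall>j<k. (par ^^ j) t \<noteq> r" 
    using exists_least_iff[of "\<lambda>k. (par ^^ k) t = r"] by auto
  show ?thesis by (rule *[of r par k, OF assms(1) k])
qed

section \<open>Elimination orders\<close>

definition adjacent :: "graph \<Rightarrow> nat \<Rightarrow> nat \<Rightarrow> bool" where
  "adjacent G x y \<longleftrightarrow> {x, y} \<in> snd G"

lemma adjacent_sym: "adjacent G x y \<Longrightarrow> adjacent G y x"
  by (simp add: adjacent_def insert_commute)

lemma adjacent_bag:
  assumes "tree_decomposition G N r par B" "adjacent G x y"
  shows "\<exists>t\<in>N. x \<in> B t \<and> y \<in> B t" "x \<in> fst G" "y \<in> fst G"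
proof -
  show "\<exists>t\<in>N. x \<in> B t \<and> y \<in> B t" 
    using assms by (fastforce simp: tree_decomposition_def adjacent_def)
  then show "x \<in> fst G" "y \<in> fst G" using assms(1) by (auto simp: tree_decomposition_def)
qed

lemma card_bag_le_width:
  assumes "tree_decomposition G N r par B" "t \<in> N"
  shows "int (card (B t)) \<le> width N B + 1"
proof -
  have "finite N" using assms by (auto simp: tree_decomposition_def rooted_tree_def)
  then have "card (B t) \<le> Max ((\<lambda>t. card (B t)) ` N)" using assms by auto
  then show ?thesis by (simp add: width_def)
qed

text \<open>Helly property of subtrees. Take \<open>v\<close> with the deepest top node. Any
  \<open>u\<close> shares a bag \<open>s\<close> with \<open>v\<close>; both top nodes are ancestors
  of \<open>s\<close>, so that of \<open>u\<close> is above that of \<open>v\<close>, and convexity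
  puts \<open>u\<close> into the bag at the top node of \<open>v\<close>.\<close>

lemma clique_in_bag:
  assumes dec: "tree_decomposition G N r par B" and K: "K \<subseteq> fst G"
    "\<And>x y. x \<in> K \<Longrightarrow> y \<in> K \<Longrightarrow> x \<noteq> y \<Longrightarrow> adjacent G x y" "finite K"
  shows "\<exists>t\<in>N. K \<subseteq> B t"
proof (cases "K = {}")
  case True
  then show ?thesis using dec by (auto simp: tree_decomposition_def rooted_tree_def)
next
  case False
  let ?t = "top_node N par B"
  have tree: "rooted_tree N r par" using dec by (simp add: tree_decomposition_def)
  obtain v where v: "v \<in> K" "\<And>u. u \<in> K \<Longrightarrow> depth par r (?t u) \<le> depth par r (?t v)"
  proof -
    have "Max ((\<lambda>u. depth par r (?t u)) ` K) \<in> (\<lambda>u. depth par r (?t u)) ` K" using K(3) False by simp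
    then obtain v where "v \<in> K" "Max ((\<lambda>u. depth par r (?t u)) ` K) = depth par r (?t v)" by auto
    then show thesis using that Max_ge[of "(\<lambda>u. depth par r (?t u)) ` K"] K(3) by auto
  qed
  have "u \<in> B (?t v)" if u: "u \<in> K" for u
  proof (cases "u = v")
    case True
    then show ?thesis using top_node[OF dec, of v] K v by auto
  next
    case False
    obtain s where s: "s \<in> N" "u \<in> B s" "v \<in> B s" using adjacent_bag[OF dec K(2)[OF u v(1) False]]
      by auto
    have uv: "u \<in> fst G" "v \<in> fst G" using u v K by auto
    have le: "tree_le par (?t u) s" "tree_le par (?t v) s" using top_node(3)[OF dec] uv s by auto
    then have "tree_le par (?t u) (?t v)"
      using tree_le_linear[OF le] depth_less[OF tree top_node(1)[OF dec uv(1)], of "?t v"] v(2)[OF u]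
      by (metis leD)
    then show ?thesis using in_bag_between[OF dec uv(1) s(1,2)] le by blast
  qed
  then show ?thesis using top_node(1)[OF dec, of v] v K by blast
qed

lemma lex_rank:
  fixes f g :: "nat \<Rightarrow> nat"
  assumes "finite V" "inj_on g V"
  shows "\<exists>r::nat \<Rightarrow> nat. inj_on r V \<and> (\<forall>u\<in>V. \<forall>v\<in>V. r u < r v \<longleftrightarrow> f u < f v \<or> f u = f v \<and> g u < g v)"
proof -
  \<comment> \<open>\<open>?M\<close> exceeds all values of \<open>g\<close>, so a larger
    \<open>f\<close> outweighs any difference in \<open>g\<close>; \<open>insert 0\<close> covers an
    empty \<open>V\<close>.\<close>
  let ?M = "Suc (Max (insert 0 (g ` V)))"
  let ?r = "\<lambda>u. f u * ?M + g u"
  have M: "g u < ?M" if "u \<in> V" for u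
    using Max_ge[of "insert 0 (g ` V)" "g u"] assms that by (simp add: le_imp_less_Suc)
  have less: "?r u < ?r v" if "f u < f v" "u \<in> V" for u v
  proof -
    have "?r u < Suc (f u) * ?M" using M[OF that(2)] by simp
    also have "\<dots> \<le> f v * ?M" using that by (intro mult_le_mono1) simp
    finally show ?thesis by simp
  qed
  then have iff: "?r u < ?r v \<longleftrightarrow> f u < f v \<or> f u = f v \<and> g u < g v" if "u \<in> V" "v \<in> V" for u v
    using that by (cases "f u" "f v" rule: linorder_cases) (auto dest: less_asym)
  moreover have "inj_on ?r V"
  proof (rule inj_onI)
    fix u v assume *: "u \<in> V" "v \<in> V" "?r u = ?r v"
    then have "f u = f v" using less[of u v] less[of v u] by (metis linorder_neqE_nat less_irrefl)
    then show "u = v" using * assms(2) by (auto dest: inj_onD)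
  qed
  ultimately show ?thesis by blast
qed

text \<open>\<open>lower_nbr G r u v\<close> holds if \<open>u\<close> is adjacent to \<open>v\<close> at the moment when \<open>v\<close> is eliminated,
  vertices being eliminated in the order of descending rank.\<close>

definition reach :: "graph \<Rightarrow> (nat \<Rightarrow> nat) \<Rightarrow> nat \<Rightarrow> nat \<Rightarrow> bool" where
  "reach G r v = (\<lambda>a b. adjacent G a b \<and> r v \<le> r b)\<^sup>*\<^sup>* v"

definition lower_nbr :: "graph \<Rightarrow> (nat \<Rightarrow> nat) \<Rightarrow> nat \<Rightarrow> nat \<Rightarrow> bool" where
  "lower_nbr G r u v \<longleftrightarrow> r u < r v \<and> (\<exists>w. reach G r v w \<and> adjacent G w u)"

text \<open>The path from \<open>v\<close> to \<open>w\<close> is walked backwards; all its vertices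
  have rank at least \<open>r v\<close>, hence at least \<open>r u\<close>.\<close>

lemma reach_sym_trans:
  assumes "reach G r v w" "r u \<le> r v" "reach G r u w"
  shows "reach G r u v"
proof -
  have "reach G r u w \<longrightarrow> reach G r u v" using assms(1) unfolding reach_def
  proof (induction rule: rtranclp_induct)
    case (step a b)
    \<comment> \<open>\<open>reach\<close> bounds the end of each step only; for the reversed step
      the start needs the bound too.\<close>
    have "r v \<le> r a" using step(1) by (induction rule: rtranclp_induct) auto
    then have "adjacent G b a \<and> r u \<le> r a" using step assms(2) adjacent_sym by auto
    then show ?case using step(3) by (auto intro: rtranclp.rtrancl_into_rtrancl)
  qed simp
  then show ?thesis using assms by simp
qed

text \<open>This is the chordality of the fill-in graph. If \<open>r u < r w\<close>, a path leads
  from \<open>w\<close> to \<open>v\<close> and on to \<open>u\<close>, and all its inner vertices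
  have rank at least \<open>r v > r w\<close>.\<close>

lemma lower_nbr_chordal:
  assumes "inj_on r (fst G)" "lower_nbr G r u v" "lower_nbr G r w v" "u \<noteq> w" "u \<in> fst G" "w \<in> fst G"
  shows "lower_nbr G r u w \<or> lower_nbr G r w u"
proof -
  have *: "lower_nbr G r u w" if uv: "lower_nbr G r u v" and wv: "lower_nbr G r w v" and less: "r u < r w" for u w
  proof -
    obtain a b where a: "reach G r v a" "adjacent G a u" and b: "reach G r v b" "adjacent G b w"
      using uv wv by (auto simp: lower_nbr_def)
    have rw: "r w < r v" using wv by (simp add: lower_nbr_def)
    have up: "(\<lambda>a b. adjacent G a b \<and> r w \<le> r b)\<^sup>*\<^sup>* v c" if "reach G r v c" for c
      using that rw unfolding reach_def by (auto elim!: rtranclp_mono[THEN predicate2D, rotated])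
    have "r v \<le> r b" using b(1) unfolding reach_def by (induction rule: rtranclp_induct) auto
    then have "reach G r w b" using adjacent_sym[OF b(2)] rw unfolding reach_def by auto
    then have "reach G r w v" using reach_sym_trans[OF b(1)] rw by simp
    then have "reach G r w a" using up[OF a(1)] unfolding reach_def by simp
    then show ?thesis using a(2) less by (auto simp: lower_nbr_def)
  qed
  have "r u \<noteq> r w" using assms by (auto dest: inj_onD)
  then show ?thesis using * assms by (meson linorder_neqE_nat)
qed

lemma adjacent_lower_nbr:
  assumes "adjacent G u v" "r u < r v"
  shows "lower_nbr G r u v"
  unfolding lower_nbr_def
proof (intro conjI exI[of _ v])
  show "reach G r v v" by (simp add: reach_def)
qed (use assms adjacent_sym in auto)

text \<open>Sorting by \<open>d\<close> and then by the depth of the top node puts every lower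
  neighbour of \<open>v\<close> into the bag at the top node of \<open>v\<close>. That bag also
  holds \<open>v\<close> itself, which pays for the \<open>- 1\<close> in the width.\<close>

lemma decomposition_to_rank:
  assumes dec: "tree_decomposition G N t0 par B" and strat: "stratified G d N par B"
    and fin: "finite (fst G)"
  shows "\<exists>r. inj_on r (fst G) \<and> (\<forall>u\<in>fst G. \<forall>v\<in>fst G. d u < d v \<longrightarrow> r u < r v) \<and>
     (\<forall>v\<in>fst G. int (card {u. lower_nbr G r u v}) \<le> width N B)"
proof -
  let ?t = "top_node N par B" and ?V = "fst G"
  let ?h = "\<lambda>v. depth par t0 (?t v)"
  have tree: "rooted_tree N t0 par" using dec by (simp add: tree_decomposition_def)
  obtain r1 :: "nat \<Rightarrow> nat" where r1: "inj_on r1 ?V" "\<forall>u\<in>?V. \<forall>v\<in>?V. r1 u < r1 v \<longleftrightarrow> ?h u < ?h v \<or>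
    ?h u = ?h v \<and> u < v"
    using lex_rank[OF fin, of "\<lambda>x. x" ?h] by auto
  obtain r :: "nat \<Rightarrow> nat" where r: "inj_on r ?V" "\<forall>u\<in>?V. \<forall>v\<in>?V. r u < r v \<longleftrightarrow> d u < d v \<or> d u = d v \<and>
    r1 u < r1 v"
    using lex_rank[OF fin r1(1), of d] by auto
  \<comment> \<open>Stratification enters here: along a branch \<open>d\<close> does not decrease,
    so sorting by \<open>d\<close> first never reverses the order by depth.\<close>
  have up: "r u < r v" if "tree_le par (?t u) (?t v)" "?t u \<noteq> ?t v" "u \<in> ?V" "v \<in> ?V" for u v
  proof -
    have "?h u < ?h v" using depth_less[OF tree top_node(1)[OF dec]] that by auto
    moreover have "d u \<le> d v" using strat that by (auto simp: stratified_def)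
    ultimately show ?thesis using r r1 that by auto
  qed
  have bag: "u \<in> B (?t v)" if v: "v \<in> ?V" and uv: "lower_nbr G r u v" for u v
  proof -
    obtain w where w: "reach G r v w" "adjacent G w u" using uv by (auto simp: lower_nbr_def)
    \<comment> \<open>Adjacent vertices share a bag, so along the path the next top node is
      comparable with that of \<open>v\<close>; strictly above it, it would belong to a vertex of
      smaller rank.\<close>
    have "w \<in> ?V \<and> tree_le par (?t v) (?t w)" using w(1) unfolding reach_def
    proof (induction rule: rtranclp_induct)
      case base
      then show ?case using v tree_le_refl by simp
    next
      case (step a b)
      obtain s where s: "s \<in> N" "a \<in> B s" "b \<in> B s" and ab: "a \<in> ?V" "b \<in> ?V"
        using adjacent_bag[OF dec] step(2) by blast
      have "tree_le par (?t v) s" "tree_le par (?t b) s"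
        using step.IH top_node(3)[OF dec] s ab tree_le_trans by blast+
      then show ?case using up[OF _ _ ab(2) v] step(2) ab tree_le_linear tree_le_refl
        by (metis linorder_not_less)
    qed
    then have w': "w \<in> ?V" "tree_le par (?t v) (?t w)" by auto
    obtain s where s: "s \<in> N" "w \<in> B s" "u \<in> B s" and u: "u \<in> ?V"
      using adjacent_bag[OF dec w(2)] by blast
    have s': "tree_le par (?t v) s" "tree_le par (?t u) s"
      using w' top_node(3)[OF dec] s u tree_le_trans by blast+
    have "tree_le par (?t u) (?t v)"
      using tree_le_linear[OF s'] up[OF _ _ v u] uv tree_le_refl by (metis lower_nbr_def less_asym)
    then show ?thesis using in_bag_between[OF dec u s(1,3)] s' by blast
  qed
  have "int (card {u. lower_nbr G r u v}) \<le> width N B" if v: "v \<in> ?V" for v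
  proof -
    have "?t v \<in> N" using top_node[OF dec v] by simp
    then have "B (?t v) \<subseteq> ?V" using dec by (auto simp: tree_decomposition_def)
    then have finB: "finite (B (?t v))" using fin finite_subset by blast
    have "insert v {u. lower_nbr G r u v} \<subseteq> B (?t v)" using bag v top_node[OF dec v] by auto
    moreover have "v \<notin> {u. lower_nbr G r u v}" by (simp add: lower_nbr_def)
    ultimately have "Suc (card {u. lower_nbr G r u v}) \<le> card (B (?t v))"
      using finB by (metis card_insert_disjoint card_mono finite_subset subset_insertI)
    then show ?thesis using card_bag_le_width[OF dec \<open>?t v \<in> N\<close>] by linarith
  qed
  then show ?thesis using r by blast
qed

section \<open>From minimal widths to ranks with few lower neighbours, and back\<close>

lemma Inf_int_attained:
  fixes X :: "int set"
  assumes "X \<noteq> {}" "bdd_below X"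
  shows "Inf X \<in> X"
proof -
  obtain x where x: "x \<in> X" "x < Inf X + 1"
    using cInf_lessD[OF assms(1), of "Inf X + 1"] by auto
  then have "x = Inf X" using cInf_lower[OF x(1) assms(2)] by simp
  then show ?thesis using x by simp
qed

lemma width_ge: "-1 \<le> width N B"
  by (simp add: width_def)

lemma trivial_decomposition:
  "\<exists>N r par B. tree_decomposition G N r par B \<and> stratified G d N par B" if "\<forall>e\<in>snd G. e \<subseteq> fst G"
proof -
  have tree: "rooted_tree {0} 0 (\<lambda>_. 0)"
    unfolding rooted_tree_def by (auto intro: exI[of _ 0])
  then have dec: "tree_decomposition G {0} 0 (\<lambda>_. 0) (\<lambda>_. fst G)"
    using that by (auto simp: tree_decomposition_def tree_connected_def)
  moreover have "stratified G d {0} (\<lambda>_. 0) (\<lambda>_. fst G)"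
    using top_node(1)[OF dec] by (simp add: stratified_def)
  ultimately show ?thesis by blast
qed

lemma stratified_tw_attained:
  assumes "\<forall>e\<in>snd G. e \<subseteq> fst G"
  shows "\<exists>N r par B. tree_decomposition G N r par B \<and> stratified G d N par B \<and>
    width N B = stratified_tw G d"
proof -
  let ?X = "{width N B | N r par B. tree_decomposition G N r par B \<and> stratified G d N par B}"
  have "?X \<noteq> {}" using trivial_decomposition[OF assms] by blast
  moreover have "bdd_below ?X" using width_ge by (intro bdd_belowI[of _ "-1"]) auto
  ultimately have "Inf ?X \<in> ?X" by (rule Inf_int_attained)
  then show ?thesis unfolding stratified_tw_def by force
qed

lemma stratified_tw_le:
  assumes "tree_decomposition G N r par B" "stratified G d N par B"
  shows "stratified_tw G d \<le> width N B"
  unfolding stratified_tw_def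
proof (rule cInf_lower)
  show "bdd_below {width N B | N r par B. tree_decomposition G N r par B \<and> stratified G d N par B}"
    using width_ge by (intro bdd_belowI[of _ "-1"]) auto
qed (use assms in blast)

lemma tw_attained:
  assumes "\<forall>e\<in>snd G. e \<subseteq> fst G"
  shows "\<exists>N r par B. tree_decomposition G N r par B \<and> width N B = tw G"
proof -
  let ?X = "{width N B | N r par B. tree_decomposition G N r par B}"
  have "?X \<noteq> {}" using trivial_decomposition[OF assms] by blast
  moreover have "bdd_below ?X" using width_ge by (intro bdd_belowI[of _ "-1"]) auto
  ultimately have "Inf ?X \<in> ?X" by (rule Inf_int_attained)
  then show ?thesis unfolding tw_def by force
qed

lemma stratified_tw_rank:
  assumes "\<forall>e\<in>snd G. e \<subseteq> fst G" "finite (fst G)"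
  shows "\<exists>r. inj_on r (fst G) \<and> (\<forall>u\<in>fst G. \<forall>v\<in>fst G. d u < d v \<longrightarrow> r u < r v) \<and>
     (\<forall>v\<in>fst G. int (card {u. lower_nbr G r u v}) \<le> stratified_tw G d)"
  using stratified_tw_attained[OF assms(1)] decomposition_to_rank[OF _ _ assms(2)] by metis

text \<open>The clique lies in one bag. With that bag as root, all its vertices have the root as top
  node, so the decomposition is stratified for the function that is 0 on \<open>K\<close> and 1
  elsewhere, and sorting by it puts \<open>K\<close> first.\<close>

lemma tw_rank_clique_first:
  assumes G: "\<forall>e\<in>snd G. e \<subseteq> fst G" "finite (fst G)"
    and K: "K \<subseteq> fst G" "\<And>x y. x \<in> K \<Longrightarrow> y \<in> K \<Longrightarrow> x \<noteq> y \<Longrightarrow> adjacent G x y"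
  shows "int (card K) \<le> tw G + 1"
    "\<exists>r. inj_on r (fst G) \<and> (\<forall>u\<in>K. \<forall>v\<in>fst G - K. r u < r v) \<and>
     (\<forall>v\<in>fst G. int (card {u. lower_nbr G r u v}) \<le> tw G)"
proof -
  let ?d = "\<lambda>v. if v \<in> K then 0 else 1 :: nat"
  obtain N r par B where dec: "tree_decomposition G N r par B" "width N B = tw G"
    using tw_attained[OF G(1)] by blast
  have "finite K" using G K finite_subset by blast
  then obtain t where t: "t \<in> N" "K \<subseteq> B t" using clique_in_bag[OF dec(1) K] by blast
  obtain par' where dec': "tree_decomposition G N t par' B" using reroot[OF dec(1) t(1)] by blast
  have tree: "rooted_tree N t par'" using dec' by (simp add: tree_decomposition_def)
  have "B t \<subseteq> fst G" using dec t by (auto simp: tree_decomposition_def)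
  then have "card K \<le> card (B t)" using t G(2) by (intro card_mono) (auto intro: finite_subset)
  then show "int (card K) \<le> tw G + 1" using card_bag_le_width[OF dec(1) t(1)] dec(2) by linarith
  have root: "tree_le par' t s" if "s \<in> N" for s
    using tree that by (auto simp: rooted_tree_def tree_le_def)
  then have top: "top_node N par' B v = t" if "v \<in> K" for v
    using top_node_eqI[OF tree, of t v B] t that by auto
  have "stratified G ?d N par' B" unfolding stratified_def
  proof (intro ballI impI, elim conjE)
    fix u v assume uv: "u \<in> fst G" "v \<in> fst G" "tree_le par' (top_node N par' B u) (top_node N par' B v)"
      "top_node N par' B u \<noteq> top_node N par' B v"
    have "v \<notin> K"
    proof
      assume "v \<in> K"
      then have "top_node N par' B u = t"
        using uv top tree_le_antisym[OF tree t(1), of "top_node N par' B u"] root top_node(1)[OF dec'] by simp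
      then show False using uv top \<open>v \<in> K\<close> by simp
    qed
    then show "?d u \<le> ?d v" by simp
  qed
  from decomposition_to_rank[OF dec' this G(2)]
  obtain r where r: "inj_on r (fst G)" "\<forall>u\<in>fst G. \<forall>v\<in>fst G. ?d u < ?d v \<longrightarrow> r u < r v"
     "\<forall>v\<in>fst G. int (card {u. lower_nbr G r u v}) \<le> width N B" by auto
  moreover have "\<forall>u\<in>K. \<forall>v\<in>fst G - K. r u < r v" using r(2) K(1) by auto
  ultimately show "\<exists>r. inj_on r (fst G) \<and> (\<forall>u\<in>K. \<forall>v\<in>fst G - K. r u < r v) \<and>
     (\<forall>v\<in>fst G. int (card {u. lower_nbr G r u v}) \<le> tw G)" using dec(2) by auto
qed

text \<open>The tree has the vertices themselves as nodes: the piece at \<open>v\<close> consists of \<open>v\<close> and its lower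
  neighbours, and the parent of \<open>v\<close> is its highest lower neighbour.\<close>

lemma elimination_decomposition:
  fixes r :: "nat \<Rightarrow> nat"
  assumes fin: "finite (fst G)" and edges: "\<And>e. e \<in> snd G \<Longrightarrow> \<exists>x y. e = {x, y} \<and> E x y"
    and E: "\<And>x y. E x y \<Longrightarrow> x \<in> fst G \<and> y \<in> fst G \<and> r x < r y \<and> d x \<le> d y"
    and chordal: "\<And>x y z. E x y \<Longrightarrow> E z y \<Longrightarrow> x \<noteq> z \<Longrightarrow> E x z \<or> E z x"
    and card: "\<And>y. y \<in> fst G \<Longrightarrow> int (card {x. E x y}) \<le> k" and k: "-1 \<le> k"
  shows "stratified_tw G d \<le> k"
proof (cases "fst G = {}")
  case True
  have tree: "rooted_tree {0} 0 (\<lambda>_. 0)"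
    unfolding rooted_tree_def by (auto intro: exI[of _ 0])
  moreover have "snd G = {}" using edges E True by fastforce
  ultimately have "tree_decomposition G {0} 0 (\<lambda>_. 0) (\<lambda>_. {})"
    using True by (auto simp: tree_decomposition_def)
  moreover have "stratified G d {0} (\<lambda>_. 0) (\<lambda>_. {})" using True by (simp add: stratified_def)
  ultimately have "stratified_tw G d \<le> width {0} (\<lambda>_. {})" by (rule stratified_tw_le)
  then show ?thesis using k by (simp add: width_def)
next
  case False
  let ?V = "fst G"
  \<comment> \<open>\<open>r\<close> need not be sorted by \<open>d\<close>. The root must have
    least \<open>d\<close>, because every vertex without lower neighbours becomes its child;
    choosing least \<open>r\<close> among the candidates leaves the root itself without lower
    neighbours.\<close>
  obtain a where a: "a \<in> ?V" "\<And>v. v \<in> ?V \<Longrightarrow> d a \<le> d v"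
    using arg_min_if_finite[OF fin False, of d] by (metis linorder_not_less)
  define V0 where "V0 = {v \<in> ?V. d v = d a}"
  have "finite V0" "V0 \<noteq> {}" using fin a by (auto simp: V0_def)
  then obtain v0 where v0: "v0 \<in> V0" "\<And>v. v \<in> V0 \<Longrightarrow> r v0 \<le> r v"
    using arg_min_if_finite[of V0 r] by (metis linorder_not_less)
  have v0': "v0 \<in> ?V" "\<And>v. v \<in> ?V \<Longrightarrow> d v0 \<le> d v" using v0(1) a by (auto simp: V0_def)
  have no_lower: "\<not> E x v0" for x
  proof
    assume x: "E x v0"
    then have "x \<in> V0" using E[OF x] v0' a v0(1) by (auto simp: V0_def intro: antisym)
    then show False using v0(2)[of x] E[OF x] by simp
  qed
  define par where "par v = (if \<exists>x. E x v then (SOME p. E p v \<and> (\<forall>x. E x v \<longrightarrow> r x \<le> r p)) else v0)" for v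
  have par: "E (par v) v \<and> (\<forall>x. E x v \<longrightarrow> r x \<le> r (par v))" if "E x v" for x v
  proof -
    have "{x. E x v} \<subseteq> ?V" using E by auto
    then have f: "finite (r ` {x. E x v})" using fin finite_subset by blast
    moreover have "r ` {x. E x v} \<noteq> {}" using that by auto
    ultimately have "Max (r ` {x. E x v}) \<in> r ` {x. E x v}" by (rule Max_in)
    then obtain p where "E p v" "Max (r ` {x. E x v}) = r p" by auto
    then have "\<exists>p. E p v \<and> (\<forall>x. E x v \<longrightarrow> r x \<le> r p)" using Max_ge[OF f] by force
    then show ?thesis using someI_ex[of "\<lambda>p. E p v \<and> (\<forall>x. E x v \<longrightarrow> r x \<le> r p)"] that
      unfolding par_def by auto
  qed
  have par0: "par v = v0" if "\<nexists>x. E x v" for v using that by (simp add: par_def)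
  have par_V: "par v \<in> ?V \<and> d (par v) \<le> d v" if "v \<in> ?V" for v
    using par[of _ v] par0[of v] E[of "par v" v] v0' that by metis
  have "\<exists>k. (par ^^ k) v = v0" if "v \<in> ?V" for v
    using that
  proof (induction "r v" arbitrary: v rule: less_induct)
    case less
    show ?case
    proof (cases "\<exists>x. E x v")
      case True
      then have "E (par v) v" using par by blast
      then obtain k where "(par ^^ k) (par v) = v0" using less.hyps[of "par v"] E by blast
      then have "(par ^^ Suc k) v = v0" by (simp add: funpow_swap1)
      then show ?thesis by blast
    next
      case False
      then show ?thesis using par0 by (intro exI[of _ 1]) simp
    qed
  qed
  then have tree: "rooted_tree ?V v0 par"
    using fin v0' par0[of v0] no_lower par_V by (auto simp: rooted_tree_def)
  define B where "B v = insert v {x. E x v}" for v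
  \<comment> \<open>Any other lower neighbour \<open>v\<close> of \<open>t\<close> is related to the
    highest one, \<open>par t\<close>, by chordality, and has smaller rank; so it is a lower
    neighbour of \<open>par t\<close>.\<close>
  have up: "v = t \<or> v \<in> B (par t)" if "v \<in> B t" for v t
  proof (cases "v = t \<or> v = par t")
    case False
    then have "E v t" using that by (auto simp: B_def)
    then have "E (par t) t" "r v \<le> r (par t)" using par by blast+
    then have "E v (par t) \<or> E (par t) v" using chordal[of v t "par t"] \<open>E v t\<close> False by blast
    then have "E v (par t)" using E[of "par t" v] \<open>r v \<le> r (par t)\<close> by linarith
    then show ?thesis by (simp add: B_def)
  qed (auto simp: B_def)
  let ?R = "\<lambda>v. {(s, t). s \<in> {t \<in> ?V. v \<in> B t} \<and> t \<in> {t \<in> ?V. v \<in> B t} \<and> (t = par s \<or> s = par t)}"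
  \<comment> \<open>The bags containing \<open>v\<close> form a subtree with root \<open>v\<close>:
    passing to the parent keeps \<open>v\<close> in the bag until \<open>v\<close> itself is
    reached, and \<open>r\<close> decreases on the way.\<close>
  have desc: "tree_le par v t \<and> (t, v) \<in> (?R v)\<^sup>*" if "t \<in> ?V" "v \<in> B t" for v t
    using that
  proof (induction "r t" arbitrary: t rule: less_induct)
    case less
    show ?case
    proof (cases "v = t")
      case True
      then show ?thesis using tree_le_refl by auto
    next
      case False
      then have "E v t" using less.prems by (auto simp: B_def)
      then have *: "r (par t) < r t" "par t \<in> ?V" "v \<in> B (par t)"
        using par E up[OF less.prems(2)] False by blast+
      then have "tree_le par v (par t)" "(par t, v) \<in> (?R v)\<^sup>*" using less.hyps[of "par t"] by blast+
      moreover have "(t, par t) \<in> ?R v" using * less.prems by auto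
      ultimately show ?thesis using tree_le_trans[OF _ tree_le_par]
        by (auto intro: converse_rtrancl_into_rtrancl)
    qed
  qed
  have sym: "sym (?R v)" for v by (auto simp: sym_def)
  have conn: "tree_connected par {t \<in> ?V. v \<in> B t}" for v
    unfolding tree_connected_def
  proof (intro ballI)
    fix s t assume st: "s \<in> {t \<in> ?V. v \<in> B t}" "t \<in> {t \<in> ?V. v \<in> B t}"
    then have "(s, v) \<in> (?R v)\<^sup>*" "(v, t) \<in> (?R v)\<^sup>*"
      using desc symD[OF sym_rtrancl[OF sym]] by blast+
    then show "(s, t) \<in> (?R v)\<^sup>*" by (rule rtrancl_trans)
  qed
  have dec: "tree_decomposition G ?V v0 par B"
    unfolding tree_decomposition_def
  proof (intro conjI ballI)
    show "(\<Union>t\<in>?V. B t) = ?V" using E by (auto simp: B_def)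
    fix e assume "e \<in> snd G"
    then obtain x y where "e = {x, y}" "E x y" using edges by blast
    then show "\<exists>t\<in>?V. e \<subseteq> B t" using E by (intro bexI[of _ y]) (auto simp: B_def)
  qed (use tree conn in auto)
  have top: "top_node ?V par B v = v" if "v \<in> ?V" for v
    using top_node_eqI[OF tree that, of v B] desc by (auto simp: B_def)
  have d_mono: "d u \<le> d v" if "v \<in> ?V" "tree_le par u v" for u v
  proof -
    have "(par ^^ k) v \<in> ?V \<and> d ((par ^^ k) v) \<le> d v" for k
      using that(1) par_V by (induction k) (auto intro: order_trans)
    then show ?thesis using that(2) by (auto simp: tree_le_def)
  qed
  have "stratified G d ?V par B" using top d_mono by (simp add: stratified_def)
  with dec have "stratified_tw G d \<le> width ?V B" by (rule stratified_tw_le)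
  also have "\<dots> \<le> k"
  proof -
    have "Max ((\<lambda>t. card (B t)) ` ?V) \<in> (\<lambda>t. card (B t)) ` ?V" using fin False by simp
    then obtain t where t: "t \<in> ?V" "Max ((\<lambda>t. card (B t)) ` ?V) = card (B t)" by auto
    have "card (B t) \<le> Suc (card {x. E x t})" unfolding B_def by (rule card_insert_le_m1) auto
    then show ?thesis using t card[OF t(1)] by (simp add: width_def)
  qed
  finally show ?thesis .
qed

text \<open>The converse of \<open>decomposition_to_rank\<close>, with \<open>lower_nbr\<close> as
  chordal relation. Sorting by \<open>d\<close>, read contrapositively, makes \<open>d\<close>
  monotone along it.\<close>

lemma stratified_tw_le_rank:
  assumes fin: "finite (fst G)" and edges: "\<And>e. e \<in> snd G \<Longrightarrow> \<exists>x y. e = {x, y} \<and> x \<noteq> y \<and> x \<in> fst G \<and>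
    y \<in> fst G"
    and r: "inj_on r (fst G)" "\<And>u v. u \<in> fst G \<Longrightarrow> v \<in> fst G \<Longrightarrow> d u < d v \<Longrightarrow> r u < r v"
    and card: "\<And>v. v \<in> fst G \<Longrightarrow> int (card {u. lower_nbr G r u v}) \<le> k" and k: "-1 \<le> k"
  shows "stratified_tw G d \<le> k"
proof -
  let ?E = "\<lambda>u v. lower_nbr G r u v \<and> v \<in> fst G"
  have adj: "u \<in> fst G" if "adjacent G w u" for u w
    using edges[of "{w, u}"] that by (auto simp: adjacent_def doubleton_eq_iff)
  have low: "u \<in> fst G" if "lower_nbr G r u v" for u v using that adj by (auto simp: lower_nbr_def)
  show ?thesis
  proof (rule elimination_decomposition[of G ?E r d k, OF fin _ _ _ _ k])
    fix e assume e: "e \<in> snd G"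
    then obtain x y where xy: "e = {x, y}" "x \<noteq> y" "x \<in> fst G" "y \<in> fst G" using edges by blast
    then have "adjacent G x y" "adjacent G y x" "r x \<noteq> r y"
      using e r(1) by (auto simp: adjacent_def insert_commute dest: inj_onD)
    then have "?E x y \<or> ?E y x" using adjacent_lower_nbr xy by (meson linorder_neqE_nat)
    then show "\<exists>x y. e = {x, y} \<and> ?E x y" using xy(1) by (metis insert_commute)
  next
    fix x y assume "?E x y"
    then show "x \<in> fst G \<and> y \<in> fst G \<and> r x < r y \<and> d x \<le> d y"
      using low r(2)[of y x] by (auto simp: lower_nbr_def not_less[symmetric])
  next
    fix x y z assume "?E x y" "?E z y" "x \<noteq> z"
    then show "?E x z \<or> ?E z x" using lower_nbr_chordal[OF r(1)] low by blast
  qed (use card in auto)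
qed

section \<open>Quantifier scopes\<close>

lemma finite_vars: "finite (vars (\<phi> :: 'r formula))"
  by (simp add: fm.set_finite)

lemma vars_eq: "vars \<phi> = free_vars \<phi> \<union> bound_vars \<phi>"
  by (induction \<phi>) auto

lemma subfms_refl: "\<phi> \<in> subfms \<phi>"
  by (cases \<phi>) auto

lemma subfms_trans: "\<psi> \<in> subfms \<chi> \<Longrightarrow> \<chi> \<in> subfms \<phi> \<Longrightarrow> \<psi> \<in> subfms \<phi>"
  by (induction \<phi>) auto

lemma subfms_vars: "\<psi> \<in> subfms \<phi> \<Longrightarrow> vars \<psi> \<subseteq> vars \<phi>"
  by (induction \<phi>) auto

lemma subfms_bound: "\<psi> \<in> subfms \<phi> \<Longrightarrow> bound_vars \<psi> \<subseteq> bound_vars \<phi>"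
  by (induction \<phi>) auto

lemma fm_graph_simps:
  "fst (fm_graph \<phi>) = vars \<phi>"
  "e \<in> snd (fm_graph \<phi>) \<Longrightarrow> \<exists>x y. e = {x, y} \<and> x \<noteq> y \<and> x \<in> vars \<phi> \<and> y \<in> vars \<phi>"
  using subfms_vars vars_eq[of \<phi>] by (fastforce simp: fm_graph_def)+

lemma Quant_subfms_trans: "Quant q x a \<in> subfms \<phi> \<Longrightarrow> \<psi> \<in> subfms a \<Longrightarrow> \<psi> \<in> subfms \<phi>"
  using subfms_trans[of \<psi> "Quant q x a" \<phi>] by simp

lemma bound_iff_Quant: "x \<in> bound_vars \<phi> \<longleftrightarrow> (\<exists>q \<psi>. Quant q x \<psi> \<in> subfms \<phi>)"
  by (induction \<phi>) auto

lemma scope_le_iff: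
  "scope_le \<phi> x y \<longleftrightarrow> x = y \<or> (\<exists>q \<psi>. Quant q x \<psi> \<in> subfms \<phi> \<and> y \<in> bound_vars \<psi>)"
  unfolding scope_le_def bound_iff_Quant ..

lemma scope_le_mono: "\<psi> \<in> subfms \<phi> \<Longrightarrow> scope_le \<psi> x y \<Longrightarrow> scope_le \<phi> x y"
  unfolding scope_le_iff using subfms_trans by blast

section \<open>Positions and minimal subformulas\<close>

lemma subfm_at_subfms: "subfm_at \<phi> p = Some \<alpha> \<Longrightarrow> \<alpha> \<in> subfms \<phi>"
  by (induction \<phi> p rule: subfm_at.induct) (auto simp: subfms_refl split: if_splits)

lemma subfms_position: "\<alpha> \<in> subfms \<phi> \<Longrightarrow> \<exists>p. subfm_at \<phi> p = Some \<alpha>"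
proof (induction \<phi>)
  case (Neg \<phi>)
  then show ?case by (metis insert_iff subfm_at.simps(1,2) subfms.simps(3))
next
  case (Conj \<phi>s)
  show ?case
  proof (cases "\<alpha> = Conj \<phi>s")
    case False
    then obtain i where i: "i < length \<phi>s" "\<alpha> \<in> subfms (\<phi>s ! i)" using Conj.prems
      by (auto simp: in_set_conv_nth)
    then obtain p where "subfm_at (\<phi>s ! i) p = Some \<alpha>" using Conj.IH[of "\<phi>s ! i"] by auto
    then show ?thesis using i by (intro exI[of _ "i # p"]) simp
  qed (auto intro: exI[of _ "[]"])
next
  case (Disj \<phi>s)
  show ?case
  proof (cases "\<alpha> = Disj \<phi>s")
    case False
    then obtain i where i: "i < length \<phi>s" "\<alpha> \<in> subfms (\<phi>s ! i)" using Disj.prems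
      by (auto simp: in_set_conv_nth)
    then obtain p where "subfm_at (\<phi>s ! i) p = Some \<alpha>" using Disj.IH[of "\<phi>s ! i"] by auto
    then show ?thesis using i by (intro exI[of _ "i # p"]) simp
  qed (auto intro: exI[of _ "[]"])
next
  case (Quant q x \<phi>)
  then show ?case by (metis insert_iff subfm_at.simps(1,5) subfms.simps(6))
qed (auto intro: exI[of _ "[]"])

lemma subfm_at_append:
  "subfm_at \<phi> (p @ q) = Some \<alpha> \<Longrightarrow> \<exists>\<beta>. subfm_at \<phi> p = Some \<beta> \<and> subfm_at \<beta> q = Some \<alpha>"
  by (induction \<phi> p rule: subfm_at.induct) (auto split: if_splits)

lemma subfm_at_prefix_vars:
  assumes "subfm_at \<phi> p = Some \<alpha>" "prefix q p"
  shows "subfm_at \<phi> q \<noteq> None" "vars \<alpha> \<subseteq> vars (the (subfm_at \<phi> q))"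
proof -
  obtain s where "p = q @ s" using assms(2) by (auto elim: prefixE)
  then obtain \<beta> where "subfm_at \<phi> q = Some \<beta>" "subfm_at \<beta> s = Some \<alpha>" using subfm_at_append assms(1)
    by blast
  then show "subfm_at \<phi> q \<noteq> None" "vars \<alpha> \<subseteq> vars (the (subfm_at \<phi> q))"
    using subfms_vars[OF subfm_at_subfms] by simp_all
qed

text \<open>More atoms have a shorter common prefix, hence a larger subformula. Nonemptiness matters
  since the longest common prefix of no positions at all is meaningless.\<close>

lemma vars_min_subfm_mono:
  assumes "X \<subseteq> Y" "atom_positions \<phi> X \<noteq> {}"
  shows "vars (min_subfm \<phi> X) \<subseteq> vars (min_subfm \<phi> Y)"
proof -
  let ?P = "atom_positions \<phi> X" and ?P' = "atom_positions \<phi> Y"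
  have sub: "?P \<subseteq> ?P'" using assms(1) by (auto simp: atom_positions_def)
  then have "\<forall>p\<in>?P. prefix (Longest_common_prefix ?P') p"
    using Longest_common_prefix_prefix by blast
  then have pre: "prefix (Longest_common_prefix ?P') (Longest_common_prefix ?P)"
    using Longest_common_prefix_max_prefix[OF assms(2)] by blast
  obtain p \<alpha> where p: "p \<in> ?P" "subfm_at \<phi> p = Some \<alpha>" using assms(2) by (auto simp: atom_positions_def)
  then obtain \<beta> where "subfm_at \<phi> (Longest_common_prefix ?P) = Some \<beta>"
    using subfm_at_prefix_vars(1)[OF p(2) Longest_common_prefix_prefix[OF p(1)]] by auto
  then show ?thesis using subfm_at_prefix_vars(2)[OF _ pre] by (simp add: min_subfm_def)
qed

lemma atom_in_min_subfm:
  assumes "\<alpha> \<in> subfms \<phi>" "is_atom \<alpha>" "x \<in> vars \<alpha>" "y \<in> vars \<alpha>" "y \<in> X"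
  shows "x \<in> vars (min_subfm \<phi> X)"
proof -
  obtain p where p: "subfm_at \<phi> p = Some \<alpha>" using subfms_position assms(1) by blast
  then have "p \<in> atom_positions \<phi> X" using assms by (auto simp: atom_positions_def)
  then show ?thesis using subfm_at_prefix_vars(2)[OF p Longest_common_prefix_prefix] assms(3)
    by (auto simp: min_subfm_def)
qed


section \<open>Nesting of scopes when no variable is quantified twice\<close>

lemma distinct_concat_same:
  assumes "distinct (concat (map f xs))" "a \<in> set xs" "b \<in> set xs" "x \<in> set (f a)" "x \<in> set (f b)"
  shows "a = b"
  using assms by (induction xs) auto

text \<open>Scopes form a laminar family: two of them that bind the same variable cannot lie in
  different conjuncts or disjuncts, because \<open>quantified\<close> would list the variable
  twice.\<close>

lemma nested_scopes:
  assumes "distinct (quantified \<phi>)" "Quant q x a \<in> subfms \<phi>" "Quant q' y b \<in> subfms \<phi>"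
    "z \<in> insert x (bound_vars a)" "z \<in> insert y (bound_vars b)"
  shows "Quant q x a \<in> subfms (Quant q' y b) \<or> Quant q' y b \<in> subfms (Quant q x a)"
  using assms
proof (induction \<phi>)
  case (Conj \<phi>s)
  then obtain \<phi>1 \<phi>2 where *: "\<phi>1 \<in> set \<phi>s" "Quant q x a \<in> subfms \<phi>1" "\<phi>2 \<in> set \<phi>s" "Quant q' y b \<in> subfms \<phi>2"
    by auto
  have "z \<in> bound_vars \<phi>1" "z \<in> bound_vars \<phi>2"
    using subfms_bound[OF *(2)] subfms_bound[OF *(4)] Conj.prems by auto
  then have "\<phi>1 = \<phi>2" using distinct_concat_same[of quantified \<phi>s] * Conj.prems(1) by auto
  moreover have "distinct (quantified \<phi>1)" using Conj.prems(1) *(1) by (auto simp: distinct_concat_iff)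
  ultimately show ?case using Conj.IH[of \<phi>1] * Conj.prems by auto
next
  case (Disj \<phi>s)
  then obtain \<phi>1 \<phi>2 where *: "\<phi>1 \<in> set \<phi>s" "Quant q x a \<in> subfms \<phi>1" "\<phi>2 \<in> set \<phi>s" "Quant q' y b \<in> subfms \<phi>2"
    by auto
  have "z \<in> bound_vars \<phi>1" "z \<in> bound_vars \<phi>2"
    using subfms_bound[OF *(2)] subfms_bound[OF *(4)] Disj.prems by auto
  then have "\<phi>1 = \<phi>2" using distinct_concat_same[of quantified \<phi>s] * Disj.prems(1) by auto
  moreover have "distinct (quantified \<phi>1)" using Disj.prems(1) *(1) by (auto simp: distinct_concat_iff)
  ultimately show ?case using Disj.IH[of \<phi>1] * Disj.prems by auto
next
  case (Quant p v \<phi>)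
  then show ?case by auto
qed auto

lemma Quant_notin_scope:
  assumes "distinct (quantified \<phi>)" "Quant q x a \<in> subfms \<phi>"
  shows "x \<notin> bound_vars a" "distinct (quantified a)"
  using assms by (induction \<phi>) (auto simp: distinct_concat_iff)

text \<open>The two are nested, and strict nesting would bind \<open>x\<close> again inside its own
  scope.\<close>

lemma Quant_unique:
  assumes d: "distinct (quantified \<phi>)" and "Quant q x a \<in> subfms \<phi>" "Quant q' x b \<in> subfms \<phi>"
  shows "q = q' \<and> a = b"
proof -
  have "x \<notin> bound_vars a" "x \<notin> bound_vars b" using Quant_notin_scope[OF d] assms by auto
  moreover have "Quant q x a \<in> subfms (Quant q' x b) \<or> Quant q' x b \<in> subfms (Quant q x a)"
    using nested_scopes[OF assms] by auto
  ultimately show ?thesis using bound_iff_Quant by auto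
qed

text \<open>Both quantifiers lie on the path to the atom. Disjointness of free and bound variables
  excludes that \<open>x\<close> is free in the branch of the atom and bound in another
  branch.\<close>

lemma atom_scopes_comparable:
  assumes "distinct (quantified \<phi>)" "free_vars \<phi> \<inter> bound_vars \<phi> = {}" "\<alpha> \<in> subfms \<phi>" "is_atom \<alpha>"
    "x \<in> vars \<alpha>" "y \<in> vars \<alpha>" "x \<in> bound_vars \<phi>" "y \<in> bound_vars \<phi>"
  shows "scope_le \<phi> x y \<or> scope_le \<phi> y x"
  using assms
proof (induction \<phi>)
  case (Neg \<phi>)
  then show ?case by (auto simp: scope_le_iff)
next
  case (Conj \<phi>s)
  then obtain \<psi> where \<psi>: "\<psi> \<in> set \<phi>s" "\<alpha> \<in> subfms \<psi>" by auto
  have "x \<in> bound_vars \<psi>" "y \<in> bound_vars \<psi>"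
    using subfms_vars[OF \<psi>(2)] vars_eq[of \<psi>] \<psi>(1) Conj.prems by auto
  moreover have "distinct (quantified \<psi>)" "free_vars \<psi> \<inter> bound_vars \<psi> = {}"
    using Conj.prems(1,2) \<psi>(1) by (auto simp: distinct_concat_iff)
  ultimately have "scope_le \<psi> x y \<or> scope_le \<psi> y x" using Conj.IH[OF \<psi>(1)] \<psi>(2) Conj.prems by auto
  moreover have "\<psi> \<in> subfms (Conj \<phi>s)" using \<psi>(1) subfms_refl[of \<psi>] by auto
  ultimately show ?case using scope_le_mono by blast
next
  case (Disj \<phi>s)
  then obtain \<psi> where \<psi>: "\<psi> \<in> set \<phi>s" "\<alpha> \<in> subfms \<psi>" by auto
  have "x \<in> bound_vars \<psi>" "y \<in> bound_vars \<psi>"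
    using subfms_vars[OF \<psi>(2)] vars_eq[of \<psi>] \<psi>(1) Disj.prems by auto
  moreover have "distinct (quantified \<psi>)" "free_vars \<psi> \<inter> bound_vars \<psi> = {}"
    using Disj.prems(1,2) \<psi>(1) by (auto simp: distinct_concat_iff)
  ultimately have "scope_le \<psi> x y \<or> scope_le \<psi> y x" using Disj.IH[OF \<psi>(1)] \<psi>(2) Disj.prems by auto
  moreover have "\<psi> \<in> subfms (Disj \<phi>s)" using \<psi>(1) subfms_refl[of \<psi>] by auto
  ultimately show ?case using scope_le_mono by blast
next
  case (Quant q z \<phi>)
  show ?case
  proof (cases "x = z \<or> y = z")
    case True
    then show ?thesis using Quant.prems by (auto simp: scope_le_iff)
  next
    case False
    then have "scope_le \<phi> x y \<or> scope_le \<phi> y x" using Quant.IH Quant.prems by auto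
    then show ?thesis by (auto simp: scope_le_iff)
  qed
qed auto

lemma quant_of_eq:
  assumes "distinct (quantified \<phi>)" "Quant q x a \<in> subfms \<phi>"
  shows "quant_of \<phi> x = q"
  unfolding quant_of_def
proof (rule the_equality)
  fix p assume "\<exists>\<psi>. Quant p x \<psi> \<in> subfms \<phi>"
  then show "p = q" using Quant_unique[OF assms] by blast
qed (use assms in blast)

lemma scope_le_refl: "scope_le \<phi> x x"
  by (simp add: scope_le_def)

lemma scope_le_bound: "scope_le \<phi> x y \<Longrightarrow> y \<in> bound_vars \<phi> \<Longrightarrow> x \<in> bound_vars \<phi>"
  by (auto simp: scope_le_iff bound_iff_Quant)

context
  fixes \<phi> :: "'r formula"
  assumes distinct: "distinct (quantified \<phi>)"
begin

lemma scope_le_trans: assumes "scope_le \<phi> x y" "scope_le \<phi> y z" shows "scope_le \<phi> x z"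
proof (cases "x = y \<or> y = z")
  case False
  then obtain q a q' b where *: "Quant q x a \<in> subfms \<phi>" "y \<in> bound_vars a" "Quant q' y b \<in> subfms \<phi>" "z \<in> bound_vars b"
    using assms by (auto simp: scope_le_iff)
  obtain q'' c where c: "Quant q'' y c \<in> subfms a" using *(2) bound_iff_Quant by blast
  then have "Quant q'' y c \<in> subfms \<phi>" using Quant_subfms_trans[OF *(1)] by blast
  then have "b = c" using Quant_unique[OF distinct *(3)] by blast
  then have "z \<in> bound_vars a" using subfms_bound[OF c] * by auto
  then show ?thesis using * by (auto simp: scope_le_iff)
qed (use assms in auto)

lemma scope_le_antisym: assumes "scope_le \<phi> x y" "scope_le \<phi> y x" shows "x = y"
proof (rule ccontr)
  assume "x \<noteq> y"
  then obtain q a q' b where *: "Quant q x a \<in> subfms \<phi>" "y \<in> bound_vars a" "Quant q' y b \<in> subfms \<phi>" "x \<in> bound_vars b"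
    using assms by (auto simp: scope_le_iff)
  obtain q'' c where c: "Quant q'' y c \<in> subfms a" using *(2) bound_iff_Quant by blast
  then have "Quant q'' y c \<in> subfms \<phi>" using Quant_subfms_trans[OF *(1)] by blast
  then have "b = c" using Quant_unique[OF distinct *(3)] by blast
  then have "x \<in> bound_vars a" using subfms_bound[OF c] * by auto
  then show False using Quant_notin_scope[OF distinct *(1)] by simp
qed

lemma scope_le_forest:
  assumes "scope_le \<phi> x z" "scope_le \<phi> y z" shows "scope_le \<phi> x y \<or> scope_le \<phi> y x"
proof (cases "x = z \<or> y = z")
  case False
  then obtain q a q' b where *: "Quant q x a \<in> subfms \<phi>" "z \<in> bound_vars a" "Quant q' y b \<in> subfms \<phi>" "z \<in> bound_vars b"
    using assms by (auto simp: scope_le_iff)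
  then have "Quant q x a \<in> subfms (Quant q' y b) \<or> Quant q' y b \<in> subfms (Quant q x a)"
    using nested_scopes[OF distinct] by blast
  then show ?thesis using * bound_iff_Quant by (auto simp: scope_le_iff)
qed (use assms in auto)

lemma finite_scope_below: "finite {z. scope_le \<phi> z x}"
  by (rule finite_subset[of _ "insert x (bound_vars \<phi>)"]) (auto simp: scope_le_iff bound_iff_Quant)

end

section \<open>Alternation depth over an abstract order\<close>

lemma alternations_snoc:
  assumes "vs \<noteq> []"
  shows "alternations \<phi> (vs @ [x]) = alternations \<phi> vs + (if quant_of \<phi> (last vs) \<noteq> quant_of \<phi> x then 1 else 0)"
proof -
  let ?Q = "quant_of \<phi>"
  let ?A = "{i. Suc i < length vs \<and> ?Q (vs ! i) \<noteq> ?Q (vs ! Suc i)}"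
  have "{i. Suc i < length (vs @ [x]) \<and> ?Q ((vs @ [x]) ! i) \<noteq> ?Q ((vs @ [x]) ! Suc i)} =
    ?A \<union> (if ?Q (last vs) \<noteq> ?Q x then {length vs - 1} else {})"
    (is "?L = ?R")
  proof (rule set_eqI)
    fix i
    have len: "Suc (length vs - 1) = length vs" using assms by (cases vs) auto
    consider "Suc i < length vs" | "i = length vs - 1" | "length vs \<le> i" using len by linarith
    then show "i \<in> ?L \<longleftrightarrow> i \<in> ?R"
    proof cases
      case 1
      then show ?thesis by (auto simp: nth_append)
    next
      case 2
      then show ?thesis using assms len by (auto simp: nth_append last_conv_nth)
    next
      case 3
      then show ?thesis using assms by (cases vs) auto
    qed
  qed
  moreover have "length vs - 1 \<notin> ?A" using assms by auto
  moreover have "finite ?A" by (rule finite_subset[of _ "{..<length vs}"]) auto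
  ultimately show ?thesis by (simp add: alternations_def)
qed

text \<open>Both alternation depths are of this form: \<open>c\<close> is the contribution of the first variable.\<close>

definition alt_depth :: "'r formula \<Rightarrow> (nat \<Rightarrow> nat \<Rightarrow> bool) \<Rightarrow> (nat \<Rightarrow> nat) \<Rightarrow> nat \<Rightarrow> nat" where
  "alt_depth \<phi> le c x = Max ((\<lambda>vs. alternations \<phi> vs + c (hd vs)) ` chains_to le x)"

lemma singleton_chain: "[x] \<in> chains_to le x"
  by (simp add: chains_to_def)

text \<open>Used for both \<open>scope_le\<close> and \<open>ess_le\<close>. Chains have no
  repetitions, so finitely many elements below \<open>x\<close> leave finitely many chains ending in
  \<open>x\<close>, and the maxima in the depths are attained.\<close>

locale finite_below_order =
  fixes le :: "nat \<Rightarrow> nat \<Rightarrow> bool"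
  assumes trans: "\<And>x y z. le x y \<Longrightarrow> le y z \<Longrightarrow> le x z"
    and antisym: "\<And>x y. le x y \<Longrightarrow> le y x \<Longrightarrow> x = y"
    and fin: "\<And>x. finite {z. le z x}"
begin

lemma chain_below: "vs \<in> chains_to le x \<Longrightarrow> distinct vs \<and> set vs \<subseteq> insert x {z. le z x}"
proof (induction vs arbitrary: x rule: rev_induct)
  case (snoc y vs)
  then have [simp]: "y = x" by (simp add: chains_to_def)
  show ?case
  proof (cases "vs = []")
    case False
    then have "vs \<in> chains_to le (last vs)" and l: "le (last vs) x" "last vs \<noteq> x"
      using snoc.prems by (auto simp: chains_to_def successively_append_iff)
    then have IH: "distinct vs" "set vs \<subseteq> insert (last vs) {z. le z (last vs)}" using snoc.IH by auto
    then have "set vs \<subseteq> {z. le z x}" using l trans by blast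
    moreover have "x \<notin> set vs" using IH(2) l antisym by blast
    ultimately show ?thesis using IH by auto
  qed simp
qed (simp add: chains_to_def)

lemma finite_chains: "finite (chains_to le x)"
proof (rule finite_subset)
  let ?A = "insert x {z. le z x}"
  show "chains_to le x \<subseteq> {vs. set vs \<subseteq> ?A \<and> length vs \<le> card ?A}"
  proof
    fix vs assume "vs \<in> chains_to le x"
    then have "distinct vs" "set vs \<subseteq> ?A" using chain_below by auto
    moreover from this have "length vs \<le> card ?A" using fin
      by (metis card_mono distinct_card finite_insert)
    ultimately show "vs \<in> {vs. set vs \<subseteq> ?A \<and> length vs \<le> card ?A}" by simp
  qed
  show "finite {vs. set vs \<subseteq> ?A \<and> length vs \<le> card ?A}" using fin by (intro finite_lists_length_le) simp
qed

lemma alt_depth_attained: "\<exists>vs\<in>chains_to le x. alt_depth \<phi> le c x = alternations \<phi> vs + c (hd vs)"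
proof -
  have "alt_depth \<phi> le c x \<in> (\<lambda>vs. alternations \<phi> vs + c (hd vs)) ` chains_to le x"
    unfolding alt_depth_def using finite_chains singleton_chain by (intro Max_in) auto
  then show ?thesis by blast
qed

lemma alt_depth_ge: "vs \<in> chains_to le x \<Longrightarrow> alternations \<phi> vs + c (hd vs) \<le> alt_depth \<phi> le c x"
  unfolding alt_depth_def using finite_chains by auto

lemma alt_depth_ge_base: "c x \<le> alt_depth \<phi> le c x"
  using alt_depth_ge[OF singleton_chain] by (simp add: alternations_def)

lemma alt_depth_mono:
  assumes "le x y" "x \<noteq> y"
  shows "alt_depth \<phi> le c x + (if quant_of \<phi> x \<noteq> quant_of \<phi> y then 1 else 0) \<le> alt_depth \<phi> le c y"
proof -
  obtain vs where vs: "vs \<in> chains_to le x" "alt_depth \<phi> le c x = alternations \<phi> vs + c (hd vs)"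
    using alt_depth_attained by blast
  then have "vs \<noteq> []" "last vs = x" by (auto simp: chains_to_def)
  moreover from this have "vs @ [y] \<in> chains_to le y" using vs(1) assms
    by (auto simp: chains_to_def successively_append_iff)
  ultimately show ?thesis using alt_depth_ge[of "vs @ [y]" y \<phi> c] vs(2) by (simp add: alternations_snoc)
qed

text \<open>An optimal chain is either \<open>[x]\<close> or has a last but one element, which
  serves as \<open>y\<close>.\<close>

lemma alt_depth_cases:
  "alt_depth \<phi> le c x = c x \<or>
    (\<exists>y. le y x \<and> y \<noteq> x \<and> alt_depth \<phi> le c x \<le> alt_depth \<phi> le c y + (if quant_of \<phi> y \<noteq> quant_of \<phi> x then 1 else 0))"
proof -
  obtain vs where vs: "vs \<in> chains_to le x" "alt_depth \<phi> le c x = alternations \<phi> vs + c (hd vs)"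
    using alt_depth_attained by blast
  then have "vs \<noteq> []" "last vs = x" by (auto simp: chains_to_def)
  then obtain ws where ws: "vs = ws @ [x]" by (metis append_butlast_last_id)
  show ?thesis
  proof (cases "ws = []")
    case True
    then show ?thesis using vs ws by (simp add: alternations_def)
  next
    case False
    then have "ws \<in> chains_to le (last ws)" "le (last ws) x" "last ws \<noteq> x"
      using vs(1) ws by (auto simp: chains_to_def successively_append_iff)
    then show ?thesis using alt_depth_ge[of ws "last ws" \<phi> c] vs(2) ws False
      by (intro disjI2 exI[of _ "last ws"]) (simp add: alternations_snoc)
  qed
qed

end

section \<open>The essential alternation depth\<close>

lemma scope_order: "distinct (quantified \<phi>) \<Longrightarrow> finite_below_order (scope_le \<phi>)"
  by unfold_locales (fact scope_le_trans scope_le_antisym finite_scope_below)+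

lemma ad'_alt_depth:
  assumes "distinct (quantified \<phi>)" "x \<notin> free_vars \<phi>"
  shows "ad' \<phi> x = alt_depth \<phi> (scope_le \<phi>) (\<lambda>_. 1) x"
proof -
  have "1 + Max (alternations \<phi> ` chains_to (scope_le \<phi>) x) = Max ((\<lambda>n. 1 + n) ` alternations \<phi> ` chains_to (scope_le \<phi>) x)"
    using finite_below_order.finite_chains[OF scope_order[OF assms(1)]] singleton_chain
      by (intro mono_Max_commute) (auto simp: mono_def)
  then show ?thesis using assms(2) by (simp add: ad'_def alt_depth_def image_image)
qed

section \<open>Growth of \<open>ad'\<close> along scopes and within quantifier blocks\<close>

context
  fixes \<phi> :: "'r formula"
  assumes straight: "straight \<phi>"
begin

lemma straightD: "distinct (quantified \<phi>)" "free_vars \<phi> \<inter> bound_vars \<phi> = {}"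
  using straight by (auto simp: straight_def)

lemma ad'_bound: "x \<in> bound_vars \<phi> \<Longrightarrow> ad' \<phi> x = alt_depth \<phi> (scope_le \<phi>) (\<lambda>_. 1) x"
  using ad'_alt_depth straightD by blast

interpretation finite_below_order "scope_le \<phi>"
  by (rule scope_order[OF straightD(1)])

lemma ad'_pos: "x \<in> bound_vars \<phi> \<Longrightarrow> 1 \<le> ad' \<phi> x"
  using alt_depth_ge_base[of "\<lambda>_. 1"] ad'_bound by simp

lemma ad'_mono:
  assumes "scope_le \<phi> x y" "y \<in> bound_vars \<phi>"
  shows "ad' \<phi> x + (if quant_of \<phi> x \<noteq> quant_of \<phi> y then 1 else 0) \<le> ad' \<phi> y"
  using alt_depth_mono[OF assms(1), of \<phi> "\<lambda>_. 1"] assms ad'_bound scope_le_bound[OF assms]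
  by (cases "x = y") auto

lemma ad'_cases:
  assumes "x \<in> bound_vars \<phi>"
  shows "ad' \<phi> x = 1 \<or> (\<exists>y. scope_le \<phi> y x \<and> y \<noteq> x \<and>
    ad' \<phi> x \<le> ad' \<phi> y + (if quant_of \<phi> y \<noteq> quant_of \<phi> x then 1 else 0))"
  using alt_depth_cases[of \<phi> "\<lambda>_. 1" x] ad'_bound
    scope_le_bound assms by metis

lemma scope_finite_induct [consumes 1, case_names step]:
  assumes "x \<in> bound_vars \<phi>"
    "\<And>x. x \<in> bound_vars \<phi> \<Longrightarrow> (\<And>y. scope_le \<phi> y x \<Longrightarrow> y \<noteq> x \<Longrightarrow> P y) \<Longrightarrow> P x"
  shows "P x"
  using assms(1)
proof (induction "card {z. scope_le \<phi> z x}" arbitrary: x rule: less_induct)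
  case less
  show ?case
  proof (rule assms(2)[OF less.prems])
    fix y assume y: "scope_le \<phi> y x" "y \<noteq> x"
    have "{z. scope_le \<phi> z y} \<subset> {z. scope_le \<phi> z x}"
      using y trans antisym scope_le_refl[of \<phi> x] by blast
    then show "P y" using less scope_le_bound[OF y(1)] psubset_card_mono[OF fin] by blast
  qed
qed

text \<open>The predecessor \<open>z\<close> of \<open>x\<close> in an optimal chain is comparable
  with \<open>y\<close>. If it lies below \<open>y\<close>, it is in the block and induction
  applies. If it lies above \<open>y\<close>, the step from \<open>z\<close> to \<open>y\<close>
  gains as much as the one to \<open>x\<close>, both having the same quantifier.\<close>

lemma ad'_same_block:
  assumes xy: "scope_le \<phi> y x" "x \<in> bound_vars \<phi>"
    and block: "\<And>z. scope_le \<phi> y z \<Longrightarrow> scope_le \<phi> z x \<Longrightarrow> quant_of \<phi> z = quant_of \<phi> x"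
  shows "ad' \<phi> x \<le> ad' \<phi> y"
  using xy(2,1) block
proof (induction x rule: scope_finite_induct)
  case (step x)
  show ?case
  proof (cases "ad' \<phi> x = 1")
    case True
    then show ?thesis using ad'_pos scope_le_bound[OF step.prems(1) step.hyps] by simp
  next
    case False
    then obtain z where z: "scope_le \<phi> z x" "z \<noteq> x"
      "ad' \<phi> x \<le> ad' \<phi> z + (if quant_of \<phi> z \<noteq> quant_of \<phi> x then 1 else 0)"
        using ad'_cases[OF step.hyps] by blast
    have y: "y \<in> bound_vars \<phi>" using scope_le_bound[OF step.prems(1) step.hyps] .
    have q: "quant_of \<phi> y = quant_of \<phi> x" using step.prems(2)[OF scope_le_refl step.prems(1)] .
    show ?thesis
    proof (cases "scope_le \<phi> y z")
      case True
      then have "quant_of \<phi> z = quant_of \<phi> x" using step.prems(2) z by blast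
      moreover have "ad' \<phi> z \<le> ad' \<phi> y" using step.IH[OF z(1,2) True] step.prems(2) z(1) \<open>quant_of \<phi> z = quant_of \<phi> x\<close>
        trans by metis
      ultimately show ?thesis using z(3) by simp
    next
      case False
      then have "scope_le \<phi> z y" using scope_le_forest[OF straightD(1) z(1) step.prems(1)] by blast
      then show ?thesis using ad'_mono[OF _ y] z(3) q by fastforce
    qed
  qed
qed

end

definition ead_base :: "'r formula \<Rightarrow> nat \<Rightarrow> nat" where
  "ead_base \<phi> x = (case quant_of \<phi> x of Exists \<Rightarrow> 1 | Forall \<Rightarrow> 2)"

section \<open>The essential order as the closure of direct steps\<close>

context
  fixes \<phi> :: "'r formula"
  assumes straight: "straight \<phi>"
    and used: "\<And>x. x \<in> bound_vars \<phi> \<Longrightarrow> \<exists>\<alpha>\<in>subfms \<phi>. is_atom \<alpha> \<and> x \<in> vars \<alpha>"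
begin

abbreviation (input) "ess \<equiv> \<Inter> {R. entanglement_closed \<phi> R}"

lemmas dist = straightD(1)[OF straight]

lemma bound_sub_vars: "bound_vars \<phi> \<subseteq> vars \<phi>"
  using vars_eq by blast

text \<open>A larger relation enlarges the sets whose minimal subformulas are taken.
  \<open>used\<close> and reflexivity make these sets meet an atom, as monotonicity of
  \<open>min_subfm\<close> requires.\<close>

lemma entangled_mono:
  assumes "R \<subseteq> R'" "refl_on (vars \<phi>) R" "x \<in> bound_vars \<phi>" "y \<in> bound_vars \<phi>" "entangled \<phi> R x y"
  shows "entangled \<phi> R' x y"
proof -
  have "vars (min_subfm \<phi> {z. (x, z) \<in> R}) \<subseteq> vars (min_subfm \<phi> {z. (x, z) \<in> R'})" if x: "x \<in> bound_vars \<phi>" for x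
  proof (rule vars_min_subfm_mono)
    show "{z. (x, z) \<in> R} \<subseteq> {z. (x, z) \<in> R'}" using assms(1) by auto
    obtain \<alpha> where \<alpha>: "\<alpha> \<in> subfms \<phi>" "is_atom \<alpha>" "x \<in> vars \<alpha>" using used[OF x] by blast
    moreover have "(x, x) \<in> R" using x bound_sub_vars refl_onD[OF assms(2)] by blast
    ultimately show "atom_positions \<phi> {z. (x, z) \<in> R} \<noteq> {}"
      using subfms_position[OF \<alpha>(1)] by (force simp: atom_positions_def)
  qed
  then show ?thesis using assms unfolding entangled_def by blast
qed

lemma entangled_sym: "entangled \<phi> R x y \<Longrightarrow> entangled \<phi> R y x"
  by (auto simp: entangled_def)

lemma atom_entangled:
  assumes "refl_on (vars \<phi>) R" "\<alpha> \<in> subfms \<phi>" "is_atom \<alpha>" "x \<in> vars \<alpha>" "y \<in> vars \<alpha>"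
  shows "entangled \<phi> R x y"
proof -
  have "x \<in> vars \<phi>" "y \<in> vars \<phi>" using subfms_vars assms by blast+
  then have "(x, x) \<in> R" "(y, y) \<in> R" using refl_onD[OF assms(1)] by auto
  then show ?thesis using atom_in_min_subfm[OF assms(2,3)] assms(4,5) by (auto simp: entangled_def)
qed

text \<open>The side conditions on the path from \<open>x\<close> to \<open>y\<close> in the definition of the essential order are
  symmetric, so the path is replaced by connectedness.\<close>

definition linked :: "(nat \<times> nat) set \<Rightarrow> nat \<Rightarrow> nat \<Rightarrow> nat \<Rightarrow> nat \<Rightarrow> bool" where
  "linked R x y = (\<lambda>a b. a \<in> bound_vars \<phi> \<and> b \<in> bound_vars \<phi> \<and> entangled \<phi> R a b \<and>
     ((x, a) \<in> R \<or> (y, a) \<in> R) \<and> ((x, b) \<in> R \<or> (y, b) \<in> R))\<^sup>*\<^sup>*"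

text \<open>One application of the rule that generates the essential order.\<close>

definition direct :: "(nat \<times> nat) set \<Rightarrow> nat \<Rightarrow> nat \<Rightarrow> bool" where
  "direct R x y \<longleftrightarrow> x \<in> bound_vars \<phi> \<and> y \<in> bound_vars \<phi> \<and> scope_le \<phi> x y \<and>
     quant_of \<phi> x \<noteq> quant_of \<phi> y \<and> linked R x y x y"

lemma linked_refl: "linked R x y a a"
  by (simp add: linked_def)

lemma linked_trans: "linked R x y a b \<Longrightarrow> linked R x y b c \<Longrightarrow> linked R x y a c"
  by (simp add: linked_def)

lemma linked_sym: "linked R x y a b \<Longrightarrow> linked R x y b a"
  unfolding linked_def by (rule sympD[OF symp_rtranclp]) (auto intro: sympI entangled_sym)

lemma linked_step:
  assumes "a \<in> bound_vars \<phi>" "b \<in> bound_vars \<phi>" "entangled \<phi> R a b"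
    "(x, a) \<in> R \<or> (y, a) \<in> R" "(x, b) \<in> R \<or> (y, b) \<in> R"
  shows "linked R x y a b"
  unfolding linked_def using assms by (intro r_into_rtranclp) blast

lemma linked_mono:
  assumes "linked R x y a b" "\<And>z. z \<in> bound_vars \<phi> \<Longrightarrow> (x, z) \<in> R \<or> (y, z) \<in> R \<Longrightarrow> (x', z) \<in> R' \<or>
    (y', z) \<in> R'"
    "\<And>a b. a \<in> bound_vars \<phi> \<Longrightarrow> b \<in> bound_vars \<phi> \<Longrightarrow> entangled \<phi> R a b \<Longrightarrow> entangled \<phi> R' a b"
  shows "linked R' x' y' a b"
  using assms(1) unfolding linked_def
  by (rule rtranclp_mono[THEN predicate2D, rotated]) (use assms(2,3) in blast)

lemma linked_path:
  assumes "linked R x y x b" "x \<in> bound_vars \<phi>"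
  shows "\<exists>zs. zs \<noteq> [] \<and> hd zs = x \<and> last zs = b \<and> set zs \<subseteq> bound_vars \<phi> \<and>
    (\<forall>i. Suc i < length zs \<longrightarrow> entangled \<phi> R (zs ! i) (zs ! Suc i) \<and> ((x, zs ! i) \<in> R \<or> (y, zs ! i) \<in> R))"
  using assms(1) unfolding linked_def
proof (induction rule: rtranclp_induct)
  case base
  then show ?case using assms(2) by (intro exI[of _ "[x]"]) simp
next
  case (step a b)
  then obtain zs where zs: "zs \<noteq> []" "hd zs = x" "last zs = a" "set zs \<subseteq> bound_vars \<phi>"
    "\<forall>i. Suc i < length zs \<longrightarrow> entangled \<phi> R (zs ! i) (zs ! Suc i) \<and> ((x, zs ! i) \<in> R \<or>
      (y, zs ! i) \<in> R)" by blast
  have "entangled \<phi> R ((zs @ [b]) ! i) ((zs @ [b]) ! Suc i) \<and> ((x, (zs @ [b]) ! i) \<in> R \<or>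
    (y, (zs @ [b]) ! i) \<in> R)"
    if i: "Suc i < length (zs @ [b])" for i
  proof (cases "Suc i < length zs")
    case True
    then show ?thesis using zs(5) by (simp add: nth_append)
  next
    case False
    then have "i = length zs - 1" "Suc i = length zs" using i by auto
    then have "(zs @ [b]) ! i = a" "(zs @ [b]) ! Suc i = b" using zs(1,3)
      by (auto simp: nth_append last_conv_nth)
    then show ?thesis using step(2) by simp
  qed
  then show ?case using zs step(2) by (intro exI[of _ "zs @ [b]"]) simp
qed

lemma path_linked:
  assumes "zs \<noteq> []" "hd zs = x" "last zs = y" "set zs \<subseteq> bound_vars \<phi>" "(y, y) \<in> R"
    "\<forall>i. Suc i < length zs \<longrightarrow> entangled \<phi> R (zs ! i) (zs ! Suc i) \<and> ((x, zs ! i) \<in> R \<or> (y, zs ! i) \<in> R)"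
  shows "linked R x y x y"
proof -
  \<comment> \<open>The condition on the path leaves out its last element; that is \<open>y\<close>,
    covered by \<open>(y, y) \<in> R\<close>.\<close>
  have W: "(x, zs ! i) \<in> R \<or> (y, zs ! i) \<in> R" if "i < length zs" for i
  proof (cases "Suc i < length zs")
    case False
    then have "i = length zs - 1" using that by simp
    then show ?thesis using assms(1,3,5) by (simp add: last_conv_nth)
  qed (use assms(6) in blast)
  have "linked R x y x (zs ! i)" if "i < length zs" for i
    using that
  proof (induction i)
    case 0
    then show ?case using assms(1,2) linked_refl by (simp add: hd_conv_nth)
  next
    case (Suc i)
    have "linked R x y (zs ! i) (zs ! Suc i)"
      using Suc.prems assms(4,6) W[of i] W[of "Suc i"] by (intro linked_step) (auto dest: nth_mem)
    then show ?case using Suc linked_trans by auto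
  qed
  from this[of "length zs - 1"] show ?thesis using assms(1,3) by (simp add: last_conv_nth)
qed

lemma closed_iff:
  "entanglement_closed \<phi> R \<longleftrightarrow> R \<subseteq> vars \<phi> \<times> vars \<phi> \<and> refl_on (vars \<phi>) R \<and> trans R \<and>
    (\<forall>x y. direct R x y \<longrightarrow> (x, y) \<in> R)"
proof (intro iffI conjI allI impI)
  assume C: "entanglement_closed \<phi> R"
  then show "R \<subseteq> vars \<phi> \<times> vars \<phi>" "refl_on (vars \<phi>) R" "trans R" by (auto simp: entanglement_closed_def)
  fix x y assume d: "direct R x y"
  then obtain zs where "zs \<noteq> [] \<and> hd zs = x \<and> last zs = y \<and> set zs \<subseteq> bound_vars \<phi> \<and>
    (\<forall>i. Suc i < length zs \<longrightarrow> entangled \<phi> R (zs ! i) (zs ! Suc i) \<and> ((x, zs ! i) \<in> R \<or> (y, zs ! i) \<in> R))"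
    using linked_path unfolding direct_def by blast
  then show "(x, y) \<in> R" using C d unfolding entanglement_closed_def direct_def by blast
next
  assume *: "R \<subseteq> vars \<phi> \<times> vars \<phi> \<and> refl_on (vars \<phi>) R \<and> trans R \<and> (\<forall>x y. direct R x y \<longrightarrow> (x, y) \<in> R)"
  show "entanglement_closed \<phi> R" unfolding entanglement_closed_def
  proof (intro conjI allI impI)
    fix x y zs
    assume zs: "scope_le \<phi> x y \<and> quant_of \<phi> x \<noteq> quant_of \<phi> y \<and>
        zs \<noteq> [] \<and> hd zs = x \<and> last zs = y \<and> set zs \<subseteq> bound_vars \<phi> \<and>
        (\<forall>i. Suc i < length zs \<longrightarrow>
           entangled \<phi> R (zs ! i) (zs ! Suc i) \<and> ((x, zs ! i) \<in> R \<or> (y, zs ! i) \<in> R))"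
    then have b: "x \<in> bound_vars \<phi>" "y \<in> bound_vars \<phi>" using hd_in_set[of zs] last_in_set[of zs] by auto
    then have "(y, y) \<in> R" using * bound_sub_vars refl_onD by fast
    then have "linked R x y x y" using path_linked[of zs x y R] zs by blast
    then show "(x, y) \<in> R" using * zs b unfolding direct_def by blast
  qed (use * in auto)
qed

text \<open>An upper bound for the essential order, from which its antisymmetry follows; the
  generating rule itself demands \<open>scope_le\<close>.\<close>

lemma scope_closed: "entanglement_closed \<phi> {(x, y). x \<in> vars \<phi> \<and> y \<in> vars \<phi> \<and> scope_le \<phi> x y}"
  unfolding closed_iff
proof (intro conjI allI impI)
  fix x y assume "direct {(x, y). x \<in> vars \<phi> \<and> y \<in> vars \<phi> \<and> scope_le \<phi> x y} x y"
  then show "(x, y) \<in> {(x, y). x \<in> vars \<phi> \<and> y \<in> vars \<phi> \<and> scope_le \<phi> x y}"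
    using bound_sub_vars unfolding direct_def by blast
next
  show "trans {(x, y). x \<in> vars \<phi> \<and> y \<in> vars \<phi> \<and> scope_le \<phi> x y}"
    using scope_le_trans[OF dist] by (auto simp: trans_def)
qed (auto simp: refl_on_def scope_le_refl)

lemma ess_refl_on: "refl_on (vars \<phi>) ess" and ess_trans: "trans ess"
  and ess_scope: "(x, y) \<in> ess \<Longrightarrow> scope_le \<phi> x y"
proof -
  show "(x, y) \<in> ess \<Longrightarrow> scope_le \<phi> x y" using scope_closed by blast
  have "R \<in> {R. entanglement_closed \<phi> R} \<Longrightarrow> refl_on (vars \<phi>) R \<and> trans R \<and> R \<subseteq> vars \<phi> \<times> vars \<phi>" for R
    by (simp add: closed_iff)
  then show "refl_on (vars \<phi>) ess" "trans ess" by (auto simp: refl_on_def trans_def)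
qed

lemma ess_refl: "x \<in> bound_vars \<phi> \<Longrightarrow> (x, x) \<in> ess"
  using refl_onD[OF ess_refl_on] bound_sub_vars by blast

text \<open>The intersection obeys the generating rule as well: by monotonicity of entanglement, a
  direct step for \<open>ess\<close> is one for each closed \<open>R\<close>.\<close>

lemma ess_direct:
  assumes "direct ess x y"
  shows "(x, y) \<in> ess"
proof (rule InterI)
  fix R assume R: "R \<in> {R. entanglement_closed \<phi> R}"
  then have "ess \<subseteq> R" by blast
  then have "linked R x y x y" using assms entangled_mono[OF _ ess_refl_on]
    unfolding direct_def by (elim conjE linked_mono) blast+
  then have "direct R x y" using assms by (simp add: direct_def)
  then show "(x, y) \<in> R" using R by (simp add: closed_iff)
qed

text \<open>\<open>ess\<close> is generated by its direct steps. Their reflexive transitive closure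
  is contained in \<open>ess\<close>, so by monotonicity its direct steps are direct steps of
  \<open>ess\<close>; hence it is closed and contains \<open>ess\<close> by minimality.\<close>

lemma ess_last_step:
  assumes "(x, y) \<in> ess" "x \<noteq> y"
  shows "\<exists>z. (x, z) \<in> ess \<and> direct ess z y"
proof -
  define D where "D = {(x, y). direct ess x y}"
  define R where "R = D\<^sup>* \<inter> vars \<phi> \<times> vars \<phi>"
  have refl: "refl_on (vars \<phi>) R" by (auto simp: refl_on_def R_def)
  have sub: "R \<subseteq> ess"
  proof
    fix p assume p: "p \<in> R"
    obtain a b where ab: "p = (a, b)" by (cases p)
    then have "a \<in> vars \<phi>" "(a, b) \<in> D\<^sup>*" using p by (auto simp: R_def)
    from this(2) have "(a, b) \<in> ess"
    proof (induction rule: rtrancl_induct)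
      case base
      then show ?case using refl_onD[OF ess_refl_on \<open>a \<in> vars \<phi>\<close>] .
    next
      case (step b c)
      then have "(b, c) \<in> ess" using ess_direct by (simp add: D_def)
      then show ?case using step.IH transD[OF ess_trans] by blast
    qed
    then show "p \<in> ess" using ab by simp
  qed
  have "entanglement_closed \<phi> R" unfolding closed_iff
  proof (intro conjI allI impI)
    show "trans R" by (auto simp: trans_def R_def)
    fix a b assume d: "direct R a b"
    then have link: "linked R a b a b" by (simp add: direct_def)
    have "linked ess a b a b"
      by (rule linked_mono[OF link]) (use sub entangled_mono[OF sub refl] in blast)+
    then have "direct ess a b" using d by (simp add: direct_def)
    then show "(a, b) \<in> R" using d bound_sub_vars unfolding direct_def R_def D_def by blast
  qed (use refl in \<open>auto simp: R_def\<close>)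
  then have xy: "(x, y) \<in> D\<^sup>*" "x \<in> vars \<phi>" using assms(1) unfolding R_def by blast+
  then obtain z where z: "(x, z) \<in> D\<^sup>*" "(z, y) \<in> D" using assms(2) by (metis rtranclE)
  then have "(x, z) \<in> R" using xy bound_sub_vars unfolding direct_def R_def D_def by blast
  then show ?thesis using z sub unfolding D_def by blast
qed

lemma ess_le_iff: "ess_le \<phi> x y \<longleftrightarrow> (x, y) \<in> ess"
  by (simp add: ess_le_def)

lemma ess_order: "finite_below_order (ess_le \<phi>)"
proof
  show "ess_le \<phi> x z" if "ess_le \<phi> x y" "ess_le \<phi> y z" for x y z
    using that transD[OF ess_trans] unfolding ess_le_iff by blast
  show "x = y" if "ess_le \<phi> x y" "ess_le \<phi> y x" for x y
    using that ess_scope scope_le_antisym[OF dist] unfolding ess_le_iff by blast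
  have "{z. ess_le \<phi> z x} \<subseteq> {z. scope_le \<phi> z x}" for x using ess_scope unfolding ess_le_iff by blast
  then show "finite {z. ess_le \<phi> z x}" for x using finite_scope_below[OF dist] finite_subset by blast
qed

lemma ead_alt_depth:
  assumes "x \<in> bound_vars \<phi>"
  shows "ead \<phi> x = alt_depth \<phi> (ess_le \<phi>) (ead_base \<phi>) x"
proof -
  have "x \<notin> free_vars \<phi>" using assms straightD(2)[OF straight] by blast
  then show ?thesis by (simp add: ead_def alt_depth_def ead_base_def)
qed

lemma ead_ge_base: "x \<in> bound_vars \<phi> \<Longrightarrow> ead_base \<phi> x \<le> ead \<phi> x"
  using finite_below_order.alt_depth_ge_base[OF ess_order, of "ead_base \<phi>" x \<phi>]
    by (simp add: ead_alt_depth)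

lemma ead_pos: "x \<in> bound_vars \<phi> \<Longrightarrow> 1 \<le> ead \<phi> x"
  using ead_ge_base[of x] by (auto simp: ead_base_def split: quantifier.splits)

lemma ead_mono:
  assumes "(x, y) \<in> ess" "y \<in> bound_vars \<phi>"
  shows "ead \<phi> x + (if quant_of \<phi> x \<noteq> quant_of \<phi> y then 1 else 0) \<le> ead \<phi> y"
proof (cases "x = y")
  case False
  have "x \<in> bound_vars \<phi>" using scope_le_bound ess_scope assms by blast
  then show ?thesis
    using finite_below_order.alt_depth_mono[OF ess_order, of x y \<phi> "ead_base \<phi>"] False assms
    by (simp add: ead_alt_depth ess_le_iff)
qed simp

text \<open>An optimal chain only yields some essential predecessor. The last direct step from there
  into \<open>x\<close> starts at a variable of the other quantifier, with no smaller
  \<open>ead\<close> than that predecessor.\<close>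

lemma ead_step:
  assumes x: "x \<in> bound_vars \<phi>" "ead \<phi> x \<noteq> ead_base \<phi> x"
  shows "\<exists>y. direct ess y x \<and> ead \<phi> x \<le> ead \<phi> y + 1"
proof -
  have "\<exists>y. (y, x) \<in> ess \<and> y \<noteq> x \<and> alt_depth \<phi> (ess_le \<phi>) (ead_base \<phi>) x \<le> alt_depth \<phi> (ess_le \<phi>) (ead_base \<phi>) y + 1"
    using finite_below_order.alt_depth_cases[OF ess_order, of \<phi> "ead_base \<phi>" x] x
    by (auto simp: ead_alt_depth ess_le_iff split: if_splits)
  then obtain y where y: "(y, x) \<in> ess" "y \<noteq> x"
    "alt_depth \<phi> (ess_le \<phi>) (ead_base \<phi>) x \<le> alt_depth \<phi> (ess_le \<phi>) (ead_base \<phi>) y + 1" by blast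
  then obtain z where z: "(y, z) \<in> ess" "direct ess z x" using ess_last_step by blast
  have "z \<in> bound_vars \<phi>" using z(2) by (simp add: direct_def)
  then have "ead \<phi> y \<le> ead \<phi> z" using ead_mono[OF z(1)] by simp
  moreover have "y \<in> bound_vars \<phi>" using scope_le_bound ess_scope y(1) x(1) by blast
  ultimately have "ead \<phi> x \<le> ead \<phi> z + 1" using y(3) x(1) by (simp add: ead_alt_depth)
  then show ?thesis using z(2) by blast
qed

section \<open>Comparison of the two depths along paths through atoms\<close>

definition atom_nbr :: "nat \<Rightarrow> nat \<Rightarrow> bool" where
  "atom_nbr a b \<longleftrightarrow> a \<in> bound_vars \<phi> \<and> b \<in> bound_vars \<phi> \<and> (\<exists>\<alpha>\<in>subfms \<phi>. is_atom \<alpha> \<and> a \<in> vars \<alpha> \<and>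
    b \<in> vars \<alpha>)"

lemma atom_nbr_sym: "atom_nbr a b \<Longrightarrow> atom_nbr b a"
  by (auto simp: atom_nbr_def)

text \<open>If \<open>u\<close> were not essentially above the variable reached, then that variable, or its direct
  predecessor of the other quantifier, would be essentially above \<open>u\<close> and have smaller \<^const>\<open>ead\<close>.\<close>

lemma ead_increasing_path:
  assumes "u \<in> bound_vars \<phi>" "(\<lambda>a b. atom_nbr a b \<and> ead \<phi> u < ead \<phi> b)\<^sup>*\<^sup>* u w"
  shows "(u, w) \<in> ess \<and> linked ess u u u w \<and> (w = u \<or> ad' \<phi> u < ad' \<phi> w)"
  using assms(2)
proof (induction rule: rtranclp_induct)
  case base
  then show ?case using ess_refl[OF assms(1)] linked_refl by simp
next
  case (step e f)
  then have ue: "(u, e) \<in> ess" "linked ess u u u e" and f: "ead \<phi> u < ead \<phi> f" and "atom_nbr e f"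
    by auto
  then have b: "e \<in> bound_vars \<phi>" "f \<in> bound_vars \<phi>" by (auto simp: atom_nbr_def)
  obtain \<alpha> where \<alpha>: "\<alpha> \<in> subfms \<phi>" "is_atom \<alpha>" "e \<in> vars \<alpha>" "f \<in> vars \<alpha>" using \<open>atom_nbr e f\<close>
    by (auto simp: atom_nbr_def)
  have ent: "entangled \<phi> ess e f" using atom_entangled[OF ess_refl_on \<alpha>] .
  \<comment> \<open>\<open>f\<close> itself serves if its quantifier differs from that of
    \<open>u\<close>. Otherwise both have the same base value, so \<open>f\<close> exceeds its own,
    and a direct predecessor loses at most 1.\<close>
  have "\<exists>y. y \<in> bound_vars \<phi> \<and> quant_of \<phi> y \<noteq> quant_of \<phi> u \<and> (y, f) \<in> ess \<and> linked ess y y y f \<and>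
    ead \<phi> u \<le> ead \<phi> y"
  proof (cases "quant_of \<phi> f = quant_of \<phi> u")
    case False
    then show ?thesis using b(2) ess_refl linked_refl f by (intro exI[of _ f]) simp
  next
    case True
    then have "ead_base \<phi> f = ead_base \<phi> u" by (simp add: ead_base_def)
    then have "ead \<phi> f \<noteq> ead_base \<phi> f" using ead_ge_base[OF assms(1)] f by simp
    then obtain y where y: "direct ess y f" "ead \<phi> f \<le> ead \<phi> y + 1" using ead_step[OF b(2)] by blast
    have yf: "(y, f) \<in> ess" using ess_direct[OF y(1)] .
    have link: "linked ess y f y f" using y(1) by (simp add: direct_def)
    have "linked ess y y y f" by (rule linked_mono[OF link]) (use yf transD[OF ess_trans] in blast)+
    then show ?thesis using y yf True f by (intro exI[of _ y]) (auto simp: direct_def)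
  qed
  then obtain y where y: "y \<in> bound_vars \<phi>" "quant_of \<phi> y \<noteq> quant_of \<phi> u" "(y, f) \<in> ess" "linked ess y y y f" "ead \<phi> u \<le> ead \<phi> y"
    by blast
  \<comment> \<open>The path runs from \<open>u\<close> to \<open>e\<close>, through the atom to
    \<open>f\<close>, and back to \<open>y\<close>.\<close>
  have link: "linked ess u y u y"
  proof -
    have "linked ess u y u e" by (rule linked_mono[OF ue(2)]) blast+
    moreover have "linked ess u y e f" using ue(1) y(3) by (intro linked_step[OF b ent]) blast+
    moreover have "linked ess u y y f" by (rule linked_mono[OF y(4)]) blast+
    ultimately show ?thesis using linked_trans linked_sym by blast
  qed
  have sc: "scope_le \<phi> u e" "scope_le \<phi> y f" using ess_scope ue y by blast+
  have "scope_le \<phi> e f \<or> scope_le \<phi> f e"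
    using atom_scopes_comparable[OF straightD[OF straight] \<alpha> b] .
  then have "scope_le \<phi> u y \<or> scope_le \<phi> y u"
    using sc scope_le_trans[OF dist] scope_le_forest[OF dist] by blast
  \<comment> \<open>Otherwise the reversed path would put \<open>y\<close> essentially above
    \<open>u\<close>, and the alternation would give
    \<open>ead \<phi> y < ead \<phi> u\<close>.\<close>
  moreover have "\<not> scope_le \<phi> y u"
  proof
    assume "scope_le \<phi> y u"
    moreover have "linked ess y u y u" by (rule linked_mono[OF linked_sym[OF link]]) blast+
    ultimately have "(y, u) \<in> ess" using y assms(1) by (intro ess_direct) (simp add: direct_def)
    then show False using ead_mono[of y u] assms(1) y by simp
  qed
  ultimately have uy: "scope_le \<phi> u y" by blast
  then have ess_uy: "(u, y) \<in> ess" using y(1,2) assms(1) link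
    by (intro ess_direct) (simp add: direct_def)
  have "linked ess u u u y" by (rule linked_mono[OF link]) (use ess_uy transD[OF ess_trans] in blast)+
  moreover have "linked ess u u y f" by (rule linked_mono[OF y(4)]) (use ess_uy transD[OF ess_trans] in blast)+
  ultimately have "linked ess u u u f" by (rule linked_trans)
  moreover have "(u, f) \<in> ess" using ess_uy y(3) transD[OF ess_trans] by blast
  moreover have "ad' \<phi> u < ad' \<phi> f"
    using ad'_mono[OF straight uy y(1)] ad'_mono[OF straight sc(2) b(2)] y(2) by auto
  ultimately show ?case by blast
qed

lemma adjacent_bound:
  assumes "adjacent (fm_graph \<phi>) a b" "a \<in> bound_vars \<phi>" "b \<in> bound_vars \<phi>"
  shows "atom_nbr a b"
  using assms straightD(2)[OF straight]
  by (auto simp: adjacent_def fm_graph_def atom_nbr_def doubleton_eq_iff)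

theorem fotw_le_stratified_tw_ad': "fotw \<phi> \<le> stratified_tw (fm_graph \<phi>) (ad' \<phi>)"
proof -
  let ?G = "fm_graph \<phi>" and ?V = "vars \<phi>"
  have V: "fst ?G = ?V" "finite (fst ?G)" by (simp_all add: finite_vars fm_graph_simps(1))
  have edges: "\<forall>e\<in>snd ?G. e \<subseteq> fst ?G" using fm_graph_simps(2)[of _ \<phi>] fm_graph_simps(1)[of \<phi>]
    by fastforce
  obtain r where r: "inj_on r ?V" "\<And>u v. u \<in> ?V \<Longrightarrow> v \<in> ?V \<Longrightarrow> ad' \<phi> u < ad' \<phi> v \<Longrightarrow> r u < r v"
    "\<And>v. v \<in> ?V \<Longrightarrow> int (card {u. lower_nbr ?G r u v}) \<le> stratified_tw ?G (ad' \<phi>)"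
    using stratified_tw_rank[OF edges V(2), of "ad' \<phi>"] V(1) by auto
  obtain s :: "nat \<Rightarrow> nat" where s: "inj_on s ?V"
    "\<forall>u\<in>?V. \<forall>v\<in>?V. s u < s v \<longleftrightarrow> ead \<phi> u < ead \<phi> v \<or> ead \<phi> u = ead \<phi> v \<and> r u < r v"
    using lex_rank[OF finite_vars r(1), of "ead \<phi>"] by auto
  have adjV: "a \<in> ?V" "b \<in> ?V" if "adjacent ?G a b" for a b
    using fm_graph_simps(2)[of "{a, b}"] that by (auto simp: adjacent_def doubleton_eq_iff)
  have free: "ead \<phi> x = 0" "ad' \<phi> x = 0" if "x \<in> free_vars \<phi>" for x using that
    by (simp_all add: ead_def ad'_def)
  have bound: "x \<in> bound_vars \<phi>" if "x \<in> ?V" "0 < ead \<phi> x" for x using that free vars_eq[of \<phi>] by auto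
  have le: "ead \<phi> v \<le> ead \<phi> b" "ead \<phi> v = ead \<phi> b \<Longrightarrow> r v \<le> r b" if "s v \<le> s b" "v \<in> ?V" "b \<in> ?V" for v b
    using s(2) that by (auto simp flip: not_less)
  let ?T = "\<lambda>v a b. atom_nbr a b \<and> ead \<phi> v \<le> ead \<phi> b"
  \<comment> \<open>The witness \<open>p\<close> is the last vertex of the path with the same
    \<open>ead\<close> as \<open>v\<close>. The tie rule gives \<open>r v \<le> r p\<close>, and
    beyond \<open>p\<close> the path is one for \<open>ead_increasing_path\<close>, which keeps
    \<open>r\<close> above \<open>r p\<close>. The return path from \<open>w\<close> to
    \<open>v\<close> later extends a step from a lower neighbour \<open>u\<close> to
    \<open>w\<close>.\<close>
  have reach_bound: "w \<in> bound_vars \<phi> \<and> ead \<phi> v \<le> ead \<phi> w \<and> reach ?G r v w \<and> (?T v)\<^sup>*\<^sup>* w v \<and>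
     (\<exists>p. p \<in> bound_vars \<phi> \<and> ead \<phi> p = ead \<phi> v \<and> r v \<le> r p \<and> (\<lambda>a b. atom_nbr a b \<and> ead \<phi> p < ead \<phi> b)\<^sup>*\<^sup>* p w)"
    if v: "v \<in> bound_vars \<phi>" and w: "reach ?G s v w" for v w
    using w unfolding reach_def[of ?G s]
  proof (induction rule: rtranclp_induct)
    case base
    then show ?case using v by (auto simp: reach_def)
  next
    case (step a b)
    then obtain p where p: "p \<in> bound_vars \<phi>" "ead \<phi> p = ead \<phi> v" "r v \<le> r p"
      "(\<lambda>a b. atom_nbr a b \<and> ead \<phi> p < ead \<phi> b)\<^sup>*\<^sup>* p a" and a: "a \<in> bound_vars \<phi>"
        "ead \<phi> v \<le> ead \<phi> a" "reach ?G r v a" "(?T v)\<^sup>*\<^sup>* a v" by blast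
    have ab: "adjacent ?G a b" "s v \<le> s b" using step by auto
    have vb: "v \<in> ?V" "b \<in> ?V" using v bound_sub_vars adjV[OF ab(1)] by auto
    note eb = le[OF ab(2) vb]
    have b: "b \<in> bound_vars \<phi>" using bound[OF vb(2)] eb(1) ead_pos[OF v] by simp
    have nbr: "atom_nbr a b" using adjacent_bound[OF ab(1) a(1) b] .
    have "\<exists>p. p \<in> bound_vars \<phi> \<and> ead \<phi> p = ead \<phi> v \<and> r v \<le> r p \<and> (\<lambda>a b. atom_nbr a b \<and>
      ead \<phi> p < ead \<phi> b)\<^sup>*\<^sup>* p b"
    proof (cases "ead \<phi> v = ead \<phi> b")
      case True
      then show ?thesis using b eb by (intro exI[of _ b]) simp
    next
      case False
      then show ?thesis using p nbr eb by (intro exI[of _ p]) (auto intro: rtranclp.rtrancl_into_rtrancl)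
    qed
    moreover from this obtain p where p: "p \<in> bound_vars \<phi>" "ead \<phi> p = ead \<phi> v" "r v \<le> r p"
      "(\<lambda>a b. atom_nbr a b \<and> ead \<phi> p < ead \<phi> b)\<^sup>*\<^sup>* p b" by blast
    have "r p \<le> r b" using ead_increasing_path[OF p(1,4)] r(2)[of p b] p(1) vb bound_sub_vars by auto
    then have "reach ?G r v b" using a(3) ab(1) p(3) unfolding reach_def
      by (auto intro: rtranclp.rtrancl_into_rtrancl)
    moreover have "(?T v)\<^sup>*\<^sup>* b v"
      using a(2,4) atom_nbr_sym[OF nbr] by (auto intro: converse_rtranclp_into_rtranclp)
    ultimately show ?case using b eb by blast
  qed
  have sub: "lower_nbr ?G r u v" if v: "v \<in> ?V" and uv: "lower_nbr ?G s u v" for u v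
  proof -
    obtain w where w: "reach ?G s v w" "adjacent ?G w u" and suv: "s u < s v" using uv
      by (auto simp: lower_nbr_def)
    have u: "u \<in> ?V" using adjV[OF w(2)] by blast
    have e: "ead \<phi> u < ead \<phi> v \<or> ead \<phi> u = ead \<phi> v \<and> r u < r v" using s(2) suv u v by blast
    show ?thesis
    proof (cases "v \<in> bound_vars \<phi>")
      case True
      note W = reach_bound[OF True w(1)]
      have "r u < r v"
      proof (cases "ead \<phi> u = ead \<phi> v")
        case False
        then have less: "ead \<phi> u < ead \<phi> v" using e by simp
        \<comment> \<open>For bound \<open>u\<close>, the step to \<open>w\<close> followed by the
          return path to \<open>v\<close> stays at \<open>ead\<close> larger than that of
          \<open>u\<close>, so \<open>ead_increasing_path\<close> applies from \<open>u\<close> to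
          \<open>v\<close>.\<close>
        have "ad' \<phi> u < ad' \<phi> v"
        proof (cases "u \<in> bound_vars \<phi>")
          case u: True
          have "atom_nbr u w" using adjacent_bound[OF adjacent_sym[OF w(2)] u] W by blast
          then have "(\<lambda>a b. atom_nbr a b \<and> ead \<phi> u < ead \<phi> b) u w" using W less by auto
          moreover have "(\<lambda>a b. atom_nbr a b \<and> ead \<phi> u < ead \<phi> b)\<^sup>*\<^sup>* w v"
            by (rule rtranclp_mono[THEN predicate2D, of "?T v"]) (use W less in auto)
          ultimately have "(\<lambda>a b. atom_nbr a b \<and> ead \<phi> u < ead \<phi> b)\<^sup>*\<^sup>* u v"
            by (rule converse_rtranclp_into_rtranclp)
          then show ?thesis using ead_increasing_path[OF u] less by blast
        next
          case False
          then have "u \<in> free_vars \<phi>" using u vars_eq[of \<phi>] by blast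
          then show ?thesis using free ad'_pos[OF straight True] by simp
        qed
        then show ?thesis using r(2) u v by blast
      qed (use e in simp)
      then show ?thesis using W w(2) by (auto simp: lower_nbr_def)
    next
      case False
      then have vf: "v \<in> free_vars \<phi>" using v vars_eq[of \<phi>] by blast
      \<comment> \<open>Free variables have depth 0 in both senses: bound ones come after
        \<open>v\<close> in both orders, and among the free ones \<open>s\<close> agrees with
        \<open>r\<close>.\<close>
      have "reach ?G r v w" using w(1) unfolding reach_def
      proof (induction rule: rtranclp_induct)
        case (step a b)
        have b: "b \<in> ?V" using adjV step(2) by blast
        have "r v \<le> r b"
        proof (cases "b \<in> bound_vars \<phi>")
          case True
          then have "ad' \<phi> v < ad' \<phi> b" using free(2)[OF vf] ad'_pos[OF straight True] by simp
          then show ?thesis using r(2)[OF v b] by simp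
        next
          case False
          then have "ead \<phi> b = ead \<phi> v" using b vars_eq[of \<phi>] free vf by auto
          then show ?thesis using le(2)[of v b] step(2) v b by simp
        qed
        then show ?case using step by (auto intro: rtranclp.rtrancl_into_rtrancl)
      qed simp
      moreover have "r u < r v" using e free(1)[OF vf] by simp
      ultimately show ?thesis using w(2) by (auto simp: lower_nbr_def)
    qed
  qed
  have "-1 \<le> stratified_tw ?G (ad' \<phi>)" using stratified_tw_attained[OF edges, of "ad' \<phi>"] width_ge
    by metis
  moreover have "int (card {u. lower_nbr ?G s u v}) \<le> stratified_tw ?G (ad' \<phi>)" if v: "v \<in> ?V" for v
  proof -
    have "{u. lower_nbr ?G r u v} \<subseteq> ?V" using adjV by (auto simp: lower_nbr_def)
    then have "finite {u. lower_nbr ?G r u v}" using finite_vars finite_subset by blast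
    then have "card {u. lower_nbr ?G s u v} \<le> card {u. lower_nbr ?G r u v}"
      using sub[OF v] by (intro card_mono) auto
    then show ?thesis using r(3)[OF v] by linarith
  qed
  ultimately show ?thesis unfolding fotw_def
    using s fm_graph_simps(2) V by (intro stratified_tw_le_rank[where r = s]) auto
qed

end

section \<open>Expansions of programs\<close>

lemma nnf_simps [simp]:
  "quantified (nnf b \<phi>) = quantified \<phi>" "free_vars (nnf b \<phi>) = free_vars \<phi>"
  by (induction b \<phi> rule: nnf.induct) (auto cong: map_cong simp: o_def)

lemma nnf_subfms: "\<psi> \<in> subfms \<phi> \<Longrightarrow> \<exists>b'. nnf b' \<psi> \<in> subfms (nnf b \<phi>)"
proof (induction b \<phi> rule: nnf.induct)
  case (3 b \<phi>)
  then show ?case by (metis insert_iff nnf.simps(3) subfms.simps(3) subfms_refl)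
next
  case (4 b \<phi>s)
  show ?case
  proof (cases "\<psi> = Conj \<phi>s")
    case False
    then obtain \<chi> where "\<chi> \<in> set \<phi>s" "\<psi> \<in> subfms \<chi>" using 4 by auto
    moreover from this obtain b' where "nnf b' \<psi> \<in> subfms (nnf b \<chi>)" using 4 by blast
    ultimately show ?thesis by (intro exI[of _ b']) auto
  qed (use subfms_refl in blast)
next
  case (5 b \<phi>s)
  show ?case
  proof (cases "\<psi> = Disj \<phi>s")
    case False
    then obtain \<chi> where "\<chi> \<in> set \<phi>s" "\<psi> \<in> subfms \<chi>" using 5 by auto
    moreover from this obtain b' where "nnf b' \<psi> \<in> subfms (nnf b \<chi>)" using 5 by blast
    ultimately show ?thesis by (intro exI[of _ b']) auto
  qed (use subfms_refl in blast)
next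
  case (6 b q x \<phi>)
  show ?case
  proof (cases "\<psi> = Quant q x \<phi>")
    case False
    then obtain b' where "nnf b' \<psi> \<in> subfms (nnf b \<phi>)" using 6 by auto
    then show ?thesis by (intro exI[of _ b']) auto
  qed (use subfms_refl in blast)
qed (use subfms_refl in auto)

lemma nnf_atoms: "is_atom \<alpha> \<Longrightarrow> \<alpha> \<in> subfms (nnf b \<phi>) \<longleftrightarrow> \<alpha> \<in> subfms \<phi>"
  by (induction b \<phi> rule: nnf.induct) (auto split: if_splits)

lemma nnf_foldr_Quant:
  "nnf b (foldr (Quant q) ys \<phi>) = foldr (Quant (if b then q else dual q)) ys (nnf b \<phi>)"
  by (induction ys) auto

lemma subfms_foldr_Quant_append: "foldr (Quant q) ys \<beta> \<in> subfms (foldr (Quant q) (xs @ ys) \<beta>)"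
  by (induction xs) (auto simp: subfms_refl)

lemma atoms_foldr_Quant: "is_atom \<alpha> \<Longrightarrow> \<alpha> \<in> subfms (foldr (Quant q) ys \<beta>) \<longleftrightarrow> \<alpha> \<in> subfms \<beta>"
  by (induction ys) auto

text \<open>A syntactic reason for \<open>ad' \<phi> x \<le> ad' \<phi> y\<close> that survives
  expansion and negation normal form. The second alternative is there because an elimination order
  may arrange the variables of one block against the order of their quantifiers.\<close>

definition precedes :: "'r formula set \<Rightarrow> nat \<Rightarrow> nat \<Rightarrow> bool" where
  "precedes A x y \<longleftrightarrow> (\<exists>q a. Quant q x a \<in> A \<and> y \<in> bound_vars a) \<or>
     (\<exists>q ys \<beta>. foldr (Quant q) ys \<beta> \<in> A \<and> x \<in> set ys \<and> y \<in> set ys)"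

lemma precedes_mono: "precedes A x y \<Longrightarrow> A \<subseteq> B \<Longrightarrow> precedes B x y"
  unfolding precedes_def by blast

lemma precedes_nnf:
  assumes "precedes (subfms \<chi>) x y"
  shows "precedes (subfms (nnf b \<chi>)) x y"
  using assms unfolding precedes_def
proof (elim disjE exE conjE)
  fix q a assume "Quant q x a \<in> subfms \<chi>" "y \<in> bound_vars a"
  moreover from this obtain b' where "nnf b' (Quant q x a) \<in> subfms (nnf b \<chi>)" using nnf_subfms by blast
  ultimately show "(\<exists>q a. Quant q x a \<in> subfms (nnf b \<chi>) \<and> y \<in> bound_vars a) \<or>
     (\<exists>q ys \<beta>. foldr (Quant q) ys \<beta> \<in> subfms (nnf b \<chi>) \<and> x \<in> set ys \<and> y \<in> set ys)"
    by (intro disjI1) (metis nnf.simps(6) nnf_simps(1))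
next
  fix q ys \<beta> assume *: "foldr (Quant q) ys \<beta> \<in> subfms \<chi>" "x \<in> set ys" "y \<in> set ys"
  moreover from this obtain b' where "nnf b' (foldr (Quant q) ys \<beta>) \<in> subfms (nnf b \<chi>)"
    using nnf_subfms by blast
  ultimately show "(\<exists>q a. Quant q x a \<in> subfms (nnf b \<chi>) \<and> y \<in> bound_vars a) \<or>
     (\<exists>q ys \<beta>. foldr (Quant q) ys \<beta> \<in> subfms (nnf b \<chi>) \<and> x \<in> set ys \<and> y \<in> set ys)"
    unfolding nnf_foldr_Quant by blast
qed

text \<open>The scope of one quantifier of the block consists of the next one, so no foreign
  quantifier fits between them.\<close>

lemma block_between:
  assumes dist: "distinct (quantified \<phi>)" and "foldr (Quant q) (h # t) \<beta> \<in> subfms \<phi>"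
    "x \<in> set (h # t)" "scope_le \<phi> h z" "scope_le \<phi> z x"
  shows "z \<in> set (h # t)"
  using assms(2-)
proof (induction t arbitrary: h)
  case Nil
  then show ?case using scope_le_antisym[OF dist] by auto
next
  case (Cons h' t)
  have F: "Quant q h (foldr (Quant q) (h' # t) \<beta>) \<in> subfms \<phi>" using Cons.prems by simp
  show ?case
  proof (cases "z = h")
    case False
    then have "x \<noteq> h" using Cons.prems scope_le_antisym[OF dist] by blast
    then have x: "x \<in> set (h' # t)" using Cons.prems by simp
    obtain q' a where "Quant q' h a \<in> subfms \<phi>" "z \<in> bound_vars a" using False Cons.prems
      by (auto simp: scope_le_iff)
    then have "z \<in> bound_vars (foldr (Quant q) (h' # t) \<beta>)" using Quant_unique[OF dist F] by blast
    moreover have F': "foldr (Quant q) (h' # t) \<beta> \<in> subfms \<phi>"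
      using Quant_subfms_trans[OF F] subfms_refl by blast
    ultimately have "scope_le \<phi> h' z" by (auto simp: scope_le_iff)
    then show ?thesis using Cons.IH[OF F' x _ Cons.prems(4)] by simp
  qed simp
qed

lemma scope_le_block:
  assumes "foldr (Quant q) (h # t) \<beta> \<in> subfms \<phi>" "x \<in> set (h # t)"
  shows "scope_le \<phi> h x"
proof (cases "x = h")
  case False
  then have "x \<in> bound_vars (foldr (Quant q) t \<beta>)" using assms(2) by (simp add: quantified_foldr_Quant)
  then show ?thesis using assms(1) unfolding scope_le_iff by fastforce
qed (simp add: scope_le_refl)

lemma block_quant_of:
  assumes "distinct (quantified \<phi>)" "foldr (Quant q) ys \<beta> \<in> subfms \<phi>" "z \<in> set ys"
  shows "quant_of \<phi> z = q"
proof -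
  obtain as bs where "ys = as @ z # bs" using assms(3) by (meson split_list)
  then have "foldr (Quant q) (z # bs) \<beta> \<in> subfms \<phi>"
    using subfms_trans[OF subfms_foldr_Quant_append] assms(2) by blast
  then show ?thesis using quant_of_eq[OF assms(1)] by simp
qed

lemma precedes_ad':
  assumes straight: "straight \<phi>" and "precedes (subfms \<phi>) x y"
  shows "ad' \<phi> x \<le> ad' \<phi> y"
  using assms(2) unfolding precedes_def
proof (elim disjE exE conjE)
  fix q a assume *: "Quant q x a \<in> subfms \<phi>" "y \<in> bound_vars a"
  then have "y \<in> bound_vars \<phi>" using subfms_bound[OF *(1)] by auto
  moreover have "scope_le \<phi> x y" using * by (auto simp: scope_le_iff)
  ultimately show ?thesis using ad'_mono[OF straight] add_leD1 by blast
next
  note dist = straightD(1)[OF straight]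
  fix q ys \<beta> assume *: "foldr (Quant q) ys \<beta> \<in> subfms \<phi>" "x \<in> set ys" "y \<in> set ys"
  have bound: "x \<in> bound_vars \<phi>" "y \<in> bound_vars \<phi>"
    using subfms_bound[OF *(1)] *(2,3) by (auto simp: quantified_foldr_Quant)
  obtain as bs where ys: "ys = as @ y # bs" using *(3) by (meson split_list)
  have F: "foldr (Quant q) (y # bs) \<beta> \<in> subfms \<phi>"
    using subfms_trans[OF subfms_foldr_Quant_append] *(1) ys by blast
  show ?thesis
  proof (cases "x \<in> set (y # bs)")
    case True
    have yx: "scope_le \<phi> y x" using F True by (rule scope_le_block)
    show ?thesis
    proof (rule ad'_same_block[OF straight yx bound(1)])
      fix z assume "scope_le \<phi> y z" "scope_le \<phi> z x"
      then have "z \<in> set (y # bs)" using block_between[OF dist F True] by blast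
      then show "quant_of \<phi> z = quant_of \<phi> x" using block_quant_of[OF dist F] True by simp
    qed
  next
    case False
    then have "x \<in> set as" using *(2) ys by auto
    then obtain as1 as2 where "as = as1 @ x # as2" by (meson split_list)
    then have "ys = as1 @ x # as2 @ y # bs" using ys by simp
    then have "foldr (Quant q) (x # as2 @ y # bs) \<beta> \<in> subfms \<phi>"
      using subfms_trans[OF subfms_foldr_Quant_append] *(1) by blast
    then have "scope_le \<phi> x y" by (rule scope_le_block) simp
    then show ?thesis using ad'_mono[OF straight _ bound(2)] add_leD1 by blast
  qed
qed

section \<open>What expansion preserves\<close>

lemma expands_foldr_QuantD:
  "expands \<Pi> (foldr (Quant q) ys \<beta>) \<chi> \<Longrightarrow> \<exists>\<beta>'. \<chi> = foldr (Quant q) ys \<beta>' \<and> expands \<Pi> \<beta> \<beta>'"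
proof (induction ys arbitrary: \<chi>)
  case (Cons y ys)
  then obtain \<chi>' where "\<chi> = Quant q y \<chi>'" "expands \<Pi> (foldr (Quant q) ys \<beta>) \<chi>'"
    by (auto elim: expands.cases)
  then show ?case using Cons.IH by auto
qed simp

lemma expands_subfms: "expands \<Pi> \<psi> \<chi> \<Longrightarrow> a \<in> subfms \<psi> \<Longrightarrow> \<exists>b\<in>subfms \<chi>. expands \<Pi> a b"
proof (induction rule: expands.induct)
  case (Conj \<psi>s \<chi>s)
  show ?case
  proof (cases "a = Conj \<psi>s")
    case True
    have "list_all2 (expands \<Pi>) \<psi>s \<chi>s" using Conj.IH by (rule list_all2_mono) simp
    then show ?thesis using True by (intro bexI[of _ "Conj \<chi>s"]) (auto intro: expands.Conj)
  next
    case False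
    then obtain i where i: "i < length \<psi>s" "a \<in> subfms (\<psi>s ! i)" using Conj.prems
      by (auto simp: in_set_conv_nth)
    then obtain b where "b \<in> subfms (\<chi>s ! i)" "expands \<Pi> a b" using list_all2_nthD[OF Conj.IH i(1)]
      by blast
    moreover have "\<chi>s ! i \<in> set \<chi>s" using i list_all2_lengthD[OF Conj.IH] by simp
    ultimately show ?thesis by (intro bexI[of _ b]) auto
  qed
next
  case (Disj \<psi>s \<chi>s)
  show ?case
  proof (cases "a = Disj \<psi>s")
    case True
    have "list_all2 (expands \<Pi>) \<psi>s \<chi>s" using Disj.IH by (rule list_all2_mono) simp
    then show ?thesis using True by (intro bexI[of _ "Disj \<chi>s"]) (auto intro: expands.Disj)
  next
    case False
    then obtain i where i: "i < length \<psi>s" "a \<in> subfms (\<psi>s ! i)" using Disj.prems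
      by (auto simp: in_set_conv_nth)
    then obtain b where "b \<in> subfms (\<chi>s ! i)" "expands \<Pi> a b" using list_all2_nthD[OF Disj.IH i(1)]
      by blast
    moreover have "\<chi>s ! i \<in> set \<chi>s" using i list_all2_lengthD[OF Disj.IH] by simp
    ultimately show ?thesis by (intro bexI[of _ b]) auto
  qed
qed (auto intro: expands.intros subfms_refl)

lemma expands_bound: "expands \<Pi> \<psi> \<chi> \<Longrightarrow> bound_vars \<psi> \<subseteq> bound_vars \<chi>"
proof (induction rule: expands.induct)
  case (Conj \<psi>s \<chi>s)
  then show ?case by (fastforce simp: list_all2_conv_all_nth in_set_conv_nth)
next
  case (Disj \<psi>s \<chi>s)
  then show ?case by (fastforce simp: list_all2_conv_all_nth in_set_conv_nth)
qed auto

lemma expands_distinct: "expands \<Pi> \<psi> \<chi> \<Longrightarrow> distinct (quantified \<chi>) \<Longrightarrow> distinct (quantified \<psi>)"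
proof (induction rule: expands.induct)
  case (Conj \<psi>s \<chi>s)
  then have "distinct (concat (map quantified \<chi>s))" by simp
  with Conj.IH have "distinct (concat (map quantified \<psi>s)) \<and>
    (\<Union>\<psi>\<in>set \<psi>s. bound_vars \<psi>) \<subseteq> (\<Union>\<chi>\<in>set \<chi>s. bound_vars \<chi>)"
  proof (induction rule: list_all2_induct)
    case (Cons \<psi> \<psi>s \<chi> \<chi>s)
    then have "bound_vars \<psi> \<subseteq> bound_vars \<chi>" using expands_bound by blast
    then show ?case using Cons by auto
  qed simp
  then show ?case by simp
next
  case (Disj \<psi>s \<chi>s)
  then have "distinct (concat (map quantified \<chi>s))" by simp
  with Disj.IH have "distinct (concat (map quantified \<psi>s)) \<and>
    (\<Union>\<psi>\<in>set \<psi>s. bound_vars \<psi>) \<subseteq> (\<Union>\<chi>\<in>set \<chi>s. bound_vars \<chi>)"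
  proof (induction rule: list_all2_induct)
    case (Cons \<psi> \<psi>s \<chi> \<chi>s)
    then have "bound_vars \<psi> \<subseteq> bound_vars \<chi>" using expands_bound by blast
    then show ?case using Cons by auto
  qed simp
  then show ?case by simp
next
  case (Quant \<psi> \<chi> q x)
  then show ?case using expands_bound[OF Quant.hyps] by auto
qed auto

lemma precedes_expands:
  assumes ex: "expands \<Pi> \<psi> \<chi>" and "precedes (subfms \<psi>) x y"
  shows "precedes (subfms \<chi>) x y"
  using assms(2) unfolding precedes_def
proof (elim disjE exE conjE)
  fix q a assume *: "Quant q x a \<in> subfms \<psi>" "y \<in> bound_vars a"
  obtain b where b: "b \<in> subfms \<chi>" "expands \<Pi> (Quant q x a) b" using expands_subfms[OF ex *(1)] by blast
  then obtain a' where a': "b = Quant q x a'" "expands \<Pi> a a'" by (auto elim: expands.cases)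
  then have "y \<in> bound_vars a'" using expands_bound *(2) by blast
  then show "(\<exists>q a. Quant q x a \<in> subfms \<chi> \<and> y \<in> bound_vars a) \<or>
     (\<exists>q ys \<beta>. foldr (Quant q) ys \<beta> \<in> subfms \<chi> \<and> x \<in> set ys \<and> y \<in> set ys)" using b a' by blast
next
  fix q ys \<beta> assume *: "foldr (Quant q) ys \<beta> \<in> subfms \<psi>" "x \<in> set ys" "y \<in> set ys"
  then show "(\<exists>q a. Quant q x a \<in> subfms \<chi> \<and> y \<in> bound_vars a) \<or>
     (\<exists>q ys \<beta>. foldr (Quant q) ys \<beta> \<in> subfms \<chi> \<and> x \<in> set ys \<and> y \<in> set ys)"
    using expands_subfms[OF ex *(1)] expands_foldr_QuantD by blast
qed

text \<open>Expansion replaces atoms, so occurrence of a bound variable in an atom is not inherited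
  directly. Being free in the own scope is inherited, since expansion keeps the free variables, and
  it implies occurrence in an atom.\<close>

definition no_vacuous :: "'r formula \<Rightarrow> bool" where
  "no_vacuous \<phi> \<longleftrightarrow> (\<forall>q x a. Quant q x a \<in> subfms \<phi> \<longrightarrow> x \<in> free_vars a)"

lemma no_vacuous_simps [simp]:
  "no_vacuous (Conj \<phi>s) \<longleftrightarrow> (\<forall>\<phi>\<in>set \<phi>s. no_vacuous \<phi>)"
  "no_vacuous (Disj \<phi>s) \<longleftrightarrow> (\<forall>\<phi>\<in>set \<phi>s. no_vacuous \<phi>)"
  by (auto simp: no_vacuous_def)

lemma free_var_atom: "x \<in> free_vars \<phi> \<Longrightarrow> \<exists>\<alpha>\<in>subfms \<phi>. is_atom \<alpha> \<and> x \<in> vars \<alpha>"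
  by (induction \<phi>) fastforce+

lemma no_vacuous_atom:
  assumes "no_vacuous \<phi>" "x \<in> bound_vars \<phi>"
  shows "\<exists>\<alpha>\<in>subfms \<phi>. is_atom \<alpha> \<and> x \<in> vars \<alpha>"
proof -
  obtain q a where a: "Quant q x a \<in> subfms \<phi>" using assms(2) bound_iff_Quant by blast
  then have "x \<in> free_vars a" using assms(1) by (auto simp: no_vacuous_def)
  then show ?thesis using free_var_atom Quant_subfms_trans[OF a] by blast
qed

lemma literal_simps:
  assumes "is_literal l"
  shows "quantified l = []" "free_vars l = vars l" "\<And>q x a. Quant q x a \<notin> subfms l"
    "\<exists>\<alpha>\<in>subfms l. is_atom \<alpha> \<and> vars \<alpha> = vars l"
  using assms by (cases l rule: is_literal.cases; (rename_tac \<alpha>, case_tac \<alpha>)?; auto)+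

lemma rule_fm_simps:
  assumes "wf_rule ar \<rho>"
  shows "vars (rule_fm \<rho>) = body_vars \<rho>" "free_vars (rule_fm \<rho>) = set (head_vars \<rho>)"
    "set (ex_vars \<rho>) = body_vars \<rho> - set (head_vars \<rho>)" "finite (body_vars \<rho>)"
proof -
  show fin: "finite (body_vars \<rho>)" unfolding body_vars_def by (auto simp: fm.set_finite)
  then show ex: "set (ex_vars \<rho>) = body_vars \<rho> - set (head_vars \<rho>)" by (simp add: ex_vars_def)
  have lit: "is_literal l" if "l \<in> set (body \<rho>)" for l using assms that by (auto simp: wf_rule_def)
  have "free_vars (Conj (body \<rho>)) = body_vars \<rho>" using literal_simps(2)[OF lit]
    by (auto simp: body_vars_def)
  then show free: "free_vars (rule_fm \<rho>) = set (head_vars \<rho>)"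
    using ex assms by (auto simp: rule_fm_def free_vars_foldr_Quant wf_rule_def)
  have "quantified (rule_fm \<rho>) = ex_vars \<rho>"
    using literal_simps(1)[OF lit] by (auto simp: rule_fm_def quantified_foldr_Quant)
  then show "vars (rule_fm \<rho>) = body_vars \<rho>" using vars_eq[of "rule_fm \<rho>"] free ex assms
    by (auto simp: wf_rule_def)
qed

lemma rule_instanceE:
  assumes wf: "wf_rule ar \<rho>" and "rule_instance \<rho> xs \<psi>"
  obtains \<sigma> where "map \<sigma> (head_vars \<rho>) = xs" "inj_on \<sigma> (set (ex_vars \<rho>))" "\<sigma> ` set (ex_vars \<rho>) \<inter> set xs = {}"
    "\<psi> = foldr (Quant Exists) (map \<sigma> (ex_vars \<rho>)) (Conj (map (map_fm id \<sigma>) (body \<rho>)))"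
    "quantified \<psi> = map \<sigma> (ex_vars \<rho>)" "free_vars \<psi> = set xs"
proof -
  obtain \<sigma> where \<sigma>: "map \<sigma> (head_vars \<rho>) = xs" "inj_on \<sigma> (set (ex_vars \<rho>))" "\<sigma> ` set (ex_vars \<rho>) \<inter> set xs = {}"
    "\<psi> = map_fm id \<sigma> (rule_fm \<rho>)" using assms(2) by (auto simp: rule_instance_def)
  then have \<psi>: "\<psi> = foldr (Quant Exists) (map \<sigma> (ex_vars \<rho>)) (Conj (map (map_fm id \<sigma>) (body \<rho>)))"
    by (simp add: rule_fm_def map_fm_foldr_Quant)
  have lit: "is_literal (map_fm id \<sigma> l)" if "l \<in> set (body \<rho>)" for l
    using wf that by (auto simp: wf_rule_def is_literal_map)
  have "quantified \<psi> = map \<sigma> (ex_vars \<rho>)"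
    using literal_simps(1)[OF lit] by (auto simp: \<psi> quantified_foldr_Quant)
  moreover have "free_vars (Conj (map (map_fm id \<sigma>) (body \<rho>))) = \<sigma> ` body_vars \<rho>"
    using literal_simps(2)[OF lit] by (auto simp: body_vars_def fm.set_map)
  then have "free_vars \<psi> = set xs" using \<sigma>(1,3) rule_fm_simps(3)[OF wf] wf
    by (auto simp: \<psi> free_vars_foldr_Quant wf_rule_def simp flip: \<sigma>(1))
  ultimately show thesis using that \<sigma> \<psi> by blast
qed

lemma rule_instance_no_vacuous:
  assumes wf: "wf_rule ar \<rho>" and inst: "rule_instance \<rho> xs \<psi>"
  shows "no_vacuous \<psi>"
proof -
  from wf inst obtain \<sigma> where "map \<sigma> (head_vars \<rho>) = xs" and \<sigma>: "inj_on \<sigma> (set (ex_vars \<rho>))" 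
    and "\<sigma> ` set (ex_vars \<rho>) \<inter> set xs = {}"
    and \<psi>: "\<psi> = foldr (Quant Exists) (map \<sigma> (ex_vars \<rho>)) (Conj (map (map_fm id \<sigma>) (body \<rho>)))"
    and "quantified \<psi> = map \<sigma> (ex_vars \<rho>)" "free_vars \<psi> = set xs" by (rule rule_instanceE)
  let ?\<beta> = "Conj (map (map_fm id \<sigma>) (body \<rho>))"
  have lit: "is_literal (map_fm id \<sigma> l)" if "l \<in> set (body \<rho>)" for l
    using wf that by (auto simp: wf_rule_def is_literal_map)
  have \<beta>: "no_vacuous ?\<beta>" using literal_simps(3)[OF lit] by (auto simp: no_vacuous_def)
  have free: "free_vars ?\<beta> = \<sigma> ` body_vars \<rho>"
    using literal_simps(2)[OF lit] by (auto simp: body_vars_def fm.set_map)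
  have "no_vacuous (foldr (Quant Exists) ys ?\<beta>)" if "distinct ys" "set ys \<subseteq> free_vars ?\<beta>" for ys
    using that
  proof (induction ys)
    case (Cons y ys)
    then show ?case by (auto simp: no_vacuous_def free_vars_foldr_Quant)
  qed (use \<beta> in simp)
  moreover have "distinct (map \<sigma> (ex_vars \<rho>))" using \<sigma> by (simp add: distinct_map ex_vars_def)
  moreover have "set (map \<sigma> (ex_vars \<rho>)) \<subseteq> free_vars ?\<beta>" using free rule_fm_simps(3)[OF wf] by auto
  ultimately show ?thesis unfolding \<psi> by blast
qed

lemma def_instance_simps:
  assumes wf: "\<forall>P\<in>set \<Pi>. \<forall>\<rho>\<in>P. wf_rule ar \<rho>" and inst: "def_instance \<Pi> R xs \<psi>"
  shows "free_vars \<psi> = set xs" "no_vacuous \<psi>"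
proof -
  obtain P \<rho>s \<psi>s where P: "P \<in> set \<Pi>" "R \<in> heads P" "set \<rho>s = {\<rho> \<in> P. head_sym \<rho> = R}"
    "list_all2 (\<lambda>\<rho>. rule_instance \<rho> xs) \<rho>s \<psi>s" "\<psi> = Disj \<psi>s"
    using inst unfolding def_instance_def by blast
  have *: "free_vars \<psi>' = set xs \<and> no_vacuous \<psi>'" if \<psi>': "\<psi>' \<in> set \<psi>s" for \<psi>'
  proof -
    obtain i where i: "i < length \<psi>s" "\<psi>' = \<psi>s ! i" using \<psi>' by (auto simp: in_set_conv_nth)
    have len: "length \<rho>s = length \<psi>s" using P(4) by (rule list_all2_lengthD)
    then have inst: "rule_instance (\<rho>s ! i) xs \<psi>'" using list_all2_nthD2[OF P(4) i(1)] i(2) by simp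
    have "\<rho>s ! i \<in> set \<rho>s" using i len by simp
    then have wf': "wf_rule ar (\<rho>s ! i)" using P wf by blast
    show ?thesis using rule_instance_no_vacuous[OF wf' inst]
      by (rule_tac rule_instanceE[OF wf' inst]) simp
  qed
  \<comment> \<open>An empty disjunction would have no free variables; it cannot occur because
    \<open>R\<close> is the head of some rule.\<close>
  have "\<rho>s \<noteq> []" using P(2,3) by (auto simp: heads_def)
  then have "\<psi>s \<noteq> []" using P(4) by auto
  then show "free_vars \<psi> = set xs" using * P(5) by (cases \<psi>s) auto
  show "no_vacuous \<psi>" using * P(5) by simp
qed

lemma expands_free:
  assumes "expands \<Pi> \<psi> \<chi>" "\<forall>P\<in>set \<Pi>. \<forall>\<rho>\<in>P. wf_rule ar \<rho>"
  shows "free_vars \<chi> = free_vars \<psi> \<and> (no_vacuous \<psi> \<longrightarrow> no_vacuous \<chi>)"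
  using assms(1)
proof (induction rule: expands.induct)
  case (Rel_int R xs \<psi> \<chi>)
  then show ?case using def_instance_simps[OF assms(2) Rel_int.hyps(2)] by simp
next
  case (Conj \<psi>s \<chi>s)
  then show ?case
  proof (induction rule: list_all2_induct)
    case (Cons \<psi> \<psi>s \<chi> \<chi>s)
    then show ?case by simp
  qed simp
next
  case (Disj \<psi>s \<chi>s)
  then show ?case
  proof (induction rule: list_all2_induct)
    case (Cons \<psi> \<psi>s \<chi> \<chi>s)
    then show ?case by simp
  qed simp
qed (auto simp: no_vacuous_def)

section \<open>Gluing elimination orders\<close>

text \<open>An elimination scheme for the variables that an expansion adds to a formula: \<open>F\<close> and \<open>P\<close> are the
  free and the bound variables of the formula before, \<open>V\<close> and \<open>A\<close> are the bound variables and the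
  subformulas of the formula after the expansion. \<open>E x y\<close> states that \<open>x\<close> is a lower neighbour
  of \<open>y\<close>. Pairs of old variables are not covered by \<open>E\<close>; that they may be treated as
  adjacent is expressed by \<open>C\<close>.\<close>

definition scheme :: "int \<Rightarrow> (nat \<Rightarrow> nat \<Rightarrow> bool) \<Rightarrow> nat set \<Rightarrow> nat set \<Rightarrow> nat set \<Rightarrow> 'r formula set \<Rightarrow>
    (nat \<Rightarrow> nat \<Rightarrow> bool) \<Rightarrow> (nat \<Rightarrow> nat) \<Rightarrow> bool" where
  "scheme k C F P V A E r \<longleftrightarrow>
     (\<forall>x y. E x y \<longrightarrow> y \<in> V - P \<and> x \<in> F \<union> V) \<and>
     (\<forall>x y. E x y \<longrightarrow> x \<in> V - P \<longrightarrow> r x < r y) \<and>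
     (\<forall>x y z. E x y \<longrightarrow> E z y \<longrightarrow> x \<noteq> z \<longrightarrow> E x z \<or> E z x \<or> C x z) \<and>
     (\<forall>y\<in>V - P. int (card {x. E x y}) \<le> k) \<and>
     (\<forall>x y. E x y \<longrightarrow> x \<in> V \<longrightarrow> precedes A x y) \<and>
     (\<forall>\<alpha>\<in>A. is_atom \<alpha> \<longrightarrow> (\<forall>x\<in>vars \<alpha>. \<forall>y\<in>vars \<alpha>. x \<noteq> y \<longrightarrow> E x y \<or> E y x \<or> C x y))"

lemma schemeI:
  assumes "\<And>x y. E x y \<Longrightarrow> y \<in> V - P \<and> x \<in> F \<union> V"
    "\<And>x y. E x y \<Longrightarrow> x \<in> V - P \<Longrightarrow> r x < r y"
    "\<And>x y z. E x y \<Longrightarrow> E z y \<Longrightarrow> x \<noteq> z \<Longrightarrow> E x z \<or> E z x \<or> C x z"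
    "\<And>y. y \<in> V - P \<Longrightarrow> int (card {x. E x y}) \<le> k"
    "\<And>x y. E x y \<Longrightarrow> x \<in> V \<Longrightarrow> precedes A x y"
    "\<And>\<alpha> x y. \<alpha> \<in> A \<Longrightarrow> is_atom \<alpha> \<Longrightarrow> x \<in> vars \<alpha> \<Longrightarrow> y \<in> vars \<alpha> \<Longrightarrow> x \<noteq> y \<Longrightarrow> E x y \<or> E y x \<or> C x y"
  shows "scheme k C F P V A E r"
  using assms unfolding scheme_def by blast

lemma schemeD:
  assumes "scheme k C F P V A E r"
  shows "\<And>x y. E x y \<Longrightarrow> y \<in> V - P \<and> x \<in> F \<union> V"
    "\<And>x y. E x y \<Longrightarrow> x \<in> V - P \<Longrightarrow> r x < r y"
    "\<And>x y z. E x y \<Longrightarrow> E z y \<Longrightarrow> x \<noteq> z \<Longrightarrow> E x z \<or> E z x \<or> C x z"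
    "\<And>y. y \<in> V - P \<Longrightarrow> int (card {x. E x y}) \<le> k"
    "\<And>x y. E x y \<Longrightarrow> x \<in> V \<Longrightarrow> precedes A x y"
    "\<And>\<alpha> x y. \<alpha> \<in> A \<Longrightarrow> is_atom \<alpha> \<Longrightarrow> x \<in> vars \<alpha> \<Longrightarrow> y \<in> vars \<alpha> \<Longrightarrow> x \<noteq> y \<Longrightarrow> E x y \<or> E y x \<or> C x y"
  using assms unfolding scheme_def by blast+

lemma scheme_insert:
  assumes "scheme k C F P V A E r" "\<not> is_atom \<beta>"
  shows "scheme k C F P V (insert \<beta> A) E r"
proof (rule schemeI)
  fix x y assume "E x y" "x \<in> V"
  then show "precedes (insert \<beta> A) x y" using schemeD(5)[OF assms(1)] precedes_mono by blast
qed (use schemeD(1-4,6)[OF assms(1)] assms(2) in blast)+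

text \<open>Siblings bind disjoint sets of variables, so all lower neighbours of one
  \<open>y\<close> come from the same scheme.\<close>

lemma scheme_union:
  assumes 1: "scheme k C F1 P1 V1 A1 E1 r1" and 2: "scheme k C F2 P2 V2 A2 E2 r2"
    and PV: "P1 \<subseteq> V1" "P2 \<subseteq> V2" and disj: "V1 \<inter> V2 = {}" "(F1 \<union> F2) \<inter> (V1 \<union> V2) = {}"
  shows "scheme k C (F1 \<union> F2) (P1 \<union> P2) (V1 \<union> V2) (A1 \<union> A2)
    (\<lambda>x y. E1 x y \<or> E2 x y) (\<lambda>v. if v \<in> V1 then r1 v else r2 v)"
proof (rule schemeI)
  fix x y assume E: "E1 x y \<or> E2 x y"
  then show "y \<in> V1 \<union> V2 - (P1 \<union> P2) \<and> x \<in> F1 \<union> F2 \<union> (V1 \<union> V2)"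
    using schemeD(1)[OF 1, of x y] schemeD(1)[OF 2, of x y] PV disj by blast
  {
    assume "x \<in> V1 \<union> V2 - (P1 \<union> P2)"
    then show "(if x \<in> V1 then r1 x else r2 x) < (if y \<in> V1 then r1 y else r2 y)"
      using E schemeD(1,2)[OF 1, of x y] schemeD(1,2)[OF 2, of x y] disj by auto
  }
  assume "x \<in> V1 \<union> V2"
  then have "precedes A1 x y \<or> precedes A2 x y"
    using E schemeD(1,5)[OF 1, of x y] schemeD(1,5)[OF 2, of x y] disj by blast
  then show "precedes (A1 \<union> A2) x y" using precedes_mono by blast
next
  fix x y z assume E: "E1 x y \<or> E2 x y" "E1 z y \<or> E2 z y" "x \<noteq> z"
  then have "E1 x y \<and> E1 z y \<or> E2 x y \<and> E2 z y"
    using schemeD(1)[OF 1, of _ y] schemeD(1)[OF 2, of _ y] disj(1) by blast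
  then show "(E1 x z \<or> E2 x z) \<or> (E1 z x \<or> E2 z x) \<or> C x z"
    using schemeD(3)[OF 1, of x y z] schemeD(3)[OF 2, of x y z] E(3) by blast
next
  fix y assume y: "y \<in> V1 \<union> V2 - (P1 \<union> P2)"
  show "int (card {x. E1 x y \<or> E2 x y}) \<le> k"
  proof (cases "y \<in> V1")
    case True
    then have "{x. E1 x y \<or> E2 x y} = {x. E1 x y}" using schemeD(1)[OF 2, of _ y] disj by blast
    then show ?thesis using schemeD(4)[OF 1, of y] y True by simp
  next
    case False
    then have "{x. E1 x y \<or> E2 x y} = {x. E2 x y}" using schemeD(1)[OF 1, of _ y] by blast
    then show ?thesis using schemeD(4)[OF 2, of y] y False by simp
  qed
next
  fix \<alpha> x y assume "\<alpha> \<in> A1 \<union> A2" "is_atom \<alpha>" "x \<in> vars \<alpha>" "y \<in> vars \<alpha>" "x \<noteq> y"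
  then show "(E1 x y \<or> E2 x y) \<or> (E1 y x \<or> E2 y x) \<or> C x y"
    using schemeD(6)[OF 1, of \<alpha> x y] schemeD(6)[OF 2, of \<alpha> x y] by blast
qed

text \<open>General in \<open>P\<close> and \<open>F\<close> to serve both the rules of a
  definition, where all bound variables are new, and lists of subformulas under expansion.\<close>

lemma scheme_list:
  assumes "list_all2 (\<lambda>\<psi> \<chi>. P \<psi> \<subseteq> bound_vars \<chi> \<and>
    (\<exists>E r. scheme k C (F \<psi>) (P \<psi>) (bound_vars \<chi>) (subfms \<chi>) E r)) \<psi>s \<chi>s"
    "distinct (concat (map quantified \<chi>s))" "(\<Union>\<psi>\<in>set \<psi>s. F \<psi>) \<inter> (\<Union>\<chi>\<in>set \<chi>s. bound_vars \<chi>) = {}"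
  shows "(\<Union>\<psi>\<in>set \<psi>s. P \<psi>) \<subseteq> (\<Union>\<chi>\<in>set \<chi>s. bound_vars \<chi>) \<and>
    (\<exists>E r. scheme k C (\<Union>\<psi>\<in>set \<psi>s. F \<psi>) (\<Union>\<psi>\<in>set \<psi>s. P \<psi>) (\<Union>\<chi>\<in>set \<chi>s. bound_vars \<chi>) (\<Union>\<chi>\<in>set \<chi>s. subfms \<chi>) E r)"
  using assms
proof (induction rule: list_all2_induct)
  case Nil
  show ?case by (auto intro!: exI[of _ "\<lambda>_ _. False"] simp: scheme_def)
next
  case (Cons \<psi> \<psi>s \<chi> \<chi>s)
  have disj: "bound_vars \<chi> \<inter> (\<Union>\<chi>\<in>set \<chi>s. bound_vars \<chi>) = {}" using Cons.prems(1) by auto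
  have "distinct (concat (map quantified \<chi>s))" "(\<Union>\<psi>\<in>set \<psi>s. F \<psi>) \<inter> (\<Union>\<chi>\<in>set \<chi>s. bound_vars \<chi>) = {}"
    using Cons.prems by auto
  from Cons.IH[OF this] obtain E2 r2 where
    2: "(\<Union>\<psi>\<in>set \<psi>s. P \<psi>) \<subseteq> (\<Union>\<chi>\<in>set \<chi>s. bound_vars \<chi>)"
    "scheme k C (\<Union>\<psi>\<in>set \<psi>s. F \<psi>) (\<Union>\<psi>\<in>set \<psi>s. P \<psi>) (\<Union>\<chi>\<in>set \<chi>s. bound_vars \<chi>) (\<Union>\<chi>\<in>set \<chi>s. subfms \<chi>) E2 r2" by blast
  obtain E1 r1 where 1: "P \<psi> \<subseteq> bound_vars \<chi>" "scheme k C (F \<psi>) (P \<psi>) (bound_vars \<chi>) (subfms \<chi>) E1 r1"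
    using Cons.hyps by blast
  have "(F \<psi> \<union> (\<Union>\<psi>\<in>set \<psi>s. F \<psi>)) \<inter> (bound_vars \<chi> \<union> (\<Union>\<chi>\<in>set \<chi>s. bound_vars \<chi>)) = {}"
    using Cons.prems(2) by simp
  from scheme_union[OF 1(2) 2(2) 1(1) 2(1) disj this] show ?case using 1(1) 2(1) by auto
qed

text \<open>An elimination order of the rule graph that starts with the head variables is
  transported by \<open>\<sigma>\<close>. Merging head variables can only shrink sets of lower
  neighbours.\<close>

lemma rule_scheme:
  assumes wf: "wf_rule ar \<rho>" and tw: "tw (fm_graph (rule_fm \<rho>)) \<le> k" and inst: "rule_instance \<rho> xs \<psi>"
    and C: "\<And>x y. x \<in> set xs \<Longrightarrow> y \<in> set xs \<Longrightarrow> x \<noteq> y \<Longrightarrow> C x y"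
  shows "\<exists>E r. scheme k C (set xs) {} (bound_vars \<psi>) (subfms \<psi>) E r"
proof -
  let ?G = "fm_graph (rule_fm \<rho>)" and ?ex = "set (ex_vars \<rho>)" and ?hv = "set (head_vars \<rho>)"
  from wf inst obtain \<sigma> where \<sigma>: "map \<sigma> (head_vars \<rho>) = xs" "inj_on \<sigma> ?ex" "\<sigma> ` ?ex \<inter> set xs = {}"
    and \<psi>: "\<psi> = foldr (Quant Exists) (map \<sigma> (ex_vars \<rho>)) (Conj (map (map_fm id \<sigma>) (body \<rho>)))"
    and q: "quantified \<psi> = map \<sigma> (ex_vars \<rho>)" and "free_vars \<psi> = set xs" by (rule rule_instanceE)
  note R = rule_fm_simps[OF wf]
  have hv: "?hv \<subseteq> body_vars \<rho>" using wf by (simp add: wf_rule_def)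
  have V: "fst ?G = body_vars \<rho>" using R(1) fm_graph_simps(1) by metis
  have "\<forall>e\<in>snd ?G. e \<subseteq> fst ?G" using fm_graph_simps(2)[of _ "rule_fm \<rho>"] fm_graph_simps(1)[of "rule_fm \<rho>"] by fastforce
  moreover have "finite (fst ?G)" "?hv \<subseteq> fst ?G" using V R(4) hv by simp_all
  moreover have "adjacent ?G x y" if "x \<in> ?hv" "y \<in> ?hv" "x \<noteq> y" for x y
    using that R(2) unfolding adjacent_def fm_graph_def by auto
  ultimately obtain r where r: "inj_on r (fst ?G)" "\<forall>u\<in>?hv. \<forall>v\<in>fst ?G - ?hv. r u < r v"
     "\<forall>v\<in>fst ?G. int (card {u. lower_nbr ?G r u v}) \<le> tw ?G"
       using tw_rank_clique_first(2)[of ?G ?hv] by blast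
  have low: "u \<in> body_vars \<rho>" if "lower_nbr ?G r u v" for u v
    using that fm_graph_simps(2)[of _ "rule_fm \<rho>"] R(1) unfolding lower_nbr_def adjacent_def
    by (metis insertE insertI1 insertI2 insert_absorb doubleton_eq_iff)
  define E where "E x y \<longleftrightarrow> (\<exists>u v. lower_nbr ?G r u v \<and> v \<in> ?ex \<and> x = \<sigma> u \<and> y = \<sigma> v)" for x y
  have hv_xs: "\<sigma> u \<in> set xs" if "u \<in> ?hv" for u using that by (simp flip: \<sigma>(1))
  have split: "u \<in> ?hv \<or> u \<in> ?ex" if "u \<in> body_vars \<rho>" for u using that R(3) by blast
  \<comment> \<open>Head variables come first, so a lower neighbour of a head variable is a head
    variable; such pairs are left to \<open>C\<close>.\<close>
  have adj: "E (\<sigma> u) (\<sigma> v) \<or> E (\<sigma> v) (\<sigma> u) \<or> C (\<sigma> u) (\<sigma> v)"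
    if uv: "lower_nbr ?G r u v \<or> lower_nbr ?G r v u" "u \<in> body_vars \<rho>" "v \<in> body_vars \<rho>" "\<sigma> u \<noteq> \<sigma> v" for u v
  proof -
    have *: "E (\<sigma> u) (\<sigma> v) \<or> C (\<sigma> u) (\<sigma> v) \<and> C (\<sigma> v) (\<sigma> u)"
      if uv: "lower_nbr ?G r u v" "u \<in> body_vars \<rho>" "v \<in> body_vars \<rho>" "\<sigma> u \<noteq> \<sigma> v" for u v
    proof (cases "v \<in> ?ex")
      case True
      then show ?thesis using uv E_def by blast
    next
      case False
      then have v: "v \<in> ?hv" using split uv by blast
      have "u \<in> ?hv"
      proof (rule ccontr)
        assume "u \<notin> ?hv"
        then have "r v < r u" using r(2) v V uv by blast
        then show False using uv(1) by (simp add: lower_nbr_def)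
      qed
      then show ?thesis using C hv_xs v uv(4) by metis
    qed
    show ?thesis using uv *[of u v] *[of v u] by metis
  qed
  have bound: "bound_vars \<psi> = \<sigma> ` ?ex" using q by simp
  \<comment> \<open>Ranks are compared among existential variables only, and there
    \<open>\<sigma>\<close> is injective.\<close>
  have "scheme k C (set xs) {} (bound_vars \<psi>) (subfms \<psi>) E (\<lambda>y. r (inv_into ?ex \<sigma> y))"
  proof (rule schemeI)
    fix x y assume E: "E x y"
    then obtain u v where uv: "lower_nbr ?G r u v" "v \<in> ?ex" "x = \<sigma> u" "y = \<sigma> v" by (auto simp: E_def)
    have u: "u \<in> ?hv \<or> u \<in> ?ex" using split low uv by blast
    then show "y \<in> bound_vars \<psi> - {} \<and> x \<in> set xs \<union> bound_vars \<psi>" using uv hv_xs bound by auto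
    have *: "u \<in> ?ex" if "x \<in> bound_vars \<psi>" using that u uv hv_xs \<sigma>(3) bound by blast
    {
      assume "x \<in> bound_vars \<psi> - {}"
      then have "u \<in> ?ex" using * by simp
      then show "r (inv_into ?ex \<sigma> x) < r (inv_into ?ex \<sigma> y)"
        using uv \<sigma>(2) by (simp add: lower_nbr_def)
    }
    assume "x \<in> bound_vars \<psi>"
    then have "x \<in> set (map \<sigma> (ex_vars \<rho>))" "y \<in> set (map \<sigma> (ex_vars \<rho>))" using * uv by auto
    \<comment> \<open>Both variables belong to the one block of existential quantifiers, in
      whichever order.\<close>
    then show "precedes (subfms \<psi>) x y" using subfms_refl[of \<psi>] unfolding precedes_def \<psi> by blast
  next
    fix x y z assume "E x y" "E z y" "x \<noteq> z"
    then obtain u v u' v' where uv: "lower_nbr ?G r u v" "v \<in> ?ex" "x = \<sigma> u" "y = \<sigma> v"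
      "lower_nbr ?G r u' v'" "v' \<in> ?ex" "z = \<sigma> u'" "y = \<sigma> v'" by (auto simp: E_def)
    then have "v = v'" using \<sigma>(2) by (auto dest: inj_onD)
    moreover have "u \<noteq> u'" using uv \<open>x \<noteq> z\<close> by blast
    ultimately have "lower_nbr ?G r u u' \<or> lower_nbr ?G r u' u"
      using lower_nbr_chordal[OF r(1), of u v u'] uv low V by simp
    then show "E x z \<or> E z x \<or> C x z" using adj[of u u'] uv low \<open>x \<noteq> z\<close> by blast
  next
    fix y assume "y \<in> bound_vars \<psi> - {}"
    then obtain v where v: "v \<in> ?ex" "y = \<sigma> v" using bound by auto
    have "{x. E x y} \<subseteq> \<sigma> ` {u. lower_nbr ?G r u v}" using v \<sigma>(2) by (auto simp: E_def dest: inj_onD)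
    moreover have fin: "finite {u. lower_nbr ?G r u v}" using low R(4) by (auto intro: finite_subset)
    ultimately have "card {x. E x y} \<le> card {u. lower_nbr ?G r u v}" by (meson surj_card_le)
    moreover have "int (card {u. lower_nbr ?G r u v}) \<le> tw ?G" using r(3) V v R(3) by auto
    ultimately show "int (card {x. E x y}) \<le> k" using tw by linarith
  next
    fix \<alpha> x y assume \<alpha>: "\<alpha> \<in> subfms \<psi>" "is_atom \<alpha>" and xy: "x \<in> vars \<alpha>" "y \<in> vars \<alpha>" "x \<noteq> y"
    then have "\<alpha> \<in> subfms (Conj (map (map_fm id \<sigma>) (body \<rho>)))" using atoms_foldr_Quant \<psi> by blast
    then obtain l where l: "l \<in> set (body \<rho>)" "\<alpha> \<in> subfms (map_fm id \<sigma> l)" using \<alpha>(2) by auto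
    have "x \<in> vars (map_fm id \<sigma> l)" "y \<in> vars (map_fm id \<sigma> l)" using subfms_vars[OF l(2)] xy by auto
    then obtain u v where uv: "u \<in> vars l" "v \<in> vars l" "x = \<sigma> u" "y = \<sigma> v" by (auto simp: fm.set_map)
    have "is_literal l" using wf l(1) by (simp add: wf_rule_def)
    then obtain \<beta> where \<beta>: "\<beta> \<in> subfms l" "is_atom \<beta>" "vars \<beta> = vars l" using literal_simps(4) by blast
    then have "\<beta> \<in> subfms (Conj (body \<rho>))" using l(1) by auto
    then have "\<beta> \<in> subfms (rule_fm \<rho>)" using atoms_foldr_Quant[OF \<beta>(2)] unfolding rule_fm_def by blast
    then have "adjacent ?G u v" using uv \<beta> xy(3) unfolding adjacent_def fm_graph_def by auto
    moreover have b: "u \<in> body_vars \<rho>" "v \<in> body_vars \<rho>" using l(1) uv by (auto simp: body_vars_def)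
    then have "r u \<noteq> r v" using r(1) V uv xy(3) by (auto dest: inj_onD)
    ultimately have "lower_nbr ?G r u v \<or> lower_nbr ?G r v u"
      using adjacent_lower_nbr adjacent_sym by (meson linorder_neqE_nat)
    then show "E x y \<or> E y x \<or> C x y" using adj b uv xy(3) by blast
  qed
  then show ?thesis by blast
qed

lemma def_scheme:
  assumes rules: "\<forall>P\<in>set \<Pi>. \<forall>\<rho>\<in>P. wf_rule ar \<rho> \<and> tw (fm_graph (rule_fm \<rho>)) \<le> k"
    and inst: "def_instance \<Pi> R xs \<psi>" and dist: "distinct (quantified \<psi>)" "set xs \<inter> bound_vars \<psi> = {}"
    and C: "\<And>x y. x \<in> set xs \<Longrightarrow> y \<in> set xs \<Longrightarrow> x \<noteq> y \<Longrightarrow> C x y"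
  shows "\<exists>E r. scheme k C (set xs) {} (bound_vars \<psi>) (subfms \<psi>) E r"
proof -
  obtain P \<rho>s \<psi>s where P: "P \<in> set \<Pi>" "R \<in> heads P" "set \<rho>s = {\<rho> \<in> P. head_sym \<rho> = R}"
    "list_all2 (\<lambda>\<rho>. rule_instance \<rho> xs) \<rho>s \<psi>s" and \<psi>: "\<psi> = Disj \<psi>s"
    using inst unfolding def_instance_def by blast
  have "list_all2 (\<lambda>\<rho> \<psi>'. {} \<subseteq> bound_vars \<psi>' \<and>
    (\<exists>E r. scheme k C (set xs) {} (bound_vars \<psi>') (subfms \<psi>') E r)) \<rho>s \<psi>s"
  proof (rule list.rel_mono_strong[OF P(4)])
    fix \<rho> \<psi>' assume "\<rho> \<in> set \<rho>s" and i: "rule_instance \<rho> xs \<psi>'"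
    then have "wf_rule ar \<rho>" "tw (fm_graph (rule_fm \<rho>)) \<le> k" using rules P(1,3) by blast+
    then show "{} \<subseteq> bound_vars \<psi>' \<and> (\<exists>E r. scheme k C (set xs) {} (bound_vars \<psi>') (subfms \<psi>') E r)"
      using rule_scheme[OF _ _ i, of ar k C] C by blast
  qed
  moreover have "distinct (concat (map quantified \<psi>s))" "(\<Union>\<rho>\<in>set \<rho>s. set xs) \<inter> (\<Union>\<psi>\<in>set \<psi>s. bound_vars \<psi>) = {}"
    using dist \<psi> by auto
  ultimately obtain E r where "scheme k C (\<Union>\<rho>\<in>set \<rho>s. set xs) (\<Union>\<rho>\<in>set \<rho>s. {}) (\<Union>\<psi>\<in>set \<psi>s. bound_vars \<psi>) (\<Union>\<psi>\<in>set \<psi>s. subfms \<psi>) E r"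
    using scheme_list[of "\<lambda>_. {}" k C "\<lambda>_. set xs" \<rho>s \<psi>s] by blast
  moreover have "set \<rho>s \<noteq> {}" using P(2,3) by (auto simp: heads_def)
  ultimately have "scheme k C (set xs) {} (bound_vars \<psi>) (\<Union>\<psi>\<in>set \<psi>s. subfms \<psi>) E r" using \<psi> by simp
  from scheme_insert[OF this, of "Disj \<psi>s"] show ?thesis unfolding \<psi> by simp blast
qed

text \<open>The lower neighbours of a variable added deeper inside may be variables of \<open>\<psi>\<close>; these occur in a
  common atom of \<open>\<psi>\<close>, so they are already adjacent in the scheme for \<open>\<psi>\<close>.\<close>

lemma scheme_compose:
  assumes ex: "expands \<Pi> \<psi> \<chi>"
    and 1: "scheme k C F {} (bound_vars \<psi>) (subfms \<psi>) E1 r1"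
    and 2: "scheme k (\<lambda>x z. E1 x z \<or> E1 z x \<or> C x z) F (bound_vars \<psi>) (bound_vars \<chi>) (subfms \<chi>) E2 r2"
    and disj: "F \<inter> bound_vars \<chi> = {}"
  shows "\<exists>E r. scheme k C F {} (bound_vars \<chi>) (subfms \<chi>) E r"
proof -
  \<comment> \<open>\<open>M\<close> lifts the ranks of the variables added by the expansion above
    those of \<open>\<psi>\<close>.\<close>
  define M where "M = Suc (Max (insert 0 (r1 ` bound_vars \<psi>)))"
  have M: "r1 v < M" if "v \<in> bound_vars \<psi>" for v
    using Max_ge[of "insert 0 (r1 ` bound_vars \<psi>)" "r1 v"] that by (simp add: M_def le_imp_less_Suc)
  have sub: "bound_vars \<psi> \<subseteq> bound_vars \<chi>" using expands_bound[OF ex] .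
  have "scheme k C F {} (bound_vars \<chi>) (subfms \<chi>) (\<lambda>x y. E1 x y \<or>
    E2 x y) (\<lambda>v. if v \<in> bound_vars \<psi> then r1 v else M + r2 v)"
  proof (rule schemeI)
    fix x y assume E: "E1 x y \<or> E2 x y"
    then show "y \<in> bound_vars \<chi> - {} \<and> x \<in> F \<union> bound_vars \<chi>"
      using schemeD(1)[OF 1, of x y] schemeD(1)[OF 2, of x y] sub by blast
    {
      assume x: "x \<in> bound_vars \<chi> - {}"
      show "(if x \<in> bound_vars \<psi> then r1 x else M + r2 x) < (if y \<in> bound_vars \<psi> then r1 y else M + r2 y)"
      proof (cases "E1 x y")
        case True
        then have "x \<in> bound_vars \<psi>" "y \<in> bound_vars \<psi>" using schemeD(1)[OF 1 True] x disj by blast+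
        then show ?thesis using schemeD(2)[OF 1 True] by simp
      next
        case False
        then have E2: "E2 x y" using E by simp
        then show ?thesis using schemeD(1,2)[OF 2 E2] M[of x] x by auto
      qed
    }
    assume x: "x \<in> bound_vars \<chi>"
    show "precedes (subfms \<chi>) x y"
    proof (cases "E1 x y")
      case True
      then have "x \<in> bound_vars \<psi>" using schemeD(1)[OF 1 True] x disj by blast
      then show ?thesis using schemeD(5)[OF 1 True] precedes_expands[OF ex] by blast
    next
      case False
      then show ?thesis using schemeD(5)[OF 2 _ x] E by blast
    qed
  next
    fix x y z assume E: "E1 x y \<or> E2 x y" "E1 z y \<or> E2 z y" "x \<noteq> z"
    \<comment> \<open>Whether \<open>y\<close> is bound in \<open>\<psi>\<close> or added later
      decides to which scheme both pairs belong.\<close>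
    then have "E1 x y \<and> E1 z y \<or> E2 x y \<and> E2 z y"
      using schemeD(1)[OF 1, of _ y] schemeD(1)[OF 2, of _ y] by blast
    then show "(E1 x z \<or> E2 x z) \<or> (E1 z x \<or> E2 z x) \<or> C x z"
      using schemeD(3)[OF 1, of x y z] schemeD(3)[OF 2, of x y z] E(3) by blast
  next
    fix y assume y: "y \<in> bound_vars \<chi> - {}"
    show "int (card {x. E1 x y \<or> E2 x y}) \<le> k"
    proof (cases "y \<in> bound_vars \<psi>")
      case True
      then have "{x. E1 x y \<or> E2 x y} = {x. E1 x y}" using schemeD(1)[OF 2, of _ y] by blast
      then show ?thesis using schemeD(4)[OF 1, of y] True by simp
    next
      case False
      then have "{x. E1 x y \<or> E2 x y} = {x. E2 x y}" using schemeD(1)[OF 1, of _ y] by blast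
      then show ?thesis using schemeD(4)[OF 2, of y] y False by simp
    qed
  next
    fix \<alpha> x y assume "\<alpha> \<in> subfms \<chi>" "is_atom \<alpha>" "x \<in> vars \<alpha>" "y \<in> vars \<alpha>" "x \<noteq> y"
    then show "(E1 x y \<or> E2 x y) \<or> (E1 y x \<or> E2 y x) \<or> C x y"
      using schemeD(6)[OF 2, of \<alpha> x y] by blast
  qed
  then show ?thesis by blast
qed

section \<open>Schemes for arbitrary expansions, and their completion by the free variables\<close>

definition atoms_covered :: "(nat \<Rightarrow> nat \<Rightarrow> bool) \<Rightarrow> 'r formula \<Rightarrow> bool" where
  "atoms_covered C \<psi> \<longleftrightarrow> (\<forall>\<alpha>\<in>subfms \<psi>. is_atom \<alpha> \<longrightarrow> (\<forall>x\<in>vars \<alpha>. \<forall>y\<in>vars \<alpha>. x \<noteq> y \<longrightarrow> C x y))"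

lemma scheme_unexpanded: "atoms_covered C \<psi> \<Longrightarrow>
  \<exists>E r. scheme k C F (bound_vars \<psi>) (bound_vars \<psi>) (subfms \<psi>) E r"
  by (rule exI[of _ "\<lambda>_ _. False"]) (auto simp: scheme_def atoms_covered_def)

text \<open>\<open>C\<close> varies in the induction: when an atom is unfolded, the adjacencies
  created by its rule instances count as given for the expansions inside.\<close>

lemma expands_scheme:
  assumes rules: "\<forall>P\<in>set \<Pi>. \<forall>\<rho>\<in>P. wf_rule ar \<rho> \<and> tw (fm_graph (rule_fm \<rho>)) \<le> k"
    and "expands \<Pi> \<psi> \<chi>" "distinct (quantified \<chi>)" "free_vars \<psi> \<inter> bound_vars \<chi> = {}" "atoms_covered C \<psi>"
  shows "\<exists>E r. scheme k C (free_vars \<psi>) (bound_vars \<psi>) (bound_vars \<chi>) (subfms \<chi>) E r"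
  using assms(2-)
proof (induction arbitrary: C rule: expands.induct)
  case (Rel_ext R xs)
  then show ?case using scheme_unexpanded by blast
next
  case (Eq x y)
  then show ?case using scheme_unexpanded by blast
next
  case (Rel_int R xs \<psi> \<chi>)
  have wf: "\<forall>P\<in>set \<Pi>. \<forall>\<rho>\<in>P. wf_rule ar \<rho>" using rules by blast
  have free: "free_vars \<psi> = set xs" using def_instance_simps(1)[OF wf Rel_int.hyps(2)] .
  have disj: "set xs \<inter> bound_vars \<chi> = {}" using Rel_int.prems(2) by simp
  have dist: "distinct (quantified \<psi>)" "set xs \<inter> bound_vars \<psi> = {}"
    using expands_distinct[OF Rel_int.hyps(3) Rel_int.prems(1)] expands_bound[OF Rel_int.hyps(3)] disj by blast+
  have C: "C x y" if "x \<in> set xs" "y \<in> set xs" "x \<noteq> y" for x y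
    using Rel_int.prems(3) that by (auto simp: atoms_covered_def)
  obtain E1 r1 where 1: "scheme k C (set xs) {} (bound_vars \<psi>) (subfms \<psi>) E1 r1"
    using def_scheme[of \<Pi> ar k R xs \<psi> C, OF rules Rel_int.hyps(2) dist] C by blast
  \<comment> \<open>Each atom of the instance is a clique for \<open>E1\<close> and \<open>C\<close>
    together, so this relation is the \<open>C\<close> of the induction hypothesis.\<close>
  have cov: "atoms_covered (\<lambda>x z. E1 x z \<or> E1 z x \<or> C x z) \<psi>"
    using schemeD(6)[OF 1] unfolding atoms_covered_def by blast
  have "free_vars \<psi> \<inter> bound_vars \<chi> = {}" using disj free by simp
  from Rel_int.IH[OF Rel_int.prems(1) this cov] obtain E2 r2
    where "scheme k (\<lambda>x z. E1 x z \<or> E1 z x \<or>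
      C x z) (set xs) (bound_vars \<psi>) (bound_vars \<chi>) (subfms \<chi>) E2 r2"
    unfolding free by blast
  from scheme_compose[OF Rel_int.hyps(3) 1 this disj] show ?case by simp
next
  case (Neg \<psi> \<chi>)
  have "atoms_covered C \<psi>" using Neg.prems(3) by (simp add: atoms_covered_def)
  then obtain E r where "scheme k C (free_vars \<psi>) (bound_vars \<psi>) (bound_vars \<chi>) (subfms \<chi>) E r"
    using Neg.IH[of C] Neg.prems by auto
  from scheme_insert[OF this, of "Neg \<chi>"] show ?case by simp blast
next
  case (Conj \<psi>s \<chi>s)
  have "list_all2 (\<lambda>\<psi> \<chi>. bound_vars \<psi> \<subseteq> bound_vars \<chi> \<and>
    (\<exists>E r. scheme k C (free_vars \<psi>) (bound_vars \<psi>) (bound_vars \<chi>) (subfms \<chi>) E r)) \<psi>s \<chi>s"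
  proof (rule list.rel_mono_strong[OF Conj.IH])
    fix \<psi> \<chi> assume in_set: "\<psi> \<in> set \<psi>s" "\<chi> \<in> set \<chi>s" and
      IH: "expands \<Pi> \<psi> \<chi> \<and> (distinct (quantified \<chi>) \<longrightarrow> free_vars \<psi> \<inter> bound_vars \<chi> = {} \<longrightarrow>
        (\<forall>C. atoms_covered C \<psi> \<longrightarrow> (\<exists>E r. scheme k C (free_vars \<psi>) (bound_vars \<psi>) (bound_vars \<chi>) (subfms \<chi>) E r)))"
    have "distinct (quantified \<chi>)" "free_vars \<psi> \<inter> bound_vars \<chi> = {}" "atoms_covered C \<psi>"
      using Conj.prems in_set by (auto simp: distinct_concat_iff atoms_covered_def)
    then show "bound_vars \<psi> \<subseteq> bound_vars \<chi> \<and>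
      (\<exists>E r. scheme k C (free_vars \<psi>) (bound_vars \<psi>) (bound_vars \<chi>) (subfms \<chi>) E r)"
      using IH expands_bound by blast
  qed
  then obtain E r where "scheme k C (\<Union>\<psi>\<in>set \<psi>s. free_vars \<psi>) (\<Union>\<psi>\<in>set \<psi>s. bound_vars \<psi>)
      (\<Union>\<chi>\<in>set \<chi>s. bound_vars \<chi>) (\<Union>\<chi>\<in>set \<chi>s. subfms \<chi>) E r"
    using scheme_list[of bound_vars k C free_vars \<psi>s \<chi>s] Conj.prems(1,2) by (simp, blast)
  from scheme_insert[OF this, of "Conj \<chi>s"] show ?case by simp blast
next
  case (Disj \<psi>s \<chi>s)
  have "list_all2 (\<lambda>\<psi> \<chi>. bound_vars \<psi> \<subseteq> bound_vars \<chi> \<and>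
    (\<exists>E r. scheme k C (free_vars \<psi>) (bound_vars \<psi>) (bound_vars \<chi>) (subfms \<chi>) E r)) \<psi>s \<chi>s"
  proof (rule list.rel_mono_strong[OF Disj.IH])
    fix \<psi> \<chi> assume in_set: "\<psi> \<in> set \<psi>s" "\<chi> \<in> set \<chi>s" and
      IH: "expands \<Pi> \<psi> \<chi> \<and> (distinct (quantified \<chi>) \<longrightarrow> free_vars \<psi> \<inter> bound_vars \<chi> = {} \<longrightarrow>
        (\<forall>C. atoms_covered C \<psi> \<longrightarrow> (\<exists>E r. scheme k C (free_vars \<psi>) (bound_vars \<psi>) (bound_vars \<chi>) (subfms \<chi>) E r)))"
    have "distinct (quantified \<chi>)" "free_vars \<psi> \<inter> bound_vars \<chi> = {}" "atoms_covered C \<psi>"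
      using Disj.prems in_set by (auto simp: distinct_concat_iff atoms_covered_def)
    then show "bound_vars \<psi> \<subseteq> bound_vars \<chi> \<and>
      (\<exists>E r. scheme k C (free_vars \<psi>) (bound_vars \<psi>) (bound_vars \<chi>) (subfms \<chi>) E r)"
      using IH expands_bound by blast
  qed
  then obtain E r where "scheme k C (\<Union>\<psi>\<in>set \<psi>s. free_vars \<psi>) (\<Union>\<psi>\<in>set \<psi>s. bound_vars \<psi>)
      (\<Union>\<chi>\<in>set \<chi>s. bound_vars \<chi>) (\<Union>\<chi>\<in>set \<chi>s. subfms \<chi>) E r"
    using scheme_list[of bound_vars k C free_vars \<psi>s \<chi>s] Disj.prems(1,2) by (simp, blast)
  from scheme_insert[OF this, of "Disj \<chi>s"] show ?case by simp blast
next
  case (Quant \<psi> \<chi> q v)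
  have v: "v \<notin> bound_vars \<chi>" using Quant.prems(1) by simp
  have "atoms_covered C \<psi>" using Quant.prems(3) by (simp add: atoms_covered_def)
  then obtain E r where *: "scheme k C (free_vars \<psi>) (bound_vars \<psi>) (bound_vars \<chi>) (subfms \<chi>) E r"
    using Quant.IH[of C] Quant.prems v by auto
  \<comment> \<open>\<open>v\<close> moves from the free to the old bound variables, so
    \<open>E\<close> stays the same. New is only that pairs \<open>E v y\<close> must satisfy
    \<open>precedes\<close>, and there \<open>y\<close> lies in the scope of
    \<open>v\<close>.\<close>
  have "scheme k C (free_vars \<psi> - {v}) (insert v (bound_vars \<psi>)) (insert v (bound_vars \<chi>)) (insert (Quant q v \<chi>) (subfms \<chi>)) E r"
  proof (rule schemeI)
    fix x y assume E: "E x y"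
    then show "y \<in> insert v (bound_vars \<chi>) - insert v (bound_vars \<psi>) \<and>
      x \<in> free_vars \<psi> - {v} \<union> insert v (bound_vars \<chi>)"
      using schemeD(1)[OF * E] v by blast
    {
      assume "x \<in> insert v (bound_vars \<chi>) - insert v (bound_vars \<psi>)"
      then show "r x < r y" using schemeD(2)[OF * E] by blast
    }
    assume x: "x \<in> insert v (bound_vars \<chi>)"
    show "precedes (insert (Quant q v \<chi>) (subfms \<chi>)) x y"
    proof (cases "x = v")
      case True
      then show ?thesis using schemeD(1)[OF * E] unfolding precedes_def by blast
    next
      case False
      then show ?thesis using schemeD(5)[OF * E] x precedes_mono by blast
    qed
  next
    fix y assume "y \<in> insert v (bound_vars \<chi>) - insert v (bound_vars \<psi>)"
    then show "int (card {x. E x y}) \<le> k" using schemeD(4)[OF *] by blast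
  next
    fix \<alpha> x y assume "\<alpha> \<in> insert (Quant q v \<chi>) (subfms \<chi>)" "is_atom \<alpha>" "x \<in> vars \<alpha>" "y \<in> vars \<alpha>" "x \<noteq> y"
    then show "E x y \<or> E y x \<or> C x y" using schemeD(6)[OF *, of \<alpha> x y] by auto
  qed (use schemeD(3)[OF *] in blast)
  then show ?case by simp blast
qed

theorem theorem6p5:
  fixes ar :: "'r \<Rightarrow> nat" and \<Pi> :: "'r program" and Q :: 'r and \<phi> :: "'r formula"
  assumes "nrsd_program ar \<Pi>"
    and "Q \<in> int_syms \<Pi>"
    and "program_fm \<Pi> Q \<phi>"
  shows "fotw \<phi> \<le> stratified_tw (fm_graph \<phi>) (ad' \<phi>)
       \<and> stratified_tw (fm_graph \<phi>) (ad' \<phi>) \<le> stw \<Pi>"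
proof
  obtain xs \<psi> \<chi> where inst: "def_instance \<Pi> Q xs \<psi>" and ex: "expands \<Pi> \<psi> \<chi>"
    and straight\<chi>: "straight \<chi>" and \<phi>: "\<phi> = nnf True \<chi>" using assms(3) by (auto simp: program_fm_def)
  define k where "k = stw \<Pi>"
  have wf: "\<forall>P\<in>set \<Pi>. \<forall>\<rho>\<in>P. wf_rule ar \<rho>" using assms(1) by (simp add: nrsd_program_def)
  have "finite (\<Union> (set \<Pi>))" using assms(1) by (simp add: nrsd_program_def)
  then have rules: "\<forall>P\<in>set \<Pi>. \<forall>\<rho>\<in>P. wf_rule ar \<rho> \<and> tw (fm_graph (rule_fm \<rho>)) \<le> k"
    using wf unfolding k_def stw_def stw_rule_def by (auto intro!: Max_ge)
  have straight: "straight \<phi>" using straight\<chi> by (simp add: straight_def \<phi>)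
  have free: "free_vars \<chi> = set xs" and vac: "no_vacuous \<chi>"
    using expands_free[OF ex wf] def_instance_simps[OF wf inst] by auto
  show "fotw \<phi> \<le> stratified_tw (fm_graph \<phi>) (ad' \<phi>)"
  proof (rule fotw_le_stratified_tw_ad'[OF straight])
    fix x assume "x \<in> bound_vars \<phi>"
    then show "\<exists>\<alpha>\<in>subfms \<phi>. is_atom \<alpha> \<and> x \<in> vars \<alpha>"
      using no_vacuous_atom[OF vac, of x] nnf_atoms \<phi> by fastforce
  qed
  let ?C = "\<lambda>x y. x \<in> set xs \<and> y \<in> set xs"
  \<comment> \<open>Seen as an expansion of the atom \<open>Rel Q xs\<close>, the formula has only
    new bound variables, and its first unfolding is no special case.\<close>
  have "expands \<Pi> (Rel Q xs) \<chi>" using assms(2) inst ex by (rule expands.Rel_int)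
  moreover have "distinct (quantified \<chi>)" "free_vars (Rel Q xs) \<inter> bound_vars \<chi> = {}" "atoms_covered ?C (Rel Q xs)"
    using straight\<chi> free by (auto simp: straight_def atoms_covered_def)
  ultimately obtain E r where E: "scheme k ?C (set xs) {} (bound_vars \<chi>) (subfms \<chi>) E r"
    using expands_scheme[OF rules] by fastforce
  have disj: "set xs \<inter> bound_vars \<chi> = {}" using straight\<chi> free by (simp add: straight_def)
  have vars: "fst (fm_graph \<phi>) = set xs \<union> bound_vars \<chi>"
    using vars_eq[of \<phi>] free fm_graph_simps(1)[of \<phi>] \<phi> by simp
  \<comment> \<open>The arguments have to be eliminated too. Some rule defines \<open>Q\<close>; its
    head variables form a clique of its graph and are mapped onto the arguments.\<close>
  have card_xs: "int (card (set xs)) \<le> k + 1"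
  proof -
    obtain P \<rho>s \<psi>s where P: "P \<in> set \<Pi>" "Q \<in> heads P" "set \<rho>s = {\<rho> \<in> P. head_sym \<rho> = Q}"
      "list_all2 (\<lambda>\<rho>. rule_instance \<rho> xs) \<rho>s \<psi>s"
      using inst unfolding def_instance_def by blast
    then obtain \<rho> \<rho>s' where \<rho>: "\<rho>s = \<rho> # \<rho>s'" "\<rho> \<in> P" by (cases \<rho>s) (auto simp: heads_def)
    then obtain \<psi>' where "rule_instance \<rho> xs \<psi>'" using P(4) by (auto simp: list_all2_Cons1)
    then obtain \<sigma> where "map \<sigma> (head_vars \<rho>) = xs" by (auto simp: rule_instance_def)
    then have "card (set xs) \<le> card (set (head_vars \<rho>))" by (metis card_image_le finite_set set_map)
    moreover have \<rho>': "wf_rule ar \<rho>" "tw (fm_graph (rule_fm \<rho>)) \<le> k" using rules P(1) \<rho>(2) by blast+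
    note R = rule_fm_simps[OF \<rho>'(1)]
    let ?G = "fm_graph (rule_fm \<rho>)"
    have "int (card (set (head_vars \<rho>))) \<le> tw ?G + 1"
    proof (rule tw_rank_clique_first(1))
      show "\<forall>e\<in>snd ?G. e \<subseteq> fst ?G"
        using fm_graph_simps(2)[of _ "rule_fm \<rho>"] fm_graph_simps(1)[of "rule_fm \<rho>"] by fastforce
      show "finite (fst ?G)" "set (head_vars \<rho>) \<subseteq> fst ?G"
        using R \<rho>'(1) fm_graph_simps(1)[of "rule_fm \<rho>"] by (simp_all add: wf_rule_def)
      show "adjacent ?G x y" if "x \<in> set (head_vars \<rho>)" "y \<in> set (head_vars \<rho>)" "x \<noteq> y" for x y
        using that R(2) unfolding adjacent_def fm_graph_def by auto
    qed
    ultimately show ?thesis using \<rho>'(2) by linarith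
  qed
  \<comment> \<open>Arguments are ranked by their own numbers, and \<open>M\<close> places all bound
    variables above them.\<close>
  define M where "M = Suc (Max (insert 0 (set xs)))"
  have M: "v < M" if "v \<in> set xs" for v using Max_ge[of "insert 0 (set xs)" v] that
    by (simp add: M_def le_imp_less_Suc)
  let ?E = "\<lambda>x y. E x y \<or> x \<in> set xs \<and> y \<in> set xs \<and> x < y"
  have "stratified_tw (fm_graph \<phi>) (ad' \<phi>) \<le> k"
  proof (rule elimination_decomposition[where E = ?E and r = "\<lambda>v. if v \<in> set xs then v else M + r v"])
    show "finite (fst (fm_graph \<phi>))" using vars by simp
  next
    fix e assume "e \<in> snd (fm_graph \<phi>)"
    then obtain x y where e: "e = {x, y}" "x \<noteq> y"
      "x \<in> free_vars \<phi> \<and> y \<in> free_vars \<phi> \<or> (\<exists>\<alpha> \<in> subfms \<phi>. is_atom \<alpha> \<and> x \<in> vars \<alpha> \<and> y \<in> vars \<alpha>)"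
      by (auto simp: fm_graph_def)
    have "E x y \<or> E y x \<or> ?C x y" using e(3)
    proof
      assume "x \<in> free_vars \<phi> \<and> y \<in> free_vars \<phi>"
      then show ?thesis using free \<phi> by simp
    next
      assume "\<exists>\<alpha> \<in> subfms \<phi>. is_atom \<alpha> \<and> x \<in> vars \<alpha> \<and> y \<in> vars \<alpha>"
      then obtain \<alpha> where "\<alpha> \<in> subfms \<chi>" "is_atom \<alpha>" "x \<in> vars \<alpha>" "y \<in> vars \<alpha>" using nnf_atoms \<phi>
        by blast
      then show ?thesis using schemeD(6)[OF E] e(2) by blast
    qed
    then have "?E x y \<or> ?E y x" using e(2) by auto
    then show "\<exists>x y. e = {x, y} \<and> ?E x y" using e(1) by (metis insert_commute)
  next
    fix x y assume xy: "?E x y"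
    show "x \<in> fst (fm_graph \<phi>) \<and> y \<in> fst (fm_graph \<phi>) \<and>
      (if x \<in> set xs then x else M + r x) < (if y \<in> set xs then y else M + r y) \<and> ad' \<phi> x \<le> ad' \<phi> y"
    proof (cases "E x y")
      case True
      note D = schemeD(1)[OF E True]
      have "y \<notin> set xs" using D disj by blast
      show ?thesis
      proof (cases "x \<in> set xs")
        case x: True
        then have "ad' \<phi> x = 0" using free \<phi> by (simp add: ad'_def)
        then show ?thesis using D x \<open>y \<notin> set xs\<close> M[OF x] vars by auto
      next
        case False
        then have x: "x \<in> bound_vars \<chi>" using D by blast
        have "r x < r y" using schemeD(2)[OF E True] x by blast
        moreover have "ad' \<phi> x \<le> ad' \<phi> y"
          using precedes_ad'[OF straight] precedes_nnf[OF schemeD(5)[OF E True x]] \<phi> by blast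
        ultimately show ?thesis using D x False \<open>y \<notin> set xs\<close> vars by auto
      qed
    next
      case False
      then have "x \<in> set xs" "y \<in> set xs" "x < y" using xy by auto
      moreover from this have "ad' \<phi> x = 0" using free \<phi> by (simp add: ad'_def)
      ultimately show ?thesis using vars by auto
    qed
  next
    fix x y z assume xyz: "?E x y" "?E z y" "x \<noteq> z"
    have "y \<notin> set xs" if "E u y" for u using schemeD(1)[OF E that] disj by blast
    then have "E x y \<and> E z y \<or> x \<in> set xs \<and> z \<in> set xs" using xyz by blast
    then show "?E x z \<or> ?E z x" using schemeD(3)[OF E, of x y z] xyz(3) by (metis linorder_neqE_nat)
  next
    fix y assume y: "y \<in> fst (fm_graph \<phi>)"
    show "int (card {x. ?E x y}) \<le> k"
    proof (cases "y \<in> set xs")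
      case True
      \<comment> \<open>The lower neighbours of an argument are other arguments, and leaving out
        \<open>y\<close> absorbs the 1 in \<open>card_xs\<close>.\<close>
      then have "{x. ?E x y} \<subseteq> set xs - {y}" using schemeD(1)[OF E, of _ y] disj by auto
      then have "card {x. ?E x y} \<le> card (set xs - {y})" by (intro card_mono) auto
      moreover have "card (set xs - {y}) = card (set xs) - 1" using True by simp
      moreover have "0 < card (set xs)" using True by (auto simp: card_gt_0_iff)
      ultimately show ?thesis using card_xs by linarith
    next
      case False
      then have "{x. ?E x y} = {x. E x y}" by auto
      then show ?thesis using schemeD(4)[OF E, of y] False y vars by auto
    qed
  next
    show "-1 \<le> k" using card_xs by linarith
  qed
  then show "stratified_tw (fm_graph \<phi>) (ad' \<phi>) \<le> stw \<Pi>" by (simp add: k_def)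
qed

end
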